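(* Let $(q_k,p_{k1},p_{k2})_{k\ge2}$ be real numbers with $q_k>0$, $p_{k1}\ge0$, $p_{k2}>0$ and $q_k+p_{k1}+p_{k2}=1$ for all $k\ge2$. Let $X$ and $Y$ be the (2,1) and (1,2) random walks defined in the context, and let $Z\in\{X,Y\}$. Suppose that $a_k\to a$ and $b_k\to b$ as $k\to\infty$ for some numbers $a>0$, $b>0$, that $a+b=1$, and that there exists $N_0>0$ such that $\varrho_k$ is increasing in $k\ge N_0$ when $Z=X$, and decreasing in $k\ge N_0$ when $Z=Y$. (1) If $\sum_{n=2}^\infty \frac{1}{D_Z(n)\log n}<\infty$, then almost surely $Z$ has at most finitely many cutpoints. (2) If there exists $\delta>0$ such that $D_Z(n)\le \delta n\log n$ for all $n$ large enough and $\sum_{n=2}^\infty \frac{1}{D_Z(n)\log n}=\infty$, then almost surely $Z$ has infinitely many cutpoints.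
   Context: $\mathbb Z_+=\{0,1,2,\dots\}$. The (2,1) random walk $X=(X_k)_{k\ge0}$ is the Markov chain on $\mathbb Z_+$ with $X_0=2$ and transition probabilities $P(X_{k+1}=1\mid X_k=0)=P(X_{k+1}=2\mid X_k=1)=1$ and, for $n\ge2$, $P(X_{k+1}=n+1\mid X_k=n)=q_n$, $P(X_{k+1}=n-1\mid X_k=n)=p_{n1}$, $P(X_{k+1}=n-2\mid X_k=n)=p_{n2}$. The (1,2) random walk $Y=(Y_k)_{k\ge0}$ is the Markov chain on $\mathbb Z_+$ with $Y_0=2$ and transition probabilities $P(Y_{k+1}=0\mid Y_k=1)=P(Y_{k+1}=2\mid Y_k=0)=1$ and, for $n\ge2$, $P(Y_{k+1}=n-1\mid Y_k=n)=q_n$, $P(Y_{k+1}=n+1\mid Y_k=n)=p_{n1}$, $P(Y_{k+1}=n+2\mid Y_k=n)=p_{n2}$. For $k\ge2$ set $a_k=(p_{k1}+p_{k2})/q_k$, $b_k=p_{k2}/q_k$ and $\varrho_k=\frac{a_k+\sqrt{a_k^2+4b_k}}{2}$. For $n\ge2$, $D_X(n)=1+\sum_{j=n+1}^\infty\prod_{i=n+1}^j\varrho_i$ and $D_Y(n)=1+\sum_{j=n+1}^\infty\prod_{i=n+1}^j\varrho_i^{-1}$. A site $k$ is a cutpoint of $X$ if $\#\{n\ge0:X_n=k\}=1$; a site $k$ is a cutpoint of $Y$ if $\#\{n\ge0:Y_n=k\}=0$. *)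

theory Defs
  imports "HOL-Probability.Probability"
begin

definition trans21 :: "(nat \<Rightarrow> real) \<Rightarrow> (nat \<Rightarrow> real) \<Rightarrow> (nat \<Rightarrow> real) \<Rightarrow> nat \<Rightarrow> nat \<Rightarrow> real" where
  "trans21 q p1 p2 n m =
    (if n = 0 then (if m = 1 then 1 else 0)
     else if n = 1 then (if m = 2 then 1 else 0)
     else if m = n + 1 then q n
     else if m + 1 = n then p1 n
     else if m + 2 = n then p2 n
     else 0)"

definition trans12 :: "(nat \<Rightarrow> real) \<Rightarrow> (nat \<Rightarrow> real) \<Rightarrow> (nat \<Rightarrow> real) \<Rightarrow> nat \<Rightarrow> nat \<Rightarrow> real" where
  "trans12 q p1 p2 n m =
    (if n = 1 then (if m = 0 then 1 else 0)
     else if n = 0 then (if m = 2 then 1 else 0)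
     else if m + 1 = n then q n
     else if m = n + 1 then p1 n
     else if m = n + 2 then p2 n
     else 0)"

definition markov_chain :: "'a measure \<Rightarrow> (nat \<Rightarrow> 'a \<Rightarrow> nat) \<Rightarrow> nat \<Rightarrow> (nat \<Rightarrow> nat \<Rightarrow> real) \<Rightarrow> bool" where
  "markov_chain M Z x0 P \<longleftrightarrow>
     prob_space M \<and>
     (\<forall>n. Z n \<in> measurable M (count_space UNIV)) \<and>
     (\<forall>n xs. length xs = Suc n \<longrightarrow>
        measure M {\<omega> \<in> space M. \<forall>i\<le>n. Z i \<omega> = xs ! i}
          = (if xs ! 0 = x0 then 1 else 0) * (\<Prod>i<n. P (xs ! i) (xs ! Suc i)))"

definition a_seq :: "(nat \<Rightarrow> real) \<Rightarrow> (nat \<Rightarrow> real) \<Rightarrow> (nat \<Rightarrow> real) \<Rightarrow> nat \<Rightarrow> real" where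
  "a_seq q p1 p2 k = (p1 k + p2 k) / q k"

definition b_seq :: "(nat \<Rightarrow> real) \<Rightarrow> (nat \<Rightarrow> real) \<Rightarrow> (nat \<Rightarrow> real) \<Rightarrow> nat \<Rightarrow> real" where
  "b_seq q p1 p2 k = p2 k / q k"

definition rho :: "(nat \<Rightarrow> real) \<Rightarrow> (nat \<Rightarrow> real) \<Rightarrow> (nat \<Rightarrow> real) \<Rightarrow> nat \<Rightarrow> real" where
  "rho q p1 p2 k = (a_seq q p1 p2 k + sqrt ((a_seq q p1 p2 k)\<^sup>2 + 4 * b_seq q p1 p2 k)) / 2"

text \<open>D_X(n) = 1 + sum_{j>=n+1} prod_{i=n+1}^j rho_i, valued in [0,\<infinity>]
  (the series may diverge). Index shift: j = n+1+m.\<close>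
definition D_X :: "(nat \<Rightarrow> real) \<Rightarrow> (nat \<Rightarrow> real) \<Rightarrow> (nat \<Rightarrow> real) \<Rightarrow> nat \<Rightarrow> ennreal" where
  "D_X q p1 p2 n = 1 + (\<Sum>m. ennreal (\<Prod>i\<in>{n+1..n+1+m}. rho q p1 p2 i))"

definition D_Y :: "(nat \<Rightarrow> real) \<Rightarrow> (nat \<Rightarrow> real) \<Rightarrow> (nat \<Rightarrow> real) \<Rightarrow> nat \<Rightarrow> ennreal" where
  "D_Y q p1 p2 n = 1 + (\<Sum>m. ennreal (\<Prod>i\<in>{n+1..n+1+m}. inverse (rho q p1 p2 i)))"

definition cutpoints_X :: "(nat \<Rightarrow> 'a \<Rightarrow> nat) \<Rightarrow> 'a \<Rightarrow> nat set" where
  "cutpoints_X X \<omega> = {k. \<exists>!n. X n \<omega> = k}"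

definition cutpoints_Y :: "(nat \<Rightarrow> 'a \<Rightarrow> nat) \<Rightarrow> 'a \<Rightarrow> nat set" where
  "cutpoints_Y Y \<omega> = {k. \<forall>n. Y n \<omega> \<noteq> k}"

end

theory Submission
  imports Defs
begin

text \<open>Let \<open>A\<^sub>k\<close> be the event that \<open>k\<close> is a cutpoint. Up to null sets \<open>A\<^sub>k\<close> says that the walk enters
  \<open>{k..}\<close> at \<open>k\<close> (for \<open>X\<close>) or at \<open>k + 1\<close> (for \<open>Y\<close>) and stays above \<open>k\<close> afterwards, so by the strong Markov
  property past and future of a cutpoint are independent. Exit probabilities are given by harmonic
  functions whose increments solve a three term recursion; because the ratios are monotone, the increments
  are comparable to products of the ratios. Hence \<open>P A\<^sub>k\<close> is of order \<open>1 / D k\<close> and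
  \<open>P (A\<^sub>j | A\<^sub>k)\<close> is of order \<open>1 / D j k\<close> for \<open>j < k\<close>, where \<open>D j k\<close> is the series \<open>D j\<close> cut off at \<open>k\<close>.

  For part (1), \<open>D j k \<le> k - j\<close> shows that the last cutpoint of a dyadic block around \<open>n\<close> has on average
  at least a multiple of \<open>ln n\<close> cutpoints just below it. The probability that the block contains a cutpoint is
  therefore at most a multiple of the sum of \<open>1 / (D k * ln k)\<close> over neighbouring \<open>k\<close>, and Borel-Cantelli applies.
  For part (2), the second moment method with weights \<open>1 / ln k\<close> bounds the probability of infinitely many
  cutpoints below by a constant that does not depend on the starting point; approximating the
  complementary event by events determined in finite time shows that it is null.\<close>

section \<open>Markov chains on the path space\<close>

text \<open>Criticality enters through \<open>a + b = 1\<close>: it makes the ratios tend to 1, and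
  a monotone sequence with limit 1 stays on one side of it. Hence the factors in \<open>D_X\<close>
  and \<open>D_Y\<close> are eventually at most 1, which is the source of
  \<open>D j k \<le> k - j\<close>. The main difference between the walks is that the (2,1) walk
  cannot skip a level upwards and so enters every level almost surely, whereas the (1,2) walk can.
  For the latter, entry at \<open>k + 1\<close> has to be shown to keep a probability bounded away
  from zero whatever is required below; this costs a constant and a few levels of room, visible as
  \<open>j + 4 \<le> k\<close> in the lower bounds. The offset \<open>c\<close> (0 or 1) lets
  everything else be done once. In part (2) the correlations involve the truncated series, while
  growth is assumed only for the full one. The link is that \<open>1 - D j k / D j\<close> equals
  the product of \<open>1 - 1 / D i\<close> over \<open>j \<le> i < k\<close>. Divergence of the
  series is covered by reading \<open>1 / D\<close> as 0.\<close>

definition path_space :: "(nat \<Rightarrow> nat) measure" where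
  "path_space = PiM UNIV (\<lambda>_. count_space UNIV)"

definition hist :: "nat \<Rightarrow> (nat \<Rightarrow> nat) \<Rightarrow> nat list" where
  "hist n w = map w [0..<Suc n]"

definition path_shift :: "nat \<Rightarrow> (nat \<Rightarrow> nat) \<Rightarrow> nat \<Rightarrow> nat" where
  "path_shift n w = (\<lambda>i. w (n + i))"

lemma path_shift_apply [simp]: "path_shift n w i = w (n + i)"
  by (simp add: path_shift_def)

lemma hist_eq_iff: "hist n w = hist n w' \<longleftrightarrow> (\<forall>i\<le>n. w i = w' i)"
  by (auto simp: hist_def less_Suc_eq_le)

lemma hist_nth: "i \<le> n \<Longrightarrow> hist n w ! i = w i"
  unfolding hist_def by (subst nth_map) (auto simp del: upt_Suc)

lemma length_hist [simp]: "length (hist n w) = Suc n"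
  by (simp add: hist_def)

lemma space_path_space [simp]: "space path_space = UNIV"
  by (simp add: path_space_def space_PiM)

lemma measurable_path_component [measurable]:
  "(\<lambda>w. w i) \<in> measurable path_space (count_space UNIV)"
  unfolding path_space_def by (rule measurable_component_singleton) simp

abbreviation path_pred :: "((nat \<Rightarrow> nat) \<Rightarrow> bool) \<Rightarrow> bool" where
  "path_pred \<equiv> Measurable.pred path_space"

lemma measurable_into_path_space:
  assumes "\<And>i. (\<lambda>w. f w i) \<in> measurable M (count_space UNIV)"
  shows "f \<in> measurable M path_space"
  unfolding path_space_def using assms by (intro measurable_PiM_single') auto

lemma measurable_path_shift [measurable]: "path_shift n \<in> measurable path_space path_space"
  by (rule measurable_into_path_space) simp

lemma sets_cylinder [measurable]: "{w. \<forall>i\<le>n. w i = v i} \<in> sets path_space"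
proof -
  have "{w \<in> space path_space. \<forall>i\<le>n. w i = v i} \<in> sets path_space"
    by measurable
  then show ?thesis by simp
qed

lemma measurable_hist [measurable]: "hist n \<in> measurable path_space (count_space UNIV)"
proof (subst measurable_count_space_eq_countable, simp, safe)
  fix xs
  show "hist n -` {xs} \<inter> space path_space \<in> sets path_space"
  proof (cases "length xs = Suc n")
    case True
    then have "hist n -` {xs} \<inter> space path_space = {w. \<forall>i\<le>n. w i = xs ! i}"
      by (auto simp: hist_nth list_eq_iff_nth_eq less_Suc_eq_le length_hist)
    then show ?thesis by (simp add: sets_cylinder)
  next
    case False
    then have "hist n -` {xs} = {}" by (auto simp: hist_def)
    then show ?thesis by simp
  qed
qed auto

text \<open>The empty set is included so that the family is closed under intersection even when two
  cylinders prescribe conflicting values; it is then a pi-system.\<close>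

definition cylinders :: "(nat \<Rightarrow> nat) set set" where
  "cylinders = insert {} {{w. \<forall>i\<le>n. w i = v i} | n v. True}"

lemma Int_stable_cylinders: "Int_stable cylinders"
proof -
  have "{w. \<forall>i\<le>n. w i = v i} \<inter> {w. \<forall>i\<le>m. w i = u i} \<in> cylinders" if "n \<le> m"
    for n m and u v :: "nat \<Rightarrow> nat"
  proof (cases "\<forall>i\<le>n. v i = u i")
    case True
    then have "{w. \<forall>i\<le>n. w i = v i} \<inter> {w. \<forall>i\<le>m. w i = u i} = {w. \<forall>i\<le>m. w i = u i}"
      using that by auto
    then show ?thesis unfolding cylinders_def by blast
  next
    case False
    then have "{w. \<forall>i\<le>n. w i = v i} \<inter> {w. \<forall>i\<le>m. w i = u i} = {}"
      using that by auto
    then show ?thesis by (auto simp: cylinders_def)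
  qed
  note * = this
  have **: "{w. \<forall>i\<le>n. w i = v i} \<inter> {w. \<forall>i\<le>m. w i = u i} \<in> cylinders"
    for n m and u v :: "nat \<Rightarrow> nat"
    using *[of n m v u] *[of m n u v] by (cases "n \<le> m") (auto simp: Int_commute)
  then show ?thesis
    unfolding Int_stable_def
  proof safe
    fix A B assume "A \<in> cylinders" "B \<in> cylinders"
    then consider "A = {} \<or> B = {}" | n v m u where "A = {w. \<forall>i\<le>n. w i = v i}" "B = {w. \<forall>i\<le>m. w i = u i}"
      unfolding cylinders_def by blast
    then show "A \<inter> B \<in> cylinders"
    proof cases
      case 1
      then show ?thesis by (auto simp: cylinders_def)
    next
      case 2
      then show ?thesis using ** by blast
    qed
  qed
qed

lemma sets_path_space: "sets path_space = sigma_sets UNIV cylinders"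
proof
  show "sigma_sets UNIV cylinders \<subseteq> sets path_space"
    using sets.sigma_sets_subset[of cylinders path_space] sets_cylinder
    by (force simp: cylinders_def)
  interpret sigma_algebra UNIV "sigma_sets UNIV cylinders"
    by (rule sigma_algebra_sigma_sets) auto
  have "{w. w i \<in> A} \<in> sigma_sets UNIV cylinders" for i and A :: "nat set"
  proof -
    \<comment> \<open>The union runs over finite lists rather than over paths, since there are only
      countably many lists.\<close>
    have eq: "{w. w i \<in> A} = (\<Union>xs\<in>{xs. xs ! i \<in> A}. {w. \<forall>l\<le>i. w l = xs ! l})"
    proof safe
      fix w :: "nat \<Rightarrow> nat" assume "w i \<in> A"
      then show "w \<in> (\<Union>xs\<in>{xs. xs ! i \<in> A}. {w. \<forall>l\<le>i. w l = xs ! l})"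
        by (intro UN_I[of "hist i w"]) (auto simp: hist_nth)
    qed auto
    show ?thesis
      unfolding eq by (intro countable_UN') (auto simp: cylinders_def)
  qed
  then show "sets path_space \<subseteq> sigma_sets UNIV cylinders"
    unfolding path_space_def sets_PiM_single
    by (auto intro!: sigma_sets_subset)
qed

text \<open>Cylinders form a generating pi-system, so agreement on them suffices. The countable
  cover by the sets on which \<open>w 0 = a\<close> supplies the sigma-finiteness that the
  uniqueness theorem asks for.\<close>

lemma path_measure_eqI:
  assumes N1: "sets N1 = sets path_space" and N2: "sets N2 = sets path_space"
    and fin: "finite_measure N1"
    and eq: "\<And>n v. emeasure N1 {w. \<forall>i\<le>n. w i = v i} = emeasure N2 {w. \<forall>i\<le>n. w i = v i}"
  shows "N1 = N2"
proof (rule measure_eqI_generator_eq[OF Int_stable_cylinders, where \<Omega> = UNIV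
      and A = "\<lambda>a. {w. \<forall>i\<le>0. w i = a}"])
  show "emeasure N1 X = emeasure N2 X" if "X \<in> cylinders" for X
    using that eq by (auto simp: cylinders_def)
  show "emeasure N1 {w. \<forall>i\<le>0. w i = a} \<noteq> \<infinity>" for a
    using finite_measure.emeasure_finite[OF fin] by simp
  show "range (\<lambda>a. {w. \<forall>i\<le>0. w i = a}) \<subseteq> cylinders"
    unfolding cylinders_def by auto
qed (auto simp: N1 N2 sets_path_space)

section \<open>Construction of the chain and uniqueness of its law\<close>

primrec walk :: "nat \<Rightarrow> (nat \<times> nat \<Rightarrow> nat) \<Rightarrow> nat \<Rightarrow> nat" where
  "walk x \<omega> 0 = x"
| "walk x \<omega> (Suc n) = \<omega> (n, walk x \<omega> n)"

text \<open>Independent choices of a successor for every time and every state drive the chain.\<close>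

definition path_law :: "(nat \<Rightarrow> nat pmf) \<Rightarrow> nat \<Rightarrow> (nat \<Rightarrow> nat) measure" where
  "path_law K x = distr (PiM UNIV (\<lambda>i. measure_pmf (K (snd i)))) path_space (walk x)"

lemma measurable_walk:
  "walk x \<in> measurable (PiM UNIV (\<lambda>i. measure_pmf (K (snd i)))) path_space"
proof (rule measurable_into_path_space)
  fix n
  show "(\<lambda>\<omega>. walk x \<omega> n) \<in> measurable (PiM UNIV (\<lambda>i. measure_pmf (K (snd i)))) (count_space UNIV)"
  proof (induction n)
    case (Suc n)
    have "(\<lambda>\<omega>. \<omega> (n, i)) \<in> measurable (PiM UNIV (\<lambda>i. measure_pmf (K (snd i)))) (count_space UNIV)" for i
      using measurable_component_singleton[of "(n, i)" UNIV "\<lambda>i. measure_pmf (K (snd i))"]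
      unfolding measurable_cong_sets[OF refl sets_measure_pmf_count_space] by blast
    then show ?case
      unfolding walk.simps
      by (rule measurable_compose_countable[of "\<lambda>i \<omega>. \<omega> (n, i)", OF _ Suc])
  qed simp
qed

lemma sets_path_law [simp, measurable_cong]: "sets (path_law K x) = sets path_space"
  by (simp add: path_law_def)

lemma space_path_law [simp]: "space (path_law K x) = UNIV"
  by (simp add: path_law_def)

lemma prob_space_path_law: "prob_space (path_law K x)"
  unfolding path_law_def
  by (intro prob_space.prob_space_distr measurable_walk prob_space_PiM prob_space_measure_pmf)

text \<open>Following \<open>v\<close> up to time \<open>n\<close> amounts to prescribing the
  choices at the pairs \<open>(i, v i)\<close> with \<open>i < n\<close>. These pairs differ in
  their first entries, so the choices are independent and the probability is a product.\<close>

lemma emeasure_path_law_cylinder: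
  "emeasure (path_law K x) {w. \<forall>i\<le>n. w i = v i} =
     ennreal ((if v 0 = x then 1 else 0) * (\<Prod>i<n. pmf (K (v i)) (v (Suc i))))"
proof (cases "v 0 = x")
  case True
  let ?M = "\<lambda>i::nat \<times> nat. measure_pmf (K (snd i))"
  let ?J = "(\<lambda>i. (i, v i)) ` {..<n}"
  interpret P: product_prob_space ?M UNIV
    by unfold_locales
  have *: "(\<forall>i\<le>m. walk x \<omega> i = v i) \<longleftrightarrow> (\<forall>i<m. \<omega> (i, v i) = v (Suc i))" for \<omega> m
  proof (induction m)
    case 0
    then show ?case using True by simp
  next
    case (Suc m)
    have "(\<forall>i\<le>Suc m. walk x \<omega> i = v i) \<longleftrightarrow> (\<forall>i\<le>m. walk x \<omega> i = v i) \<and> walk x \<omega> (Suc m) = v (Suc m)"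
      using le_Suc_eq by auto
    then show ?case using Suc by (auto simp: less_Suc_eq)
  qed
  have "emeasure (path_law K x) {w. \<forall>i\<le>n. w i = v i} =
      emeasure (PiM UNIV ?M) {\<omega> \<in> space (PiM UNIV ?M). \<forall>i\<in>?J. \<omega> i \<in> {v (Suc (fst i))}}"
    unfolding path_law_def
    by (subst emeasure_distr[OF measurable_walk sets_cylinder])
      (auto intro!: arg_cong2[where f = emeasure] simp: * space_PiM)
  also have "\<dots> = (\<Prod>i\<in>?J. emeasure (?M i) {v (Suc (fst i))})"
    by (rule P.emeasure_PiM_Collect) auto
  also have "\<dots> = (\<Prod>i<n. ennreal (pmf (K (v i)) (v (Suc i))))"
    by (subst prod.reindex) (auto simp: inj_on_def emeasure_pmf_single)
  finally show ?thesis using True by (simp add: prod_ennreal)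
next
  case False
  then have "walk x -` {w. \<forall>i\<le>n. w i = v i} = {}"
    by force
  then show ?thesis
    unfolding path_law_def using False
    by (subst emeasure_distr[OF measurable_walk sets_cylinder]) (simp del: vimage_Collect_eq)
qed

text \<open>Everything later is proved for \<open>path_law\<close>; this carries it to an arbitrary
  chain. The list condition in \<open>markov_chain\<close>, read along \<open>hist n v\<close>,
  gives exactly the cylinder probabilities.\<close>

lemma markov_chain_law:
  assumes "markov_chain M Z x (\<lambda>n m. pmf (K n) m)"
  shows "(\<lambda>\<omega> n. Z n \<omega>) \<in> measurable M path_space"
    and "distr M path_space (\<lambda>\<omega> n. Z n \<omega>) = path_law K x"
proof -
  interpret prob_space M using assms by (simp add: markov_chain_def)
  have Z: "Z n \<in> measurable M (count_space UNIV)" for n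
    using assms by (simp add: markov_chain_def)
  show m: "(\<lambda>\<omega> n. Z n \<omega>) \<in> measurable M path_space"
    by (rule measurable_into_path_space) (use Z in simp)
  show "distr M path_space (\<lambda>\<omega> n. Z n \<omega>) = path_law K x"
  proof (rule path_measure_eqI)
    fix n and v :: "nat \<Rightarrow> nat"
    have l: "length (hist n v) = Suc n" by (simp add: hist_def)
    have "measure M {\<omega> \<in> space M. \<forall>i\<le>n. Z i \<omega> = hist n v ! i} =
        (if hist n v ! 0 = x then 1 else 0) * (\<Prod>i<n. pmf (K (hist n v ! i)) (hist n v ! Suc i))"
      using assms l unfolding markov_chain_def by blast
    moreover have "{\<omega> \<in> space M. \<forall>i\<le>n. Z i \<omega> = hist n v ! i} =
        (\<lambda>\<omega> n. Z n \<omega>) -` {w. \<forall>i\<le>n. w i = v i} \<inter> space M"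
      by (auto simp: hist_nth)
    ultimately show "emeasure (distr M path_space (\<lambda>\<omega> n. Z n \<omega>)) {w. \<forall>i\<le>n. w i = v i} =
        emeasure (path_law K x) {w. \<forall>i\<le>n. w i = v i}"
      by (simp add: emeasure_distr[OF m] emeasure_path_law_cylinder emeasure_eq_measure hist_nth)
  qed (auto intro!: finite_measure_distr m)
qed

text \<open>Membership in the sigma-algebra of the first \<open>n + 1\<close> positions. States are
  countable, so every event that depends only on these positions is measurable and no separate
  condition is imposed.\<close>

definition adapted :: "nat \<Rightarrow> ((nat \<Rightarrow> nat) \<Rightarrow> bool) \<Rightarrow> bool" where
  "adapted n R \<longleftrightarrow> (\<forall>w w'. (\<forall>i\<le>n. w i = w' i) \<longrightarrow> R w = R w')"

lemma adapted_iff_hist: "adapted n R \<Longrightarrow> R w \<longleftrightarrow> hist n w \<in> hist n ` {w. R w}"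
  unfolding adapted_def by (auto simp: image_iff hist_eq_iff)

lemma adapted_measurable: "adapted n R \<Longrightarrow> path_pred R"
proof -
  assume "adapted n R"
  then have "R = (\<lambda>w. hist n w \<in> hist n ` {w. R w})"
    using adapted_iff_hist[of n R] by blast
  then show ?thesis
    using measurable_compose[OF measurable_hist[of n], of "\<lambda>xs. xs \<in> hist n ` {w. R w}" "count_space UNIV"] by simp
qed

lemma prod_lessThan_add: "(\<Prod>i<n + m. f i) = (\<Prod>i<n. f i) * (\<Prod>i<m. f (n + i :: nat) :: 'a :: comm_monoid_mult)"
  by (induction m) (auto simp: ac_simps)

text \<open>Split according to the history up to time \<open>n\<close>, of which there are countably
  many. For one fixed history the two conditions together prescribe a single longer cylinder, whose
  product formula factors at time \<open>n\<close>. If \<open>v 0\<close> differs from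
  \<open>y\<close>, both sides vanish.\<close>

lemma markov_property_cylinder:
  assumes R: "adapted n R" and y: "\<forall>w. R w \<longrightarrow> w n = y"
  shows "emeasure (path_law K x) {w. R w \<and> (\<forall>i\<le>m. w (n + i) = v i)} =
     emeasure (path_law K x) {w. R w} * emeasure (path_law K y) {w. \<forall>i\<le>m. w i = v i}"
proof -
  let ?Q = "path_law K x"
  define L where "L = hist n ` {w. R w}"
  let ?C = "{w. \<forall>i\<le>m. w (n + i) = v i}"
  have C: "?C \<in> sets path_space"
  proof -
    have "{w \<in> space path_space. \<forall>i\<le>m. w (n + i) = v i} \<in> sets path_space"
      by measurable
    then show ?thesis by simp
  qed
  have H: "{w. hist n w = xs} \<in> sets path_space" for xs
  proof -
    have "{w. hist n w = xs} = hist n -` {xs} \<inter> space path_space" by auto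
    then show ?thesis using measurable_sets[OF measurable_hist[of n], of "{xs}"] by simp
  qed
  have split: "emeasure ?Q {w. R w \<and> w \<in> D} =
      (\<integral>\<^sup>+xs. emeasure ?Q ({w. hist n w = xs} \<inter> D) \<partial>count_space L)"
    if "D \<in> sets path_space" for D
  proof -
    have "{w. R w \<and> w \<in> D} = (\<Union>xs\<in>L. {w. hist n w = xs} \<inter> D)"
      unfolding L_def using adapted_iff_hist[OF R] by blast
    also have "emeasure ?Q \<dots> =
      (\<integral>\<^sup>+xs. emeasure ?Q ({w. hist n w = xs} \<inter> D) \<partial>count_space L)"
      using that H by (intro emeasure_UN_countable) (auto simp: disjoint_family_on_def)
    finally show ?thesis .
  qed
  have one: "emeasure ?Q ({w. hist n w = xs} \<inter> ?C) =
     emeasure ?Q {w. hist n w = xs} * emeasure (path_law K y) {w. \<forall>i\<le>m. w i = v i}"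
    if "xs \<in> L" for xs
  proof -
    obtain u where u: "xs = hist n u" "R u" using \<open>xs \<in> L\<close> by (auto simp: L_def)
    have un: "u n = y" using y u by simp
    have xs: "{w. hist n w = xs} = {w. \<forall>i\<le>n. w i = u i}"
      by (simp add: u hist_eq_iff)
    show ?thesis
    proof (cases "v 0 = y")
      case True
      \<comment> \<open>The concatenation of the two paths. They overlap at time \<open>n\<close>,
        where \<open>u n = y = v 0\<close>.\<close>
      define z where "z i = (if i \<le> n then u i else v (i - n))" for i
      have z: "z i = u i" if "i \<le> n" for i using that by (simp add: z_def)
      have z': "z (n + i) = v i" for i using True un by (auto simp: z_def)
      have "w \<in> {w. hist n w = xs} \<inter> ?C \<longleftrightarrow> w \<in> {w. \<forall>i\<le>n + m. w i = z i}" for w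
      proof
        assume *: "w \<in> {w. hist n w = xs} \<inter> ?C"
        have "w i = z i" if "i \<le> n + m" for i
        proof (cases "i \<le> n")
          case True
          then show ?thesis using * z by (auto simp: u hist_eq_iff)
        next
          case False
          have "\<forall>i\<le>m. w (n + i) = v i" using * by simp
          then have "w (n + (i - n)) = v (i - n)" using that by (elim allE[of _ "i - n"]) simp
          then show ?thesis using False by (simp add: z_def)
        qed
        then show "w \<in> {w. \<forall>i\<le>n + m. w i = z i}" by simp
      next
        assume *: "w \<in> {w. \<forall>i\<le>n + m. w i = z i}"
        have "hist n w = xs" using * z by (auto simp: u hist_eq_iff)
        moreover have "w (n + i) = v i" if "i \<le> m" for i using * z' that by auto
        ultimately show "w \<in> {w. hist n w = xs} \<inter> ?C" by simp
      qed
      then have "{w. hist n w = xs} \<inter> ?C = {w. \<forall>i\<le>n + m. w i = z i}" by blast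
      then have "emeasure ?Q ({w. hist n w = xs} \<inter> ?C) =
          ennreal ((if z 0 = x then 1 else 0) * (\<Prod>i<n + m. pmf (K (z i)) (z (Suc i))))"
        by (simp only: emeasure_path_law_cylinder)
      also have "(\<Prod>i<n + m. pmf (K (z i)) (z (Suc i))) =
          (\<Prod>i<n. pmf (K (u i)) (u (Suc i))) * (\<Prod>i<m. pmf (K (v i)) (v (Suc i)))"
        unfolding prod_lessThan_add by (simp only: z' add_Suc_right[symmetric]) (simp add: z)
      also have "ennreal ((if z 0 = x then 1 else 0) * \<dots>) =
         emeasure ?Q {w. hist n w = xs} * emeasure (path_law K y) {w. \<forall>i\<le>m. w i = v i}"
        unfolding xs emeasure_path_law_cylinder using True z[of 0]
        by (simp add: ennreal_mult prod_nonneg)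
      finally show ?thesis .
    next
      case False
      then have "{w. hist n w = xs} \<inter> ?C = {}"
        using un unfolding xs by force
      then show ?thesis using False by (simp only:) (simp add: emeasure_path_law_cylinder)
    qed
  qed
  have "emeasure ?Q {w. R w \<and> (\<forall>i\<le>m. w (n + i) = v i)} =
      (\<integral>\<^sup>+xs. emeasure ?Q ({w. hist n w = xs} \<inter> UNIV) *
         emeasure (path_law K y) {w. \<forall>i\<le>m. w i = v i} \<partial>count_space L)"
    using split[OF C] one by (simp cong: nn_integral_cong_simp)
  also have "\<dots> = emeasure ?Q {w. R w} * emeasure (path_law K y) {w. \<forall>i\<le>m. w i = v i}"
    using split[of UNIV] sets.top[of path_space]
    by (subst nn_integral_multc) auto
  finally show ?thesis .
qed

lemma sets_path:
  "path_pred R \<Longrightarrow> {w. R w} \<in> sets path_space"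
  by (simp add: pred_def)

text \<open>As functions of \<open>B\<close> both sides are finite measures: the image under the
  shift of the law restricted to \<open>R\<close>, and a multiple of the law started at
  \<open>y\<close>. They agree on cylinders.\<close>

lemma markov_property_emeasure:
  assumes R: "adapted n R" and y: "\<forall>w. R w \<longrightarrow> w n = y"
    and B: "path_pred B"
  shows "emeasure (path_law K x) {w. R w \<and> B (path_shift n w)} =
     emeasure (path_law K x) {w. R w} * emeasure (path_law K y) {w. B w}"
proof -
  let ?Q = "path_law K x"
  interpret X: prob_space ?Q by (rule prob_space_path_law)
  interpret Y: prob_space "path_law K y" by (rule prob_space_path_law)
  note [measurable] = adapted_measurable[OF R] B
  let ?E = "{w. R w}"
  let ?N = "distr (density ?Q (indicator ?E)) path_space (path_shift n)"
  let ?S = "scale_measure (emeasure ?Q ?E) (path_law K y)"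
  have [measurable]: "?E \<in> sets path_space" by (rule sets_path) measurable
  have N: "emeasure ?N D = emeasure ?Q {w. R w \<and> path_shift n w \<in> D}"
    if [measurable]: "D \<in> sets path_space" for D
  proof -
    have "emeasure ?N D = emeasure (density ?Q (indicator ?E)) (path_shift n -` D)"
      by (subst emeasure_distr) auto
    also have "\<dots> = (\<integral>\<^sup>+w. indicator ?E w * indicator (path_shift n -` D) w \<partial>?Q)"
      using measurable_sets[OF measurable_path_shift that, of n]
      by (subst emeasure_density) auto
    also have "\<dots> = (\<integral>\<^sup>+w. indicator {w. R w \<and> path_shift n w \<in> D} w \<partial>?Q)"
      by (intro nn_integral_cong) (auto split: split_indicator)
    also have "\<dots> = emeasure ?Q {w. R w \<and> path_shift n w \<in> D}"
      by (rule nn_integral_indicator) (simp, rule sets_path, measurable)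
    finally show ?thesis .
  qed
  have "?N = ?S"
  proof (rule path_measure_eqI)
    show "emeasure ?N {w. \<forall>i\<le>m. w i = v i} = emeasure ?S {w. \<forall>i\<le>m. w i = v i}" for m v
      using markov_property_cylinder[OF R y]
      by (simp add: N emeasure_scale_measure)
    show "finite_measure ?N"
    proof
      have "emeasure ?N (space ?N) = emeasure ?Q {w. R w \<and> path_shift n w \<in> UNIV}"
        using N[of UNIV] sets.top[of path_space] by simp
      then show "emeasure ?N (space ?N) \<noteq> \<infinity>" by simp
    qed
  qed auto
  then have "emeasure ?N {w. B w} = emeasure ?S {w. B w}" by (rule arg_cong)
  moreover have "emeasure ?N {w. B w} = emeasure ?Q {w. R w \<and> B (path_shift n w)}"
    unfolding N[OF sets_path[OF B]] mem_Collect_eq ..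
  ultimately show ?thesis
    by (simp only: emeasure_scale_measure)
qed

lemma markov_property:
  assumes R: "adapted n R" and y: "\<forall>w. R w \<longrightarrow> w n = y"
    and B: "path_pred B"
  shows "measure (path_law K x) {w. R w \<and> B (path_shift n w)} =
     measure (path_law K x) {w. R w} * measure (path_law K y) {w. B w}"
  using markov_property_emeasure[OF R y B] by (simp add: measure_def enn2real_mult)

text \<open>\<open>R n\<close> plays the role of the event that a stopping time equals
  \<open>n\<close> and the walk is then at \<open>y\<close>; \<open>excl\<close> makes these events
  disjoint, so the Markov property can be summed over \<open>n\<close>.\<close>

lemma strong_markov:
  assumes R: "\<And>n. adapted n (R n)" and y: "\<And>n w. R n w \<Longrightarrow> w n = y"
    and excl: "\<And>n m w. R n w \<Longrightarrow> R m w \<Longrightarrow> n = m"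
    and B: "path_pred B"
  shows "measure (path_law K x) {w. \<exists>n. R n w \<and> B (path_shift n w)} =
     measure (path_law K x) {w. \<exists>n. R n w} * measure (path_law K y) {w. B w}"
proof -
  let ?Q = "path_law K x"
  note [measurable] = adapted_measurable[OF R] B
  have sum: "emeasure ?Q {w. \<exists>n. R n w \<and> C n w} =
      (\<Sum>n. emeasure ?Q {w. R n w \<and> C n w})"
    if [measurable]: "\<And>n. path_pred (C n)" for C
  proof -
    have "{w. \<exists>n. R n w \<and> C n w} = (\<Union>n. {w. R n w \<and> C n w})" by auto
    moreover have "disjoint_family (\<lambda>n. {w. R n w \<and> C n w})"
      unfolding disjoint_family_on_def using excl by blast
    moreover have "range (\<lambda>n. {w. R n w \<and> C n w}) \<subseteq> sets ?Q"
      by (auto intro!: sets_path)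
    ultimately show ?thesis
      using suminf_emeasure[of "\<lambda>n. {w. R n w \<and> C n w}" ?Q] by simp
  qed
  have "emeasure ?Q {w. \<exists>n. R n w \<and> B (path_shift n w)} =
      (\<Sum>n. emeasure ?Q {w. R n w} * emeasure (path_law K y) {w. B w})"
    (is "_ = (\<Sum>n. ?f n)")
  proof -
    have "emeasure ?Q {w. R n w \<and> B (path_shift n w)} = ?f n" for n
      using y by (intro markov_property_emeasure[OF R _ B]) blast
    then show ?thesis by (subst sum) auto
  qed
  also have "\<dots> = (\<Sum>n. emeasure ?Q {w. R n w \<and> True}) * emeasure (path_law K y) {w. B w}"
    by (simp add: ennreal_suminf_multc)
  also have "(\<Sum>n. emeasure ?Q {w. R n w \<and> True}) = emeasure ?Q {w. \<exists>n. R n w \<and> True}"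
    by (rule sum[symmetric]) simp
  finally show ?thesis
    unfolding measure_def by (simp add: enn2real_mult del: path_shift_apply)
qed

section \<open>Occurrence of events with logarithmic clustering\<close>

text \<open>Each block \<open>{N<..2 * N}\<close> contributes at least 1/2. The sum starts at 4
  because lower bounds for two joint occurrences are available only at distance at least 4.\<close>

lemma harmonic_tail_dyadic: "(\<Sum>i=4..2 ^ (p + 2). 1 / real i) \<ge> real p / 2"
proof (induction p)
  case 0
  then show ?case by simp
next
  case (Suc p)
  define N :: nat where "N = 2 ^ (p + 2)"
  have four: "4 \<le> N" using power_increasing[of 2 "p + 2" "2::nat"] by (simp add: N_def)
  let ?A = "{4..N}" and ?B = "{N<..2 * N}"
  have "{4..2 ^ (Suc p + 2)} = {4..2 * N}" by (simp add: N_def)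
  also have "\<dots> = ?A \<union> ?B" using four by auto
  finally have "(\<Sum>i=4..2 ^ (Suc p + 2). 1 / real i) = (\<Sum>i\<in>?A. 1 / real i) + (\<Sum>i\<in>?B. 1 / real i)"
    by (simp only:) (subst sum.union_disjoint, auto)
  moreover have "(\<Sum>i\<in>?B. 1 / real i) \<ge> (\<Sum>i\<in>?B. 1 / real (2 * N))"
    by (rule sum_mono) (auto simp: field_simps)
  moreover have "(\<Sum>i\<in>?B. 1 / real (2 * N)) = 1 / 2"
    using four by (simp add: field_simps)
  ultimately show ?case using Suc by (simp add: N_def)
qed

text \<open>The windows overlap. With \<open>S p\<close> the partial sum up to \<open>2 ^ p\<close>,
  the window sum is \<open>S (p + 2) - S p\<close>, which is the increment of
  \<open>S (p + 1) + S p\<close>, so the series telescopes.\<close>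

lemma summable_dyadic_blocks:
  fixes f :: "nat \<Rightarrow> real"
  assumes "summable f"
  shows "summable (\<lambda>p. \<Sum>j\<in>{2 ^ p<..2 ^ (p + 2)}. f j)"
proof -
  define S where "S p = (\<Sum>j<Suc (2 ^ p). f j)" for p :: nat
  have "filterlim (\<lambda>p::nat. Suc (2 ^ p)) at_top sequentially"
    by (rule filterlim_subseq) (auto simp: strict_mono_def)
  then have S: "S \<longlonglongrightarrow> suminf f"
    unfolding S_def[abs_def] using filterlim_compose[OF summable_LIMSEQ[OF assms]] by blast
  have "(\<lambda>p. S (Suc p) + S p) \<longlonglongrightarrow> suminf f + suminf f"
    by (intro tendsto_add S LIMSEQ_Suc)
  then have "summable (\<lambda>p. (S (Suc (Suc p)) + S (Suc p)) - (S (Suc p) + S p))"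
    by (rule telescope_summable)
  moreover have "(S (Suc (Suc p)) + S (Suc p)) - (S (Suc p) + S p) = (\<Sum>j\<in>{2 ^ p<..2 ^ (p + 2)}. f j)" for p
  proof -
    have "(2::nat) ^ p \<le> 2 ^ (p + 2)" by (rule power_increasing) auto
    then have "{..<Suc (2 ^ (p + 2))} = {..<Suc (2 ^ p)} \<union> {2 ^ p<..2 ^ (p + 2)}" by auto
    then have "S (p + 2) = sum f ({..<Suc (2 ^ p)} \<union> {2 ^ p<..2 ^ (p + 2)})"
      unfolding S_def by (rule arg_cong)
    also have "\<dots> = S p + (\<Sum>j\<in>{2 ^ p<..2 ^ (p + 2)}. f j)"
      unfolding S_def by (rule sum.union_disjoint) auto
    finally show ?thesis by (simp add: numeral_2_eq_2)
  qed
  ultimately show ?thesis by simp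
qed

text \<open>Decompose a dyadic block according to its last occurrence \<open>k\<close>: each such \<open>k\<close> has, on average,
  about \<open>ln k\<close> further occurrences just below it.\<close>

lemma (in prob_space) AE_finite_occurrences:
  fixes A :: "nat \<Rightarrow> 'a set" and w :: "nat \<Rightarrow> real"
  assumes A: "\<And>k. A k \<in> events"
    and ub: "\<And>k. K \<le> k \<Longrightarrow> prob (A k) \<le> C * w k"
    and lb: "\<And>j k n. K \<le> j \<Longrightarrow> j + 4 \<le> k \<Longrightarrow> k \<le> n \<Longrightarrow>
      c / real (k - j) * prob (A k - (\<Union>i\<in>{k<..n}. A i)) \<le> prob (A j \<inter> (A k - (\<Union>i\<in>{k<..n}. A i)))"
    and c: "c > 0" and C: "C \<ge> 0" and w: "\<And>k. w k \<ge> 0"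
    and sum: "summable (\<lambda>k. w k / ln (real k))"
  shows "AE \<omega> in M. finite {k. \<omega> \<in> A k}"
proof -
  \<comment> \<open>\<open>U p\<close> concerns the block itself; \<open>J p\<close> also contains
    the preceding block, so that \<open>k - i\<close> stays in it for \<open>k\<close> in the block
    and \<open>i \<le> 2 ^ p\<close>.\<close>
  define U where "U p = (\<Union>k\<in>{2 ^ (p + 1)<..2 ^ (p + 2)}. A k)" for p :: nat
  define J where "J p = {2 ^ p<..(2::nat) ^ (p + 2)}" for p :: nat
  let ?s = "\<lambda>p. \<Sum>j\<in>J p. w j / ln (real j)"
  have U: "U p \<in> events" for p unfolding U_def using A by auto
  \<comment> \<open>The constant 32 is 8 times 4: the sum of \<open>1 / i\<close> over the distances
    \<open>4..2 ^ p\<close> is at least \<open>p / 8\<close>, and \<open>ln j \<le> 4 * p\<close>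
    for \<open>j\<close> in \<open>J p\<close>.\<close>
  have main: "prob (U p) \<le> 32 * C / c * ?s p"
    if p: "p \<ge> 4" "K \<le> 2 ^ p" for p
  proof -
    define n :: nat where "n = 2 ^ (p + 2)"
    define L where "L k = A k - (\<Union>i\<in>{k<..n}. A i)" for k
    define B where "B = {2 ^ (p + 1)<..n}"
    have L: "L k \<in> events" for k unfolding L_def using A by auto
    have Ldisj: "disjoint_family_on L B"
      unfolding disjoint_family_on_def
    proof safe
      fix k l x assume "k \<in> B" "l \<in> B" "k \<noteq> l" "x \<in> L k" "x \<in> L l"
      then show "x \<in> {}"
        by (cases "k < l") (auto simp: L_def B_def)
    qed
    have UL: "U p = (\<Union>k\<in>B. L k)"
    proof safe
      fix x assume "x \<in> U p"
      then obtain k0 where k0: "k0 \<in> B" "x \<in> A k0" unfolding U_def B_def n_def by blast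
      let ?k = "Max {k \<in> B. x \<in> A k}"
      have fin: "finite {k \<in> B. x \<in> A k}" by (simp add: B_def)
      have "?k \<in> {k \<in> B. x \<in> A k}" using k0 by (intro Max_in fin) auto
      moreover have "x \<notin> A i" if "i \<in> {?k<..n}" for i
      proof
        assume "x \<in> A i"
        with that \<open>?k \<in> _\<close> have "i \<in> {k \<in> B. x \<in> A k}" by (auto simp: B_def)
        then have "i \<le> ?k" by (intro Max_ge fin)
        then show False using that by auto
      qed
      ultimately show "x \<in> (\<Union>k\<in>B. L k)" unfolding L_def by blast
    next
      fix x k assume "k \<in> B" "x \<in> L k"
      then show "x \<in> U p" unfolding U_def L_def B_def n_def by blast
    qed
    have PU: "prob (U p) = (\<Sum>k\<in>B. prob (L k))"
      unfolding UL by (rule finite_measure_finite_Union) (use L Ldisj in \<open>auto simp: B_def\<close>)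
    have "c * (real p / 8) * prob (U p) \<le> (\<Sum>k\<in>B. \<Sum>j\<in>J p. prob (A j \<inter> L k))"
      unfolding PU sum_distrib_left
    proof (rule sum_mono)
      fix k assume k: "k \<in> B"
      have inj: "inj_on (\<lambda>i. k - i) {4..2 ^ p}"
        using k by (auto simp: inj_on_def B_def)
      have sub: "(\<lambda>i. k - i) ` {4..2 ^ p} \<subseteq> J p"
        using k by (auto simp: J_def B_def n_def)
      have "real p / 8 \<le> real (p - 2) / 2" using p by (auto simp: of_nat_diff)
      also have "\<dots> \<le> (\<Sum>i=4..2 ^ p. 1 / real i)"
      proof -
        have "p - 2 + 2 = p" using p by simp
        then show ?thesis using harmonic_tail_dyadic[of "p - 2"] by (simp only:)
      qed
      finally have h: "real p / 8 \<le> (\<Sum>i=4..2 ^ p. 1 / real i)" .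
      have "c * (real p / 8) * prob (L k) \<le> c * (\<Sum>i=4..2 ^ p. 1 / real i) * prob (L k)"
        using h c by (intro mult_right_mono mult_left_mono) auto
      also have "\<dots> = (\<Sum>i=4..2 ^ p. c / real i * prob (L k))"
        by (simp add: sum_distrib_left sum_distrib_right)
      also have "\<dots> \<le> (\<Sum>i=4..2 ^ p. prob (A (k - i) \<inter> L k))"
      proof (rule sum_mono)
        fix i :: nat assume i: "i \<in> {4..2 ^ p}"
        then have "K \<le> k - i" "k - i + 4 \<le> k" "k \<le> n" "k - (k - i) = i"
          using k p by (auto simp: B_def)
        then show "c / real i * prob (L k) \<le> prob (A (k - i) \<inter> L k)"
          using lb[of "k - i" k n] unfolding L_def by simp
      qed
      also have "\<dots> = (\<Sum>j\<in>(\<lambda>i. k - i) ` {4..2 ^ p}. prob (A j \<inter> L k))"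
        by (simp add: sum.reindex[OF inj])
      also have "\<dots> \<le> (\<Sum>j\<in>J p. prob (A j \<inter> L k))"
        by (rule sum_mono2[OF _ sub]) (auto simp: J_def)
      finally show "c * (real p / 8) * prob (L k) \<le> (\<Sum>j\<in>J p. prob (A j \<inter> L k))" .
    qed
    also have "\<dots> = (\<Sum>j\<in>J p. \<Sum>k\<in>B. prob (A j \<inter> L k))"
      by (rule sum.swap)
    also have "\<dots> \<le> (\<Sum>j\<in>J p. C * w j)"
    proof (rule sum_mono)
      fix j assume j: "j \<in> J p"
      \<comment> \<open>Because the \<open>L k\<close> are disjoint, \<open>A j\<close> is counted
        at most once as \<open>k\<close> varies.\<close>
      have "(\<Sum>k\<in>B. prob (A j \<inter> L k)) = prob (\<Union>k\<in>B. A j \<inter> L k)"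
      proof (rule finite_measure_finite_Union[symmetric])
        show "disjoint_family_on (\<lambda>k. A j \<inter> L k) B"
          using Ldisj unfolding disjoint_family_on_def by blast
      qed (use A L in \<open>auto simp: B_def\<close>)
      also have "\<dots> \<le> prob (A j)"
        by (rule finite_measure_mono) (use A in auto)
      also have "\<dots> \<le> C * w j" using j p by (intro ub) (auto simp: J_def)
      finally show "(\<Sum>k\<in>B. prob (A j \<inter> L k)) \<le> C * w j" .
    qed
    finally have *: "c * (real p / 8) * prob (U p) \<le> (\<Sum>j\<in>J p. C * w j)" .
    have "c * (real p / 8) * prob (U p) \<le> c * (real p / 8) * (32 * C / c * ?s p)"
    proof (rule order.trans[OF *])
      have "C * w j \<le> 4 * C * real p * (w j / ln (real j))" if j: "j \<in> J p" for j
      proof -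
        have j1: "j \<ge> 2" "j \<le> 2 ^ (p + 2)" using j p
          by (auto simp: J_def intro: order.trans[of 2 "Suc (2 ^ p)"])
        have "real j \<le> real (2 ^ (p + 2))" using j1 by (simp only: of_nat_le_iff)
        then have "ln (real j) \<le> ln (2 ^ (p + 2))"
          using j1 by simp
        also have "\<dots> = real (p + 2) * ln 2" by (rule ln_realpow)
        also have "\<dots> \<le> real (p + 2) * 1" by (intro mult_left_mono) (auto simp: ln_2_less_1 less_imp_le)
        also have "\<dots> \<le> 4 * real p" using p by simp
        finally have "ln (real j) \<le> 4 * real p" .
        moreover have "ln (real j) > 0" using j1 by simp
        ultimately have "1 \<le> 4 * real p / ln (real j)" by simp
        then have "C * w j * 1 \<le> C * w j * (4 * real p / ln (real j))"
          using C w by (intro mult_left_mono) auto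
        then show ?thesis by (simp add: field_simps)
      qed
      then have "(\<Sum>j\<in>J p. C * w j) \<le> (\<Sum>j\<in>J p. 4 * C * real p * (w j / ln (real j)))"
        by (rule sum_mono)
      also have "\<dots> = c * (real p / 8) * (32 * C / c * ?s p)"
        unfolding sum_distrib_left[symmetric] using c by (simp add: field_simps)
      finally show "(\<Sum>j\<in>J p. C * w j) \<le> c * (real p / 8) * (32 * C / c * ?s p)" .
    qed
    then show ?thesis
      using c p by (subst (asm) mult_le_cancel_left_pos) auto
  qed
  have "summable (\<lambda>p. prob (U p))"
  proof (rule summable_comparison_test_ev)
    show "summable (\<lambda>p. 32 * C / c * ?s p)"
      unfolding J_def by (intro summable_mult summable_dyadic_blocks sum)
    have "\<forall>\<^sub>F p in sequentially. p \<ge> max 4 K" by (rule eventually_ge_at_top)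
    then show "\<forall>\<^sub>F p in sequentially. norm (prob (U p)) \<le> 32 * C / c * ?s p"
    proof eventually_elim
      case (elim p)
      have "K \<le> p" using elim by simp
      also have "p \<le> 2 ^ p" by simp
      finally show ?case using main[of p] elim by simp
    qed
  qed
  then have "AE \<omega> in M. \<forall>\<^sub>F p in sequentially. \<omega> \<in> space M - U p"
    using U by (intro borel_cantelli_AE1) (auto simp: emeasure_eq_measure)
  then show ?thesis
  proof eventually_elim
    case (elim \<omega>)
    then obtain P where P: "\<And>p. p \<ge> P \<Longrightarrow> \<omega> \<notin> U p"
      by (auto simp: eventually_sequentially)
    have "k \<le> 2 ^ (P + 1)" if k: "\<omega> \<in> A k" for k
    proof (rule ccontr)
      assume "\<not> k \<le> 2 ^ (P + 1)"
      define p where "p = (LEAST p. k \<le> 2 ^ (p + 2))"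
      have ex: "k \<le> 2 ^ (k + 2)" by (rule order.trans[of _ "2 ^ k"]) (simp_all add: power_increasing)
      have 1: "k \<le> 2 ^ (p + 2)" unfolding p_def using ex by (rule LeastI)
      have 2: "\<not> k \<le> 2 ^ (p + 1)"
      proof (cases p)
        case 0
        have "(2::nat) ^ 1 \<le> 2 ^ (P + 1)" by (rule power_increasing) auto
        also have "\<dots> < k" using \<open>\<not> k \<le> 2 ^ (P + 1)\<close> by (simp only: not_le)
        finally show ?thesis using 0 by simp
      next
        case (Suc p')
        then show ?thesis using not_less_Least[of p' "\<lambda>p. k \<le> 2 ^ (p + 2)"] by (simp add: p_def)
      qed
      have "p \<ge> P"
      proof (rule ccontr)
        assume "\<not> p \<ge> P"
        then have "(2::nat) ^ (p + 2) \<le> 2 ^ (P + 1)" by (intro power_increasing) auto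
        then show False using 1 \<open>\<not> k \<le> 2 ^ (P + 1)\<close> by simp
      qed
      moreover have "\<omega> \<in> U p" using 1 2 k by (auto simp: U_def)
      ultimately show False using P by blast
    qed
    then have "{k. \<omega> \<in> A k} \<subseteq> {..2 ^ (P + 1)}" by blast
    then show ?case by (rule finite_subset) simp
  qed
qed

text \<open>Cauchy-Schwarz: the weighted count \<open>S\<close> of the occurring events vanishes off
  their union \<open>U\<close>, so the square of its mean is at most its second moment times the
  probability of \<open>U\<close>.\<close>

lemma (in prob_space) prob_union_second_moment:
  fixes A :: "nat \<Rightarrow> 'a set" and l :: "nat \<Rightarrow> real"
  assumes T: "finite T" and A: "\<And>k. A k \<in> events"
  shows "(\<Sum>k\<in>T. l k * prob (A k))\<^sup>2 \<le>
    (\<Sum>j\<in>T. \<Sum>k\<in>T. l j * l k * prob (A j \<inter> A k)) * prob (\<Union>k\<in>T. A k)"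
proof -
  let ?U = "\<Union>k\<in>T. A k"
  let ?S = "\<lambda>x. \<Sum>k\<in>T. l k * indicator (A k) x :: real"
  define m where "m = (\<Sum>k\<in>T. l k * prob (A k))"
  define V where "V = (\<Sum>j\<in>T. \<Sum>k\<in>T. l j * l k * prob (A j \<inter> A k))"
  have U: "?U \<in> events" using A T by auto
  have ind: "has_bochner_integral M (indicator E :: _ \<Rightarrow> real) (prob E)" if "E \<in> events" for E
    using that by (intro has_bochner_integral_real_indicator) (auto simp: emeasure_eq_measure)
  have eq: "(s * ?S x - t * indicator ?U x)\<^sup>2 =
      s\<^sup>2 * (\<Sum>j\<in>T. \<Sum>k\<in>T. l j * l k * indicator (A j \<inter> A k) x)
      - 2 * s * t * (\<Sum>k\<in>T. l k * indicator (A k) x) + t\<^sup>2 * indicator ?U x" for x s t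
  proof -
    have "?S x * indicator ?U x = ?S x"
      unfolding sum_distrib_right by (intro sum.cong) (auto split: split_indicator)
    moreover have "?S x * ?S x = (\<Sum>j\<in>T. \<Sum>k\<in>T. l j * l k * indicator (A j \<inter> A k) x)"
      unfolding sum_product by (intro sum.cong) (auto simp: indicator_inter_arith)
    moreover have "(indicator ?U x :: real) * indicator ?U x = indicator ?U x"
      by (auto split: split_indicator)
    moreover have "(s * S - t * U)\<^sup>2 = s\<^sup>2 * Q - 2 * s * t * S + t\<^sup>2 * U"
      if "S * U = S" "S * S = Q" "U * U = U" for S U Q :: real
    proof -
      have "(s * S - t * U)\<^sup>2 = s\<^sup>2 * (S * S) - 2 * s * t * (S * U) + t\<^sup>2 * (U * U)"
        by (simp add: power2_eq_square algebra_simps)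
      then show ?thesis by (simp only: that)
    qed
    ultimately show ?thesis by blast
  qed
  have quad: "0 \<le> s\<^sup>2 * V - 2 * s * t * m + t\<^sup>2 * prob ?U" for s t
  proof -
    have "0 \<le> (\<integral>x. (s * ?S x - t * indicator ?U x)\<^sup>2 \<partial>M)"
      by (rule integral_nonneg_AE) simp
    also have "\<dots> = s\<^sup>2 * V - 2 * s * t * m + t\<^sup>2 * prob ?U"
      unfolding eq V_def m_def using A U T
      by (intro has_bochner_integral_integral_eq has_bochner_integral_add has_bochner_integral_diff
          has_bochner_integral_mult_right has_bochner_integral_sum ind sets.Int) auto
    finally show ?thesis .
  qed
  \<comment> \<open>For \<open>s = prob ?U\<close> the quadratic in \<open>t\<close> is minimal at
    \<open>t = m\<close>; a common factor \<open>prob ?U\<close> then splits off.\<close>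
  have "0 \<le> (prob ?U)\<^sup>2 * V - 2 * prob ?U * m * m + m\<^sup>2 * prob ?U"
    by (rule quad[of "prob ?U" m])
  then have *: "0 \<le> prob ?U * (V * prob ?U - m\<^sup>2)"
    by (simp add: power2_eq_square algebra_simps)
  show ?thesis
  proof (cases "prob ?U = 0")
    case True
    have "prob (A k) = 0" if "k \<in> T" for k
    proof -
      have "prob (A k) \<le> prob ?U" by (rule finite_measure_mono[OF _ U]) (use that in blast)
      then show ?thesis using True measure_nonneg[of M "A k"] by linarith
    qed
    then show ?thesis using True by simp
  next
    case False
    then have "prob ?U > 0" by (simp add: zero_less_measure_iff)
    then have "V * prob ?U - m\<^sup>2 \<ge> 0"
      using * by (simp add: zero_le_mult_iff)
    then show ?thesis unfolding V_def m_def by simp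
  qed
qed

section \<open>Sums weighted by reciprocal logarithms\<close>

lemma sum_ratio_tail_le:
  fixes w :: "nat \<Rightarrow> real"
  assumes w: "\<And>i. a \<le> i \<Longrightarrow> i \<le> n \<Longrightarrow> w i > 0" and "a \<le> n"
  shows "(\<Sum>j=a..n. w j / (\<Sum>i=j..n. w i)) \<le> 1 + ln (\<Sum>i=a..n. w i) - ln (w n)"
  using assms(2,1)
proof (induction a rule: inc_induct)
  case base
  then show ?case by simp
next
  case (step a)
  let ?s = "\<Sum>i=a..n. w i" and ?s' = "\<Sum>i=Suc a..n. w i"
  have s: "?s = w a + ?s'" using step by (simp add: sum.atLeast_Suc_atMost)
  have s': "?s' > 0" using step by (intro sum_pos) auto
  have wa: "w a > 0" using step by auto
  \<comment> \<open>For the successive tail sums,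
    \<open>w a / ?s = 1 - ?s' / ?s \<le> ln ?s - ln ?s'\<close>, so the sum telescopes; its last
    term is the 1 in the bound.\<close>
  have "ln (?s' / ?s) \<le> ?s' / ?s - 1" using s s' wa by (intro ln_le_minus_one) auto
  also have "ln (?s' / ?s) = ln ?s' - ln ?s" using s s' wa by (simp add: ln_div)
  also have "?s' / ?s - 1 = - (w a / ?s)" using s s' wa by (simp add: field_simps)
  finally have "w a / ?s \<le> ln ?s - ln ?s'" by simp
  moreover have "(\<Sum>j=a..n. w j / (\<Sum>i=j..n. w i)) = w a / ?s + (\<Sum>j=Suc a..n. w j / (\<Sum>i=j..n. w i))"
    using step by (simp add: sum.atLeast_Suc_atMost)
  ultimately show ?case using step.IH step.prems by fastforce
qed

lemma sum_inverse_ge_ln: "a \<le> k \<Longrightarrow> a \<ge> 1 \<Longrightarrow> ln (real k) - ln (real a) \<le> (\<Sum>i\<in>{a..<k}. 1 / real i)"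
proof (induction k rule: dec_induct)
  case (step k)
  have "ln (real (Suc k) / real k) \<le> real (Suc k) / real k - 1"
    using step by (intro ln_le_minus_one) auto
  then have "ln (real (Suc k)) - ln (real k) \<le> 1 / real k"
    using step by (simp add: ln_div field_simps)
  then show ?case using step by simp
qed simp

lemma ln_ge_1: "3 \<le> j \<Longrightarrow> 1 \<le> ln (real j)"
  using exp_le by (subst ln_ge_iff) auto

text \<open>The identity for \<open>D\<close> gives \<open>1 / D j k \<le> w j + w j / s j\<close>,
  where \<open>s j\<close> sums \<open>w\<close> over \<open>{j..<k}\<close>. The first term yields
  the sum on the right. For the second, if \<open>j\<^sup>2 \<le> k\<close> the growth condition
  \<open>wlow\<close> forces \<open>s j \<ge> 1 / (2 * \<delta>)\<close>; otherwise
  \<open>1 / ln j \<le> 2 / ln k\<close>, while the sum of all \<open>w j / s j\<close> is only of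
  order \<open>ln k\<close>.\<close>

lemma weighted_inverse_sum_bound:
  fixes w :: "nat \<Rightarrow> real" and D :: "nat \<Rightarrow> nat \<Rightarrow> real"
  assumes K: "K \<ge> 3" and w: "\<And>k. K \<le> k \<Longrightarrow> 0 < w k \<and> w k \<le> 1"
    and \<delta>: "\<delta> > 0" and wlow: "\<And>k. K \<le> k \<Longrightarrow> 1 \<le> \<delta> * real k * ln (real k) * w k"
    and D: "\<And>j k. K \<le> j \<Longrightarrow> j < k \<Longrightarrow> w j * D j k = 1 - (\<Prod>i\<in>{j..<k}. 1 - w i)"
  obtains B where "B > 0"
    "\<And>a k. K \<le> a \<Longrightarrow> a < k \<Longrightarrow>
      (\<Sum>j\<in>{a..<k}. 1 / ln (real j) / D j k) \<le> B * (1 + (\<Sum>j\<in>{a..<k}. w j / ln (real j)))"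
proof
  \<comment> \<open>\<open>1 + 2 * \<delta>\<close> collects the terms comparable to
    \<open>w j / ln j\<close>; the rest is twice the constant
    \<open>4 + \<bar>ln \<delta>\<bar>\<close> in the bound for the sum of
    \<open>w j / s j\<close>.\<close>
  define B where "B = 1 + 2 * \<delta> + 2 * (4 + \<bar>ln \<delta>\<bar>)"
  show "B > 0" using \<delta> by (simp add: B_def)
  fix a k assume a: "K \<le> a" "a < k"
  let ?v = "\<Sum>j\<in>{a..<k}. w j / ln (real j)"
  define s where "s j = (\<Sum>i\<in>{j..<k}. w i)" for j
  have ln1: "ln (real j) \<ge> 1" if "K \<le> j" for j using K that by (intro ln_ge_1) simp
  have spos: "s j > 0" if "K \<le> j" "j < k" for j
    unfolding s_def using w that by (intro sum_pos) auto
  have Dinv: "1 / D j k \<le> w j + w j / s j" if j: "K \<le> j" "j < k" for j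
  proof -
    have "(\<Prod>i\<in>{j..<k}. 1 - w i) \<le> (\<Prod>i\<in>{j..<k}. exp (- w i))"
      using j w by (intro prod_mono) (auto simp: exp_ge_add_one_self[of "- w _", simplified])
    also have "\<dots> = exp (- s j)"
      by (simp add: s_def exp_sum[symmetric] sum_negf)
    finally have "w j * D j k \<ge> 1 - exp (- s j)" using D[OF j] by simp
    moreover have "1 - exp (- s j) \<ge> s j / (1 + s j)"
    proof -
      have "1 + s j \<le> exp (s j)" by simp
      then have "inverse (exp (s j)) \<le> inverse (1 + s j)"
        using spos[OF j] by (intro le_imp_inverse_le) auto
      moreover have "1 - inverse (1 + s j) = s j / (1 + s j)"
        using spos[OF j] by (simp add: field_simps)
      ultimately show ?thesis unfolding exp_minus by linarith
    qed
    ultimately have 1: "s j / (1 + s j) \<le> w j * D j k" by linarith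
    have 2: "0 < s j / (1 + s j)" using spos[OF j] by simp
    have wj: "w j > 0" using w j by auto
    from 1 2 have "w j * D j k > 0" by linarith
    then have Dp: "D j k > 0" using wj by (simp add: zero_less_mult_iff)
    have "1 / (w j * D j k) \<le> 1 / (s j / (1 + s j))"
      using 1 2 wj Dp by (intro divide_left_mono mult_pos_pos) auto
    then have "w j * (1 / (w j * D j k)) \<le> w j * (1 / (s j / (1 + s j)))"
      using wj by (intro mult_left_mono) auto
    then show ?thesis using wj Dp spos[OF j] by (simp add: field_simps)
  qed
  have bound: "1 / ln (real j) / D j k \<le> (1 + 2 * \<delta>) * (w j / ln (real j)) + 2 / ln (real k) * (w j / s j)"
    if j: "a \<le> j" "j < k" for j
  proof -
    have jK: "K \<le> j" using a j by simp
    have l: "ln (real j) > 0" using ln1[OF jK] by simp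
    have lk: "ln (real k) > 0" using ln1[of k] jK j by linarith
    have wj: "w j > 0" using w jK by auto
    have "1 / ln (real j) / D j k = 1 / ln (real j) * (1 / D j k)" by simp
    also have "\<dots> \<le> 1 / ln (real j) * (w j + w j / s j)"
      using Dinv[OF jK j(2)] l by (intro mult_left_mono) auto
    also have "\<dots> = w j / ln (real j) + 1 / ln (real j) * (w j / s j)" by (simp add: add_divide_distrib)
    also have "1 / ln (real j) * (w j / s j) \<le> 2 * \<delta> * (w j / ln (real j)) + 2 / ln (real k) * (w j / s j)"
    proof (cases "j\<^sup>2 \<le> k")
      case True
      have "2 * ln (real j) = ln (real (j\<^sup>2))" using jK K by (simp add: ln_realpow)
      also have "\<dots> \<le> ln (real k)" using True jK K j by (subst ln_le_cancel_iff) auto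
      finally have "ln (real k) / 2 \<le> ln (real k) - ln (real j)" by simp
      also have "\<dots> \<le> (\<Sum>i\<in>{j..<k}. 1 / real i)"
        using jK K j by (intro sum_inverse_ge_ln) auto
      also have "\<dots> \<le> (\<Sum>i\<in>{j..<k}. \<delta> * ln (real k) * w i)"
      proof (rule sum_mono)
        fix i assume i: "i \<in> {j..<k}"
        then have iK: "K \<le> i" using jK by simp
        have "1 \<le> \<delta> * real i * ln (real i) * w i" using wlow[OF iK] .
        also have "\<dots> \<le> \<delta> * real i * ln (real k) * w i"
          using i iK K \<delta> w[OF iK] by (intro mult_right_mono mult_left_mono) auto
        finally show "1 / real i \<le> \<delta> * ln (real k) * w i"
          using iK K by (simp add: field_simps)
      qed
      also have "\<dots> = ln (real k) * (\<delta> * s j)" by (simp add: s_def sum_distrib_left mult_ac)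
      finally have "1 / 2 \<le> \<delta> * s j" using lk by (simp add: field_simps)
      then have "1 / s j \<le> 2 * \<delta>" using spos[OF jK j(2)] by (simp add: field_simps)
      then have "(w j / ln (real j)) * (1 / s j) \<le> (w j / ln (real j)) * (2 * \<delta>)"
        using wj l by (intro mult_left_mono) auto
      moreover have "0 \<le> 2 / ln (real k) * (w j / s j)" using lk wj spos[OF jK j(2)] by simp
      ultimately show ?thesis by (simp add: field_simps)
    next
      case False
      then have "real k \<le> real (j\<^sup>2)" by (subst of_nat_le_iff) simp
      then have "ln (real k) \<le> ln (real (j\<^sup>2))" using jK K j by (subst ln_le_cancel_iff) auto
      also have "\<dots> = 2 * ln (real j)" using jK K by (simp add: ln_realpow)
      finally have "1 / ln (real j) \<le> 2 / ln (real k)" using l lk by (simp add: field_simps)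
      then have "1 / ln (real j) * (w j / s j) \<le> 2 / ln (real k) * (w j / s j)"
        using wj spos[OF jK j(2)] by (intro mult_right_mono) auto
      moreover have "0 \<le> 2 * \<delta> * (w j / ln (real j))" using \<delta> wj l by simp
      ultimately show ?thesis by linarith
    qed
    finally show ?thesis by (simp add: algebra_simps)
  qed
  have lk: "ln (real k) \<ge> 1" using ln1[of k] a by simp
  have k0: "real k > 0" using a by simp
  have sumw: "(\<Sum>j\<in>{a..<k}. w j / s j) \<le> (4 + \<bar>ln \<delta>\<bar>) * ln (real k)"
  proof -
    obtain n where n: "k = Suc n" using a by (cases k) auto
    have an: "a \<le> n" using a n by simp
    have wn: "w n > 0" using w[of n] an a by auto
    have set: "{j..<k} = {j..n}" for j by (simp add: n atLeastLessThanSuc_atLeastAtMost)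
    have "(\<Sum>j\<in>{a..<k}. w j / s j) \<le> 1 + ln (\<Sum>i=a..n. w i) - ln (w n)"
      unfolding s_def set using an a w by (intro sum_ratio_tail_le) auto
    moreover have "ln (\<Sum>i=a..n. w i) \<le> ln (real k)"
    proof -
      have "(\<Sum>i=a..n. w i) \<le> (\<Sum>i=a..n. 1)" using w a by (intro sum_mono) auto
      also have "\<dots> \<le> real k" by (simp add: n)
      finally have "(\<Sum>i=a..n. w i) \<le> real k" .
      moreover have "(\<Sum>i=a..n. w i) > 0" using spos[of a] a by (simp add: s_def set)
      ultimately show ?thesis using k0 by (subst ln_le_cancel_iff) auto
    qed
    \<comment> \<open>The last weight may be as small as \<open>1 / (\<delta> * n * ln n)\<close>,
      but the logarithm of its reciprocal is still of order \<open>ln k\<close>.\<close>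
    moreover have "- ln (w n) \<le> \<bar>ln \<delta>\<bar> * ln (real k) + 2 * ln (real k)"
    proof -
      have nK: "K \<le> n" using a an by simp
      have nn: "real n \<ge> 1" "real n \<le> real k" using nK K by (auto simp: n)
      have "0 \<le> ln (\<delta> * real n * ln (real n) * w n)"
        using wlow[OF nK] by simp
      also have "\<dots> = ln \<delta> + ln (real n) + ln (ln (real n)) + ln (w n)"
        using \<delta> nK K ln1[OF nK] wn by (simp add: ln_mult)
      finally have "- ln (w n) \<le> ln \<delta> + ln (real n) + ln (ln (real n))" by simp
      moreover have "ln (ln (real n)) \<le> ln (real n)"
        using ln1[OF nK] ln_le_minus_one[of "ln (real n)"] by linarith
      moreover have "ln (real n) \<le> ln (real k)" using nn k0 by simp
      moreover have "ln \<delta> \<le> \<bar>ln \<delta>\<bar> * ln (real k)"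
        using lk mult_left_mono[of 1 "ln (real k)" "\<bar>ln \<delta>\<bar>"] by linarith
      ultimately show ?thesis by linarith
    qed
    ultimately show ?thesis using lk by (simp add: algebra_simps)
  qed
  have vnn: "0 \<le> ?v"
  proof (rule sum_nonneg)
    fix j assume "j \<in> {a..<k}"
    then have "K \<le> j" using a by simp
    then show "0 \<le> w j / ln (real j)" using w[of j] ln1[of j] by auto
  qed
  have "(\<Sum>j\<in>{a..<k}. 1 / ln (real j) / D j k) \<le>
      (\<Sum>j\<in>{a..<k}. (1 + 2 * \<delta>) * (w j / ln (real j)) + 2 / ln (real k) * (w j / s j))"
    by (rule sum_mono) (use bound in auto)
  also have "\<dots> = (1 + 2 * \<delta>) * ?v + 2 / ln (real k) * (\<Sum>j\<in>{a..<k}. w j / s j)"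
    by (simp add: sum.distrib sum_distrib_left)
  also have "\<dots> \<le> (1 + 2 * \<delta>) * ?v + 2 / ln (real k) * ((4 + \<bar>ln \<delta>\<bar>) * ln (real k))"
    using sumw lk by (intro add_left_mono mult_left_mono) auto
  also have "\<dots> = (1 + 2 * \<delta>) * ?v + 2 * (4 + \<bar>ln \<delta>\<bar>)"
    using lk by (simp add: field_simps)
  also have "\<dots> \<le> B * ?v + B * 1"
    using \<delta> by (intro add_mono[OF mult_right_mono[OF _ vnn]]) (auto simp: B_def)
  finally show "(\<Sum>j\<in>{a..<k}. 1 / ln (real j) / D j k) \<le> B * (1 + (\<Sum>j\<in>{a..<k}. w j / ln (real j)))"
    by (simp add: algebra_simps)
qed

lemma sum_square_symmetric:
  fixes f :: "nat \<Rightarrow> nat \<Rightarrow> real"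
  assumes "\<And>j k. f j k = f k j"
  shows "(\<Sum>j\<in>{a..<n}. \<Sum>k\<in>{a..<n}. f j k) = (\<Sum>k\<in>{a..<n}. f k k + 2 * (\<Sum>j\<in>{a..<k}. f j k))"
proof (induction n)
  case (Suc n)
  show ?case
  proof (cases "a \<le> n")
    case True
    have "(\<Sum>j\<in>{a..<n}. f n j) = (\<Sum>j\<in>{a..<n}. f j n)" by (simp add: assms)
    with True Suc show ?thesis by (simp add: sum.distrib)
  qed simp
qed simp

text \<open>With weights \<open>l k = 1 / ln k\<close> and a cutoff \<open>n\<close> the first
  moment is at least \<open>c * v n\<close>, and for \<open>v n \<ge> 1\<close> the second moment is
  at most a multiple of \<open>(v n)\<^sup>2\<close>. The factor \<open>v n\<close> cancels, so the
  resulting bound does not depend on \<open>a\<close>.\<close>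

lemma (in prob_space) prob_occurrence_ge:
  fixes A :: "nat \<Rightarrow> 'a set" and w :: "nat \<Rightarrow> real" and D :: "nat \<Rightarrow> nat \<Rightarrow> real"
  assumes A: "\<And>k. A k \<in> events" and a: "a \<ge> 3"
    and ub1: "\<And>k. a \<le> k \<Longrightarrow> prob (A k) \<le> C * w k"
    and ub2: "\<And>j k. a \<le> j \<Longrightarrow> j < k \<Longrightarrow> prob (A j \<inter> A k) \<le> C * w k * (1 / D j k)"
    and lb: "\<And>k. a \<le> k \<Longrightarrow> c * w k \<le> prob (A k)"
    and c: "c > 0" and C: "C > 0" and B: "B > 0" and w: "\<And>k. a \<le> k \<Longrightarrow> w k \<ge> 0"
    and D: "\<And>k. a < k \<Longrightarrow>
      (\<Sum>j\<in>{a..<k}. 1 / ln (real j) / D j k) \<le> B * (1 + (\<Sum>j\<in>{a..<k}. w j / ln (real j)))"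
    and div: "\<not> summable (\<lambda>k. w k / ln (real k))"
  shows "c\<^sup>2 / (C + 4 * C * B) \<le> prob (\<Union>k\<in>{a..}. A k)"
proof -
  define l where "l k = 1 / ln (real k)" for k
  have ln1: "ln (real j) \<ge> 1" if "a \<le> j" for j using a that by (intro ln_ge_1) simp
  have l: "0 < l k" "l k \<le> 1" if "a \<le> k" for k using ln1[OF that] by (auto simp: l_def)
  define v where "v n = (\<Sum>k\<in>{a..<n}. l k * w k)" for n
  have v_mono: "v k \<le> v n" if "k \<le> n" for k n
    unfolding v_def using that l(1)[THEN less_imp_le] w by (intro sum_mono2) auto
  have v_nonneg: "0 \<le> v n" for n
    unfolding v_def using l(1)[THEN less_imp_le] w by (intro sum_nonneg) auto
  \<comment> \<open>\<open>v n \<ge> 1\<close> absorbs the diagonal terms and gives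
    \<open>1 + v k \<le> 2 * v n\<close>; together with the factor 2 for unordered pairs this is the
    4 in \<open>4 * C * B\<close>.\<close>
  obtain n where n: "v n \<ge> 1"
  proof -
    have "\<not> summable (\<lambda>k. l (k + a) * w (k + a))"
      using div summable_iff_shift[of "\<lambda>k. w k / ln (real k)" a] by (simp add: l_def)
    have "\<exists>m. (\<Sum>k<m. l (k + a) * w (k + a)) \<ge> 1"
    proof (rule ccontr)
      assume "\<not> ?thesis"
      then have "summable (\<lambda>k. l (k + a) * w (k + a))"
        using l(1)[THEN less_imp_le] w
        by (intro summableI_nonneg_bounded[where x = 1]) (auto simp: not_le intro: less_imp_le)
      with \<open>\<not> summable (\<lambda>k. l (k + a) * w (k + a))\<close> show False ..
    qed
    then obtain m where m: "(\<Sum>k<m. l (k + a) * w (k + a)) \<ge> 1" ..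
    have "(\<Sum>k<m. l (k + a) * w (k + a)) = v (m + a)"
      unfolding v_def
      using sum.shift_bounds_nat_ivl[of "\<lambda>k. l k * w k" 0 a m] by (simp add: atLeast0LessThan)
    with m show ?thesis using that by simp
  qed
  let ?T = "{a..<n}"
  define V where "V = (\<Sum>j\<in>?T. \<Sum>k\<in>?T. l j * l k * prob (A j \<inter> A k))"
  have "V = (\<Sum>k\<in>?T. l k * l k * prob (A k \<inter> A k) + 2 * (\<Sum>j\<in>{a..<k}. l j * l k * prob (A j \<inter> A k)))"
    unfolding V_def by (rule sum_square_symmetric) (simp add: Int_commute mult_ac)
  also have "\<dots> \<le> (\<Sum>k\<in>?T. (C + 4 * C * B) * v n * (l k * w k))"
  proof (rule sum_mono)
    fix k assume "k \<in> ?T"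
    then have k: "a \<le> k" "k < n" by auto
    have "l k * l k * prob (A k \<inter> A k) \<le> 1 * l k * (C * w k)"
      using l[OF k(1)] ub1[OF k(1)] by (intro mult_mono) auto
    also have "\<dots> \<le> C * (l k * w k) * v n"
      using mult_left_mono[OF n, of "C * (l k * w k)"] C l[OF k(1)] w[OF k(1)] by simp
    finally have 1: "l k * l k * prob (A k \<inter> A k) \<le> C * v n * (l k * w k)" by (simp add: mult_ac)
    have "(\<Sum>j\<in>{a..<k}. l j * l k * prob (A j \<inter> A k)) \<le> (\<Sum>j\<in>{a..<k}. l j * l k * (C * w k * (1 / D j k)))"
    proof (intro sum_mono mult_left_mono)
      fix j assume "j \<in> {a..<k}"
      then show "prob (A j \<inter> A k) \<le> C * w k * (1 / D j k)" "0 \<le> l j * l k"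
        using ub2[of j k] l[of j] l[of k] by auto
    qed
    also have "\<dots> = C * (l k * w k) * (\<Sum>j\<in>{a..<k}. 1 / ln (real j) / D j k)"
      by (simp add: sum_distrib_left l_def mult_ac)
    also have "\<dots> \<le> C * (l k * w k) * (B * (1 + v k))"
    proof (cases "k = a")
      case True
      then show ?thesis using C B l[OF k(1)] w[OF k(1)] v_nonneg[of a] by simp
    next
      case False
      then have "(\<Sum>j\<in>{a..<k}. 1 / ln (real j) / D j k) \<le> B * (1 + v k)"
        using D[of k] k by (simp add: v_def l_def)
      then show ?thesis using C l[OF k(1)] w[OF k(1)] by (intro mult_left_mono) auto
    qed
    also have "\<dots> \<le> C * (l k * w k) * (B * (2 * v n))"
      using v_mono[of k n] k n C B l[OF k(1)] w[OF k(1)] by (intro mult_left_mono) auto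
    finally have 2: "2 * (\<Sum>j\<in>{a..<k}. l j * l k * prob (A j \<inter> A k)) \<le> 4 * C * B * v n * (l k * w k)"
      by (simp add: mult_ac)
    show "l k * l k * prob (A k \<inter> A k) + 2 * (\<Sum>j\<in>{a..<k}. l j * l k * prob (A j \<inter> A k)) \<le>
        (C + 4 * C * B) * v n * (l k * w k)"
      using 1 2 by (simp add: algebra_simps)
  qed
  also have "\<dots> = (C + 4 * C * B) * (v n)\<^sup>2"
    by (simp add: sum_distrib_left[symmetric] v_def power2_eq_square)
  finally have V: "V \<le> (C + 4 * C * B) * (v n)\<^sup>2" .
  let ?U = "\<Union>k\<in>?T. A k"
  have "(c * v n)\<^sup>2 \<le> (\<Sum>k\<in>?T. l k * prob (A k))\<^sup>2"
  proof (rule power_mono)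
    have "c * v n = (\<Sum>k\<in>?T. l k * (c * w k))" by (simp add: v_def sum_distrib_left mult_ac)
    also have "\<dots> \<le> (\<Sum>k\<in>?T. l k * prob (A k))"
      using lb l(1)[THEN less_imp_le] by (intro sum_mono mult_left_mono) auto
    finally show "c * v n \<le> (\<Sum>k\<in>?T. l k * prob (A k))" .
    show "0 \<le> c * v n" using c v_nonneg by simp
  qed
  also have "\<dots> \<le> V * prob ?U"
    unfolding V_def by (rule prob_union_second_moment) (use A in auto)
  also have "\<dots> \<le> (C + 4 * C * B) * (v n)\<^sup>2 * prob ?U"
    by (intro mult_right_mono V) simp
  finally have "(v n)\<^sup>2 * c\<^sup>2 \<le> (v n)\<^sup>2 * ((C + 4 * C * B) * prob ?U)"
    by (simp add: power_mult_distrib mult_ac)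
  then have "c\<^sup>2 \<le> (C + 4 * C * B) * prob ?U"
    using n by (subst (asm) mult_le_cancel_left_pos) auto
  moreover have "C + 4 * C * B > 0" using C B by (intro add_pos_pos mult_pos_pos) auto
  ultimately have "c\<^sup>2 / (C + 4 * C * B) \<le> prob ?U" by (simp add: field_simps)
  also have "\<dots> \<le> prob (\<Union>k\<in>{a..}. A k)"
    using A by (intro finite_measure_mono) auto
  finally show ?thesis .
qed

section \<open>Almost sure properties of paths\<close>

lemma adapted_mono: "adapted n R \<Longrightarrow> n \<le> m \<Longrightarrow> adapted m R"
  unfolding adapted_def by (meson le_trans)

text \<open>The approximable sets contain the cylinders and are closed under complements, which
  leave the symmetric difference unchanged, and under countable unions: half of
  \<open>\<epsilon>\<close> pays for replacing the union by finitely many sets, the other half for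
  approximating those.\<close>

lemma approx_by_adapted:
  assumes N: "sets N = sets path_space" and fin: "finite_measure N"
    and E: "E \<in> sets path_space" and \<epsilon>: "\<epsilon> > 0"
  shows "\<exists>n R. adapted n R \<and> measure N ((E - {w. R w}) \<union> ({w. R w} - E)) < \<epsilon>"
proof -
  interpret finite_measure N by fact
  have space: "space N = UNIV" using sets_eq_imp_space_eq[OF N] by simp
  have ad: "{w. R w} \<in> sets N" if "adapted n R" for n R
    unfolding N by (rule sets_path adapted_measurable that)+
  have "E \<in> sigma_sets UNIV cylinders" using E by (simp add: sets_path_space)
  then show ?thesis using \<epsilon>
  proof (induction arbitrary: \<epsilon> rule: sigma_sets.induct)
    case (Basic E)
    then consider "E = {}" | n v where "E = {w. \<forall>i\<le>n. w i = v i}"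
      unfolding cylinders_def by blast
    then show ?case
    proof cases
      case 1
      then show ?thesis using Basic by (intro exI[of _ 0] exI[of _ "\<lambda>_. False"]) (simp add: adapted_def)
    next
      case (2 n v)
      then show ?thesis
        using Basic by (intro exI[of _ n] exI[of _ "\<lambda>w. \<forall>i\<le>n. w i = v i"]) (simp add: adapted_def)
    qed
  next
    case Empty
    then show ?case by (intro exI[of _ 0] exI[of _ "\<lambda>_. False"]) (simp add: adapted_def)
  next
    case (Compl E)
    then obtain n R where R: "adapted n R" "measure N ((E - {w. R w}) \<union> ({w. R w} - E)) < \<epsilon>"
      by blast
    have "((UNIV - E) - {w. \<not> R w}) \<union> ({w. \<not> R w} - (UNIV - E)) = (E - {w. R w}) \<union> ({w. R w} - E)"
      by blast
    with R show ?case
      by (intro exI[of _ n] exI[of _ "\<lambda>w. \<not> R w"]) (simp add: adapted_def)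
  next
    case (Union E)
    have EN: "E i \<in> sets N" for i using Union by (simp add: N sets_path_space)
    define F where "F n = (\<Union>i<n. E i)" for n
    have FN: "F n \<in> sets N" for n unfolding F_def using EN by auto
    have UN: "(\<Union>i. E i) \<in> sets N" using EN by auto
    have "(\<lambda>n. measure N (F n)) \<longlonglongrightarrow> measure N (\<Union>n. F n)"
      by (rule finite_Lim_measure_incseq) (use FN in \<open>force simp: incseq_def F_def\<close>)+
    moreover have "(\<Union>n. F n) = (\<Union>i. E i)" unfolding F_def by blast
    ultimately have "\<forall>\<^sub>F n in sequentially. measure N (F n) > measure N (\<Union>i. E i) - \<epsilon> / 2"
      using Union.prems by (intro order_tendstoD(1)) auto
    then obtain n where n: "measure N (F n) > measure N (\<Union>i. E i) - \<epsilon> / 2"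
      by (auto simp: eventually_sequentially)
    \<comment> \<open>Using \<open>n + 1\<close> covers the case \<open>n = 0\<close>;
      \<open>n\<close> errors of this size add up to at most \<open>\<epsilon> / 2\<close>.\<close>
    have "\<exists>m R. adapted m R \<and> measure N ((E i - {w. R w}) \<union> ({w. R w} - E i)) < \<epsilon> / (2 * (real n + 1))" for i
      using Union.IH[of "\<epsilon> / (2 * (real n + 1))"] Union.prems by simp
    then obtain m R where mR: "\<And>i. adapted (m i) (R i)"
        "\<And>i. measure N ((E i - {w. R i w}) \<union> ({w. R i w} - E i)) < \<epsilon> / (2 * (real n + 1))"
      by metis
    define S where "S i = (E i - {w. R i w}) \<union> ({w. R i w} - E i)" for i
    have SN: "S i \<in> sets N" for i unfolding S_def using EN ad[OF mR(1)] by auto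
    define m' where "m' = Max (m ` {..<n} \<union> {0})"
    have adR: "adapted m' (\<lambda>w. \<exists>i<n. R i w)"
    proof -
      have "adapted m' (R i)" if "i < n" for i
        using mR(1) by (rule adapted_mono) (auto simp: m'_def that intro!: Max_ge)
      then show ?thesis unfolding adapted_def by blast
    qed
    let ?D = "((\<Union>i. E i) - {w. \<exists>i<n. R i w}) \<union> ({w. \<exists>i<n. R i w} - (\<Union>i. E i))"
    have "?D \<subseteq> ((\<Union>i. E i) - F n) \<union> (\<Union>i<n. S i)"
      unfolding F_def S_def by blast
    then have "measure N ?D \<le> measure N (((\<Union>i. E i) - F n) \<union> (\<Union>i<n. S i))"
      using UN FN SN by (intro finite_measure_mono) auto
    also have "\<dots> \<le> measure N ((\<Union>i. E i) - F n) + measure N (\<Union>i<n. S i)"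
      using UN FN SN by (intro measure_Un_le) auto
    also have "measure N ((\<Union>i. E i) - F n) = measure N (\<Union>i. E i) - measure N (F n)"
      using UN FN by (intro finite_measure_Diff) (auto simp: F_def)
    also have "measure N (\<Union>i<n. S i) \<le> (\<Sum>i<n. measure N (S i))"
      using SN by (intro measure_UNION_le) auto
    also have "(\<Sum>i<n. measure N (S i)) \<le> (\<Sum>i<n. \<epsilon> / (2 * (real n + 1)))"
      using mR(2) by (intro sum_mono less_imp_le) (simp add: S_def)
    also have "\<dots> = real n * \<epsilon> / (2 * (real n + 1))" by simp
    also have "\<dots> \<le> \<epsilon> / 2" using Union.prems by (simp add: field_simps)
    finally have "measure N ?D < \<epsilon>" using n by simp
    with adR show ?case by blast
  qed
qed

section \<open>First-step analysis\<close>

lemma measure_path_law_le_1: "measure (path_law K x) E \<le> 1"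
  by (rule prob_space.prob_le_1[OF prob_space_path_law])

lemma measure_path_law_UNIV: "measure (path_law K x) UNIV = 1"
  using prob_space.prob_space[OF prob_space_path_law] by simp

lemma AE_path_start: "AE w in path_law K x. w 0 = x"
proof -
  interpret prob_space "path_law K x" by (rule prob_space_path_law)
  have "emeasure (path_law K x) {w. \<forall>i\<le>0. w i = x} = 1"
    by (subst emeasure_path_law_cylinder[where v = "\<lambda>_. x"]) simp
  then have "prob {w \<in> space (path_law K x). w 0 = x} = 1"
    by (simp add: measure_def)
  then show ?thesis by (subst (asm) prob_Collect_eq_1) (auto intro!: sets_path)
qed

lemma prob_step:
  assumes R: "adapted n R" and y: "\<forall>w. R w \<longrightarrow> w n = y"
  shows "measure (path_law K x) {w. R w \<and> w (Suc n) = z} = measure (path_law K x) {w. R w} * pmf (K y) z"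
proof -
  let ?v = "\<lambda>i. if i = 0 then y else z"
  have "{w. R w \<and> w (Suc n) = z} = {w. R w \<and> (\<forall>i\<le>1. w (n + i) = ?v i)}"
  proof -
    have "(\<forall>i\<le>1. w (n + i) = ?v i) \<longleftrightarrow> w n = y \<and> w (Suc n) = z" for w
      by (auto simp: le_Suc_eq)
    then show ?thesis using y by auto
  qed
  then show ?thesis
    using markov_property_cylinder[OF R y, of K x 1 ?v]
    by (simp only: emeasure_path_law_cylinder) (simp add: measure_def enn2real_mult)
qed

lemma AE_path_steps: "AE w in path_law K x. \<forall>i. w (Suc i) \<in> set_pmf (K (w i))"
proof -
  interpret prob_space "path_law K x" by (rule prob_space_path_law)
  have "AE w in path_law K x. \<forall>i y z. z \<notin> set_pmf (K y) \<longrightarrow> \<not> (w i = y \<and> w (Suc i) = z)"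
    unfolding AE_all_countable
  proof (intro allI)
    fix i y z
    show "AE w in path_law K x. z \<notin> set_pmf (K y) \<longrightarrow> \<not> (w i = y \<and> w (Suc i) = z)"
    proof (cases "z \<in> set_pmf (K y)")
      case False
      have "prob {w. w i = y \<and> w (Suc i) = z} = 0"
        using False by (subst prob_step[where y = y]) (auto simp: adapted_def set_pmf_iff)
      then have "prob {w \<in> space (path_law K x). w i = y \<and> w (Suc i) = z} = 0" by simp
      then have "AE w in path_law K x. \<not> (w i = y \<and> w (Suc i) = z)"
        by (subst (asm) prob_Collect_eq_0) (auto intro!: sets_path)
      then show ?thesis by auto
    qed simp
  qed
  then show ?thesis by eventually_elim blast
qed

lemma prob_cong_AE:
  assumes "AE w in path_law K x. R w \<longleftrightarrow> S w"
    and [measurable]: "path_pred R" "path_pred S"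
  shows "measure (path_law K x) {w. R w} = measure (path_law K x) {w. S w}"
proof -
  interpret prob_space "path_law K x" by (rule prob_space_path_law)
  show ?thesis
    by (rule finite_measure_eq_AE) (use assms in \<open>auto simp: sets_path\<close>)
qed

lemma prob_mono_AE:
  assumes "AE w in path_law K x. R w \<longrightarrow> S w"
    and [measurable]: "path_pred S"
  shows "measure (path_law K x) {w. R w} \<le> measure (path_law K x) {w. S w}"
proof -
  interpret prob_space "path_law K x" by (rule prob_space_path_law)
  show ?thesis
    by (rule finite_measure_mono_AE) (use assms in \<open>auto simp: sets_path\<close>)
qed

lemma prob_first_step:
  assumes [measurable]: "path_pred B"
  shows "measure (path_law K x) {w. w 1 = y \<and> B (path_shift 1 w)} = pmf (K x) y * measure (path_law K y) {w. B w}"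
proof -
  let ?Q = "path_law K x"
  have "measure ?Q {w. w 1 = y \<and> B (path_shift 1 w)} =
      measure ?Q {w. (w 0 = x \<and> w 1 = y) \<and> B (path_shift 1 w)}"
    by (rule prob_cong_AE) (use AE_path_start[of x K] in \<open>auto elim: eventually_mono\<close>)
  also have "\<dots> = measure ?Q {w. w 0 = x \<and> w 1 = y} * measure (path_law K y) {w. B w}"
    by (rule markov_property) (auto simp: adapted_def)
  also have "measure ?Q {w. w 0 = x \<and> w 1 = y} = measure ?Q {w. w 0 = x} * pmf (K x) y"
    using prob_step[of 0 "\<lambda>w. w 0 = x" x K x y] by (simp add: adapted_def)
  also have "measure ?Q {w. w 0 = x} = measure ?Q {w. True}"
    by (rule prob_cong_AE) (use AE_path_start[of x K] in \<open>auto elim: eventually_mono\<close>)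
  also have "\<dots> = 1"
    by (simp add: measure_path_law_UNIV)
  finally show ?thesis by (simp del: path_shift_apply)
qed

section \<open>Passage events and cutpoint events\<close>

lemma first_passage:
  fixes w :: "nat \<Rightarrow> nat"
  assumes "k \<le> w m"
  obtains n where "n \<le> m" "k \<le> w n" "\<And>i. i < n \<Longrightarrow> w i < k"
proof
  let ?n = "LEAST n. k \<le> w n"
  show "?n \<le> m" using assms by (rule Least_le)
  show "k \<le> w ?n" using assms by (rule LeastI)
  show "w i < k" if "i < ?n" for i using not_less_Least[OF that] by simp
qed

text \<open>Exit of the interval \<open>{lo..<k}\<close> into \<open>T\<close>, where time 0 already
  counts. \<open>T = {k..}\<close> gives upward exit, and \<open>T = {k + 1}\<close> prescribes the
  overshoot as well.\<close>

definition reaches :: "nat \<Rightarrow> nat \<Rightarrow> nat set \<Rightarrow> (nat \<Rightarrow> nat) \<Rightarrow> bool" where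
  "reaches lo k T w \<longleftrightarrow> (\<exists>n. (\<forall>i<n. lo \<le> w i \<and> w i < k) \<and> w n \<in> T)"

lemma measurable_reaches [measurable]: "path_pred (reaches lo k T)"
  unfolding reaches_def by measurable

lemma reaches_shift: "lo \<le> w 0 \<Longrightarrow> w 0 < k \<Longrightarrow> w 0 \<notin> T \<Longrightarrow> reaches lo k T w \<longleftrightarrow> reaches lo k T (path_shift 1 w)"
proof
  assume w0: "lo \<le> w 0" "w 0 < k" "w 0 \<notin> T" and "reaches lo k T w"
  then obtain n where n: "\<forall>i<n. lo \<le> w i \<and> w i < k" "w n \<in> T" by (auto simp: reaches_def)
  then obtain m where "n = Suc m" using w0 by (cases n) auto
  then show "reaches lo k T (path_shift 1 w)" using n unfolding reaches_def by (intro exI[of _ m]) auto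
next
  assume w0: "lo \<le> w 0" "w 0 < k" and "reaches lo k T (path_shift 1 w)"
  then obtain m where n: "\<forall>i<m. lo \<le> w (Suc i) \<and> w (Suc i) < k" "w (Suc m) \<in> T" by (auto simp: reaches_def)
  have "\<forall>i<Suc m. lo \<le> w i \<and> w i < k" using n w0 by (auto simp: less_Suc_eq_0_disj)
  then show "reaches lo k T w" using n unfolding reaches_def by blast
qed

text \<open>\<open>cut_at 0 k\<close> describes the cutpoints of the (2,1) walk and \<open>cut_at 1 k\<close> those of the (1,2) walk,
  almost surely and for \<open>k\<close> above the starting point.\<close>

definition cut_at :: "nat \<Rightarrow> nat \<Rightarrow> (nat \<Rightarrow> nat) \<Rightarrow> bool" where
  "cut_at c k w \<longleftrightarrow> (\<exists>n. (\<forall>i<n. w i < k) \<and> w n = k + c \<and> (\<forall>m>n. k < w m))"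

lemma measurable_cut_at [measurable]: "path_pred (cut_at c k)"
  unfolding cut_at_def by measurable

text \<open>The time witnessing the cutpoint is the first one at or above \<open>k\<close>, hence
  not among the discarded times; the shift only renumbers it.\<close>

lemma cut_at_shift:
  assumes "\<forall>i<n. w i < k"
  shows "cut_at c k w \<longleftrightarrow> cut_at c k (path_shift n w)"
proof
  assume "cut_at c k w"
  then obtain m where m: "\<forall>i<m. w i < k" "w m = k + c" "\<forall>i>m. k < w i" by (auto simp: cut_at_def)
  have "n \<le> m"
  proof (rule ccontr)
    assume "\<not> n \<le> m"
    then have "w m < k" using assms by auto
    then show False using m by simp
  qed
  then show "cut_at c k (path_shift n w)"
    unfolding cut_at_def using m by (intro exI[of _ "m - n"]) auto
next
  assume "cut_at c k (path_shift n w)"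
  then obtain m where m: "\<forall>i<m. w (n + i) < k" "w (n + m) = k + c" "\<forall>i>m. k < w (n + i)"
    by (auto simp: cut_at_def)
  have "w i < k" if "i < n + m" for i
  proof (cases "i < n")
    case False
    then show ?thesis using that spec[OF m(1), of "i - n"] by auto
  qed (use assms in auto)
  moreover have "k < w i" if "i > n + m" for i
    using that spec[OF m(3), of "i - n"] by auto
  ultimately show "cut_at c k w"
    unfolding cut_at_def using m by blast
qed

lemma finite_Collect_iff_above:
  assumes "\<And>k. k > b \<Longrightarrow> P k \<longleftrightarrow> Q k"
  shows "finite {k::nat. P k} \<longleftrightarrow> finite {k. Q k}"
proof -
  have "{k. P k} \<subseteq> {k. Q k} \<union> {..b}" "{k. Q k} \<subseteq> {k. P k} \<union> {..b}"
    using assms not_le_imp_less by blast+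
  then show ?thesis by (meson finite_UnI finite_atMost finite_subset)
qed

text \<open>Only finitely many levels are at or below the maximum of the first steps, and all higher
  levels are unaffected by the shift.\<close>

lemma infinite_cut_shift: "infinite {k. cut_at c k w} \<longleftrightarrow> infinite {k. cut_at c k (path_shift n w)}"
proof -
  define b where "b = Max (w ` {..n})"
  have "finite {k. cut_at c k w} \<longleftrightarrow> finite {k. cut_at c k (path_shift n w)}"
  proof (rule finite_Collect_iff_above[of b], rule cut_at_shift, safe)
    fix k i assume "b < k" "i < n"
    then have "w i \<le> b" unfolding b_def by (intro Max_ge) auto
    then show "w i < k" using \<open>b < k\<close> by simp
  qed
  then show ?thesis by simp
qed

lemma measurable_infinite_cut [measurable]: "path_pred (\<lambda>w. infinite {k. cut_at c k w})"
proof -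
  have "(\<lambda>w. infinite {k. cut_at c k w}) = (\<lambda>w. \<forall>m. \<exists>k. k > m \<and> cut_at c k w)"
    by (auto simp: infinite_nat_iff_unbounded)
  then show ?thesis by simp
qed

text \<open>The event \<open>I\<close> of infinitely many cutpoints is shift invariant, so after
  every history it still has probability at least \<open>\<beta>\<close>; uniformity in the start
  \<open>y\<close> is essential here. If \<open>R\<close> approximates the complement of
  \<open>I\<close> up to \<open>\<epsilon>\<close>, then \<open>R \<and> I\<close> lies in the error
  set, so \<open>R\<close> has probability at most \<open>\<epsilon> / \<beta>\<close> and the
  complement at most \<open>\<epsilon> / \<beta> + \<epsilon>\<close>.\<close>

lemma AE_infinite_cut:
  assumes \<beta>: "\<beta> > 0" and ge: "\<And>y. \<beta> \<le> measure (path_law K y) {w. infinite {k. cut_at c k w}}"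
  shows "AE w in path_law K x. infinite {k. cut_at c k w}"
proof -
  let ?Q = "path_law K x"
  interpret prob_space ?Q by (rule prob_space_path_law)
  let ?I = "\<lambda>w. infinite {k. cut_at c k w}"
  have I: "{w. ?I w} \<in> sets path_space" by (rule sets_path) measurable
  have ad: "\<beta> * prob {w. R w} \<le> prob {w. R w \<and> ?I w}" if R: "adapted n R" for n R
  proof -
    note [measurable] = adapted_measurable[OF R]
    have split: "emeasure ?Q {w. R w \<and> S w} = (\<Sum>y. emeasure ?Q {w. (R w \<and> w n = y) \<and> S w})"
      if [measurable]: "path_pred S" for S
    proof -
      have "{w. R w \<and> S w} = (\<Union>y. {w. (R w \<and> w n = y) \<and> S w})" by auto
      moreover have "range (\<lambda>y. {w. (R w \<and> w n = y) \<and> S w}) \<subseteq> sets ?Q"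
        by (auto intro!: sets_path)
      moreover have "disjoint_family (\<lambda>y. {w. (R w \<and> w n = y) \<and> S w})"
        by (auto simp: disjoint_family_on_def)
      ultimately show ?thesis
        using suminf_emeasure[of "\<lambda>y. {w. (R w \<and> w n = y) \<and> S w}" ?Q] by simp
    qed
    have "ennreal \<beta> * emeasure ?Q {w. R w \<and> True} =
        (\<Sum>y. ennreal \<beta> * emeasure ?Q {w. (R w \<and> w n = y) \<and> True})"
      by (subst split) auto
    also have "\<dots> \<le> (\<Sum>y. emeasure ?Q {w. (R w \<and> w n = y) \<and> ?I w})"
    proof (rule suminf_le)
      fix y
      have ad': "adapted n (\<lambda>w. R w \<and> w n = y)" using R unfolding adapted_def by (metis order_refl)
      have "emeasure ?Q {w. (R w \<and> w n = y) \<and> ?I w} =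
          emeasure ?Q {w. (R w \<and> w n = y) \<and> ?I (path_shift n w)}"
        by (subst infinite_cut_shift[of c _ n]) simp
      also have "\<dots> = emeasure ?Q {w. R w \<and> w n = y} * emeasure (path_law K y) {w. ?I w}"
        by (rule markov_property_emeasure[OF ad']) auto
      finally have eq: "emeasure ?Q {w. (R w \<and> w n = y) \<and> ?I w} =
          emeasure ?Q {w. R w \<and> w n = y} * emeasure (path_law K y) {w. ?I w}" .
      interpret Y: prob_space "path_law K y" by (rule prob_space_path_law)
      have "ennreal \<beta> \<le> emeasure (path_law K y) {w. ?I w}"
        using ge[of y] by (simp add: Y.emeasure_eq_measure)
      then show "ennreal \<beta> * emeasure ?Q {w. (R w \<and> w n = y) \<and> True} \<le>
          emeasure ?Q {w. (R w \<and> w n = y) \<and> ?I w}"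
        unfolding eq by (subst mult.commute) (simp add: mult_left_mono)
    qed auto
    also have "\<dots> = emeasure ?Q {w. R w \<and> ?I w}"
      by (rule split[symmetric]) simp
    finally have "ennreal (\<beta> * prob {w. R w}) \<le> ennreal (prob {w. R w \<and> ?I w})"
      using \<beta> by (simp add: emeasure_eq_measure ennreal_mult)
    then show ?thesis by (simp add: ennreal_le_iff)
  qed
  have small: "prob (- {w. ?I w}) \<le> (1 + 1 / \<beta>) * \<epsilon>" if "\<epsilon> > 0" for \<epsilon>
  proof -
    let ?E = "- {w. ?I w}"
    have E: "?E \<in> sets path_space" using sets.compl_sets[OF I] by (simp add: Compl_eq_Diff_UNIV)
    obtain n R where R: "adapted n R" "prob ((?E - {w. R w}) \<union> ({w. R w} - ?E)) < \<epsilon>"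
      using approx_by_adapted[OF sets_path_law finite_measure_axioms E \<open>\<epsilon> > 0\<close>] by blast
    have RS: "{w. R w} \<in> sets path_space" by (rule sets_path adapted_measurable R)+
    have "\<beta> * prob {w. R w} \<le> prob {w. R w \<and> ?I w}" by (rule ad[OF R(1)])
    also have "\<dots> \<le> prob ((?E - {w. R w}) \<union> ({w. R w} - ?E))"
      using E RS by (intro finite_measure_mono) auto
    finally have 1: "prob {w. R w} \<le> \<epsilon> / \<beta>" using R(2) \<beta> by (simp add: field_simps)
    have "prob ?E \<le> prob ({w. R w} \<union> ((?E - {w. R w}) \<union> ({w. R w} - ?E)))"
      using E RS by (intro finite_measure_mono) auto
    also have "\<dots> \<le> prob {w. R w} + prob ((?E - {w. R w}) \<union> ({w. R w} - ?E))"
      using E RS by (intro measure_Un_le) auto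
    also have "\<dots> \<le> \<epsilon> / \<beta> + \<epsilon>" using 1 R(2) by simp
    finally show ?thesis by (simp add: algebra_simps)
  qed
  have "prob (- {w. ?I w}) \<le> 0"
  proof (rule field_le_epsilon)
    fix e :: real assume "e > 0"
    have "1 + 1 / \<beta> > 0" using \<beta> by (simp add: add_pos_pos)
    then show "prob (- {w. ?I w}) \<le> 0 + e"
      using small[of "e / (1 + 1 / \<beta>)"] \<open>e > 0\<close> by simp
  qed
  then have "prob {w \<in> space ?Q. \<not> ?I w} = 0"
    using measure_nonneg[of ?Q] by (simp add: Collect_neg_eq order_antisym)
  then show ?thesis by (subst (asm) prob_Collect_eq_0) (auto intro!: sets_path)
qed

section \<open>Factorisation of cutpoint probabilities\<close>

definition enters :: "nat \<Rightarrow> nat \<Rightarrow> nat \<Rightarrow> (nat \<Rightarrow> nat) \<Rightarrow> bool" where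
  "enters c k n w \<longleftrightarrow> (\<forall>i<n. w i < k) \<and> w n = k + c"

text \<open>Time 0 is left out because the (2,1) walk is started at \<open>k\<close> itself when its
  escape is measured.\<close>

definition above :: "nat \<Rightarrow> (nat \<Rightarrow> nat) \<Rightarrow> bool" where
  "above k w \<longleftrightarrow> (\<forall>m>0. k < w m)"

definition last_cut :: "nat \<Rightarrow> nat \<Rightarrow> nat \<Rightarrow> (nat \<Rightarrow> nat) \<Rightarrow> bool" where
  "last_cut c k N w \<longleftrightarrow> (\<forall>i\<in>{k<..N}. \<not> cut_at c i w)"

text \<open>The stretch of path between two cutpoints \<open>j < k\<close>, with time counted from
  the entry at \<open>j + c\<close>. As in \<open>above\<close>, the lower barrier applies only
  after time 0.\<close>

definition links :: "nat \<Rightarrow> nat \<Rightarrow> nat \<Rightarrow> (nat \<Rightarrow> nat) \<Rightarrow> bool" where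
  "links c j k w \<longleftrightarrow> (\<exists>n>0. (\<forall>i<n. w i < k) \<and> w n = k + c \<and> (\<forall>i. 0 < i \<and> i < n \<longrightarrow> j < w i))"

definition entry_prob :: "(nat \<Rightarrow> nat pmf) \<Rightarrow> nat \<Rightarrow> nat \<Rightarrow> nat \<Rightarrow> real" where
  "entry_prob K c x k = measure (path_law K x) {w. \<exists>n. enters c k n w}"

definition link_prob :: "(nat \<Rightarrow> nat pmf) \<Rightarrow> nat \<Rightarrow> nat \<Rightarrow> nat \<Rightarrow> real" where
  "link_prob K c j k = measure (path_law K (j + c)) {w. links c j k w}"

definition escape_prob :: "(nat \<Rightarrow> nat pmf) \<Rightarrow> nat \<Rightarrow> nat \<Rightarrow> real" where
  "escape_prob K c k = measure (path_law K (k + c)) {w. above k w}"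

lemma measurable_above [measurable]: "path_pred (above k)"
  unfolding above_def by measurable

lemma measurable_last_cut [measurable]: "path_pred (last_cut c k N)"
  unfolding last_cut_def by measurable

lemma measurable_links [measurable]: "path_pred (links c j k)"
  unfolding links_def by measurable

lemma adapted_enters: "adapted n (enters c k n)"
  unfolding adapted_def enters_def by auto

lemma enters_apply: "enters c k n w \<Longrightarrow> w n = k + c"
  unfolding enters_def by simp

lemma enters_unique: "enters c k n w \<Longrightarrow> enters c k m w \<Longrightarrow> n = m"
  unfolding enters_def by (metis linorder_neqE_nat not_add_less1)

lemma strong_markov_enters:
  assumes "path_pred B"
  shows "measure (path_law K x) {w. \<exists>n. enters c k n w \<and> B (path_shift n w)} =
    entry_prob K c x k * measure (path_law K (k + c)) {w. B w}"
  unfolding entry_prob_def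
proof (rule strong_markov)
  show "adapted n (enters c k n)" for n by (rule adapted_enters)
  show "w n = k + c" if "enters c k n w" for n w using that by (rule enters_apply)
  show "n = m" if "enters c k n w" "enters c k m w" for n m w using that by (rule enters_unique)
qed fact

lemma cut_at_iff: "cut_at c k w \<longleftrightarrow> (\<exists>n. enters c k n w \<and> above k (path_shift n w))"
proof -
  have "(\<forall>m>n. k < w m) \<longleftrightarrow> (\<forall>m>0. k < w (n + m))" for n
  proof safe
    fix m assume *: "\<forall>m>0. k < w (n + m)" and "n < m"
    then show "k < w m" using spec[OF *, of "m - n"] by simp
  qed simp
  then show ?thesis unfolding cut_at_def enters_def above_def by auto
qed

text \<open>Before the entry the walk is below \<open>k\<close>, so whether a level above
  \<open>k\<close> is a cutpoint is decided by the shifted path alone.\<close>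

lemma last_cut_shift: "enters c k n w \<Longrightarrow> last_cut c k N w \<longleftrightarrow> last_cut c k N (path_shift n w)"
  unfolding last_cut_def enters_def
  by (intro ball_cong refl arg_cong[where f = Not] cut_at_shift) auto

lemma prob_cut_no_later:
  "measure (path_law K x) {w. cut_at c k w \<and> last_cut c k N w} =
    entry_prob K c x k * measure (path_law K (k + c)) {w. above k w \<and> last_cut c k N w}"
proof -
  have "{w. cut_at c k w \<and> last_cut c k N w} =
    {w. \<exists>n. enters c k n w \<and> (above k (path_shift n w) \<and> last_cut c k N (path_shift n w))}"
    unfolding cut_at_iff using last_cut_shift by blast
  then show ?thesis
    by (simp only:)
       (rule strong_markov_enters[where B = "\<lambda>w. above k w \<and> last_cut c k N w"], measurable)
qed

text \<open>Staying above \<open>j\<close> needs to be checked only between the two entries, because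
  from the entry at level \<open>k\<close> on the walk is at least \<open>k\<close>. The condition
  on \<open>j\<close> thus belongs entirely to the past of that entry.\<close>

lemma cut_cut_iff:
  assumes "j < k"
  shows "cut_at c j w \<and> cut_at c k w \<longleftrightarrow>
    (\<exists>n. (enters c k n w \<and> (\<exists>m<n. enters c j m w \<and> (\<forall>i. m < i \<and> i < n \<longrightarrow> j < w i))) \<and>
      above k (path_shift n w))" (is "?L \<longleftrightarrow> ?R")
proof
  assume ?L
  then obtain m n where m: "enters c j m w" "\<forall>i>m. j < w i"
    and n: "enters c k n w" "above k (path_shift n w)"
    unfolding cut_at_iff[of c k] unfolding cut_at_def enters_def by blast
  have "m < n"
  proof (rule ccontr)
    assume "\<not> m < n"
    then have "n = m \<or> n < m" by auto
    then show False using m n assms by (auto simp: enters_def)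
  qed
  then show ?R using m n by blast
next
  assume ?R
  then obtain m n where n: "enters c k n w" "above k (path_shift n w)"
    and m: "m < n" "enters c j m w" "\<forall>i. m < i \<and> i < n \<longrightarrow> j < w i" by blast
  have "j < w i" if "i > m" for i
  proof (cases "i \<le> n")
    case True
    then show ?thesis using m n that assms by (cases "i = n") (auto simp: enters_def)
  next
    case False
    then have "k < w (n + (i - n))" using n(2) unfolding above_def path_shift_apply by (metis diff_is_0_eq not_gr_zero)
    then show ?thesis using False assms by simp
  qed
  then have "cut_at c j w" using m unfolding cut_at_def enters_def by blast
  then show ?L using n unfolding cut_at_iff by blast
qed

lemma prob_enters_linked:
  assumes "j < k"
  shows "measure (path_law K x)
      {w. \<exists>n. enters c k n w \<and> (\<exists>m<n. enters c j m w \<and> (\<forall>i. m < i \<and> i < n \<longrightarrow> j < w i))} =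
    entry_prob K c x j * link_prob K c j k"
proof -
  have "(\<exists>n. enters c k n w \<and> (\<exists>m<n. enters c j m w \<and> (\<forall>i. m < i \<and> i < n \<longrightarrow> j < w i))) \<longleftrightarrow>
      (\<exists>m. enters c j m w \<and> links c j k (path_shift m w))" for w
  proof safe
    fix n m assume n: "enters c k n w" and m: "m < n" "enters c j m w" "\<forall>i. m < i \<and> i < n \<longrightarrow> j < w i"
    then have "links c j k (path_shift m w)"
      unfolding links_def enters_def by (intro exI[of _ "n - m"]) auto
    with m show "\<exists>m. enters c j m w \<and> links c j k (path_shift m w)" by blast
  next
    fix m assume m: "enters c j m w" and "links c j k (path_shift m w)"
    then obtain n where n: "n > 0" "\<forall>i<n. w (m + i) < k" "w (m + n) = k + c" "\<forall>i. 0 < i \<and> i < n \<longrightarrow> j < w (m + i)"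
      unfolding links_def by auto
    have "w i < k" if "i < m + n" for i
    proof (cases "i < m")
      case True
      then have "w i < j" using m by (simp add: enters_def)
      then show ?thesis using assms by simp
    next
      case False
      then have "w (m + (i - m)) < k" using spec[OF n(2), of "i - m"] that by linarith
      then show ?thesis using False by simp
    qed
    moreover have "j < w i" if "m < i \<and> i < m + n" for i
    proof -
      have "j < w (m + (i - m))" using spec[OF n(4), of "i - m"] that by linarith
      then show ?thesis using that by simp
    qed
    ultimately show "\<exists>n. enters c k n w \<and> (\<exists>m<n. enters c j m w \<and> (\<forall>i. m < i \<and> i < n \<longrightarrow> j < w i))"
      using m n(1,3) by (intro exI[of _ "m + n"] conjI exI[of _ m]) (auto simp: enters_def)
  qed
  then show ?thesis unfolding link_prob_def
    by (simp only:) (rule strong_markov_enters[where B = "links c j k"], measurable)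
qed

text \<open>The strong Markov property is used twice: at the entry into \<open>{k..}\<close>, with
  the condition on \<open>j\<close> as part of the past, and then at the entry into
  \<open>{j..}\<close>, which turns that past into an entry and a link.\<close>

lemma prob_cut_cut_no_later:
  assumes "j < k"
  shows "measure (path_law K x) {w. cut_at c j w \<and> cut_at c k w \<and> last_cut c k N w} =
    entry_prob K c x j * link_prob K c j k *
      measure (path_law K (k + c)) {w. above k w \<and> last_cut c k N w}"
proof -
  let ?R = "\<lambda>n w. enters c k n w \<and> (\<exists>m<n. enters c j m w \<and> (\<forall>i. m < i \<and> i < n \<longrightarrow> j < w i))"
  have "{w. cut_at c j w \<and> cut_at c k w \<and> last_cut c k N w} =
    {w. \<exists>n. ?R n w \<and> (above k (path_shift n w) \<and> last_cut c k N (path_shift n w))}"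
  proof (rule Collect_cong)
    fix w
    have *: "(A1 \<and> A2 \<and> B) = (\<exists>n. R n \<and> (S n \<and> B' n))"
      if "(A1 \<and> A2) = (\<exists>n. R n \<and> S n)" "\<And>n. R n \<Longrightarrow> B = B' n" for A1 A2 B and R S B' :: "nat \<Rightarrow> bool"
      using that by blast
    show "(cut_at c j w \<and> cut_at c k w \<and> last_cut c k N w) =
      (\<exists>n. ?R n w \<and> (above k (path_shift n w) \<and> last_cut c k N (path_shift n w)))"
      by (rule *[OF cut_cut_iff[OF assms, of c w]]) (rule last_cut_shift, erule conjunct1)
  qed
  moreover have "adapted n (?R n)" for n
  proof -
    have *: "adapted n (\<lambda>w. A w \<and> (\<exists>m<n. B m w \<and> C m w))"
      if "adapted n A" "\<And>m. m < n \<Longrightarrow> adapted n (B m)" "\<And>m. adapted n (C m)" for A B C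
      using that unfolding adapted_def by blast
    show ?thesis
    proof (rule *)
      show "adapted n (enters c k n)" by (rule adapted_enters)
      show "adapted n (enters c j m)" if "m < n" for m
        using that by (intro adapted_mono[OF adapted_enters]) simp
      show "adapted n (\<lambda>w. \<forall>i. m < i \<and> i < n \<longrightarrow> j < w i)" for m
        unfolding adapted_def by auto
    qed
  qed
  then have "measure (path_law K x)
      {w. \<exists>n. ?R n w \<and> (above k (path_shift n w) \<and> last_cut c k N (path_shift n w))} =
    measure (path_law K x) {w. \<exists>n. ?R n w} *
      measure (path_law K (k + c)) {w. above k w \<and> last_cut c k N w}"
  proof (rule strong_markov[where B = "\<lambda>w. above k w \<and> last_cut c k N w"])
    show "w n = k + c" if "?R n w" for n w using that enters_apply by blast
    show "n = m" if "?R n w" "?R m w" for n m w using that enters_unique by blast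
  qed measurable
  ultimately show ?thesis using prob_enters_linked[OF assms] by simp
qed

lemma last_cut_self [simp]: "last_cut c k k w"
  by (simp add: last_cut_def)

lemma prob_cut: "measure (path_law K x) {w. cut_at c k w} = entry_prob K c x k * escape_prob K c k"
  using prob_cut_no_later[of K x c k k] by (simp add: escape_prob_def)

lemma prob_cut_cut:
  "j < k \<Longrightarrow> measure (path_law K x) {w. cut_at c j w \<and> cut_at c k w} =
    entry_prob K c x j * link_prob K c j k * escape_prob K c k"
  using prob_cut_cut_no_later[of j k K x c k] by (simp add: escape_prob_def)

section \<open>Maximum principle and exit problems\<close>

locale climbing_walk =
  fixes K :: "nat \<Rightarrow> nat pmf" and ht :: "nat \<Rightarrow> nat"
  assumes supp: "\<And>x. set_pmf (K x) \<subseteq> {..x + 2}"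
    and climb: "\<And>x. \<exists>y\<in>set_pmf (K x). ht x < ht y"
begin

abbreviation Pr :: "nat \<Rightarrow> ((nat \<Rightarrow> nat) \<Rightarrow> bool) \<Rightarrow> real" where
  "Pr x R \<equiv> measure (path_law K x) {w. R w}"

abbreviation hit :: "nat \<Rightarrow> nat \<Rightarrow> real" where
  "hit j k \<equiv> Pr (j + 1) (reaches (j + 1) k {k..})"

lemma sum_pmf_step: "(\<Sum>y\<le>x + 2. pmf (K x) y) = 1"
  by (rule sum_pmf_eq_1) (use supp[of x] in auto)

text \<open>Among the points where a positive maximum is attained, take one of largest height
  \<open>ht\<close>. All its possible successors attain the maximum as well, and by
  \<open>climb\<close> one of them is higher; it cannot lie beyond \<open>N\<close>, where
  \<open>g\<close> is not positive.\<close>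

lemma maximum_principle:
  fixes g :: "nat \<Rightarrow> real"
  assumes sub: "\<And>x. x \<le> N \<Longrightarrow> g x > 0 \<Longrightarrow> g x \<le> (\<Sum>y\<le>x + 2. pmf (K x) y * g y)"
    and out: "\<And>x. x > N \<Longrightarrow> g x \<le> 0"
  shows "g x \<le> 0"
proof (rule ccontr)
  assume gx: "\<not> g x \<le> 0"
  define m where "m = Max (g ` {..N})"
  have xN: "x \<le> N" using gx out[of x] by (meson not_le)
  have gm: "g y \<le> m" if "y \<le> N" for y unfolding m_def using that by (intro Max_ge) auto
  have mpos: "m > 0" using gm[OF xN] gx by simp
  have gm': "g y \<le> m" for y using gm[of y] out[of y] mpos by (cases "y \<le> N") auto
  define S where "S = {y. y \<le> N \<and> g y = m}"
  have "m \<in> g ` {..N}" unfolding m_def by (rule Max_in) auto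
  then have S: "finite S" "S \<noteq> {}" unfolding S_def by (auto intro: finite_subset[of _ "{..N}"])
  have "Max (ht ` S) \<in> ht ` S" using S by (intro Max_in) auto
  then obtain z where z: "z \<in> S" "ht z = Max (ht ` S)" by auto
  have zmax: "ht y \<le> ht z" if "y \<in> S" for y unfolding z(2) using S that by (intro Max_ge) auto
  obtain y where y: "y \<in> set_pmf (K z)" "ht z < ht y" using climb by blast
  have "(\<Sum>y\<le>z + 2. pmf (K z) y * (m - g y)) = m - (\<Sum>y\<le>z + 2. pmf (K z) y * g y)"
    using sum_pmf_step[of z] by (simp add: right_diff_distrib sum_subtractf sum_distrib_right[symmetric])
  also have "\<dots> \<le> 0" using sub[of z] z mpos by (auto simp: S_def)
  finally have "(\<Sum>y\<le>z + 2. pmf (K z) y * (m - g y)) \<le> 0" .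
  moreover have "(\<Sum>y\<le>z + 2. pmf (K z) y * (m - g y)) \<ge> 0"
    using gm' by (intro sum_nonneg mult_nonneg_nonneg) auto
  ultimately have "(\<Sum>y\<le>z + 2. pmf (K z) y * (m - g y)) = 0" by simp
  then have "\<forall>y\<in>{..z + 2}. pmf (K z) y * (m - g y) = 0"
    using gm' by (subst (asm) sum_nonneg_eq_0_iff) auto
  then have "pmf (K z) y * (m - g y) = 0" using y supp[of z] by blast
  moreover have "pmf (K z) y \<noteq> 0" using y by (simp add: set_pmf_iff)
  ultimately have "g y = m" by simp
  then have "y \<in> S" unfolding S_def using out[of y] mpos by (auto simp: not_less[symmetric])
  then show False using zmax[of y] y by simp
qed

lemma prob_shift_eq_sum:
  assumes [measurable]: "path_pred B"
  shows "Pr x (\<lambda>w. B (path_shift 1 w)) = (\<Sum>y\<le>x + 2. pmf (K x) y * Pr y B)"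
proof -
  interpret prob_space "path_law K x" by (rule prob_space_path_law)
  have "AE w in path_law K x. w 1 \<le> x + 2"
    using AE_path_start[of x K] AE_path_steps[of K x]
  proof eventually_elim
    case (elim w)
    then have "w (Suc 0) \<in> set_pmf (K x)" by (metis)
    then show ?case using supp[of x] by auto
  qed
  then have "Pr x (\<lambda>w. B (path_shift 1 w)) = Pr x (\<lambda>w. \<exists>y\<le>x + 2. w 1 = y \<and> B (path_shift 1 w))"
    by (intro prob_cong_AE) (auto elim: eventually_mono simp del: path_shift_apply)
  also have "{w. \<exists>y\<le>x + 2. w 1 = y \<and> B (path_shift 1 w)} = (\<Union>y\<in>{..x + 2}. {w. w 1 = y \<and> B (path_shift 1 w)})"
    by blast
  also have "prob \<dots> = (\<Sum>y\<le>x + 2. Pr x (\<lambda>w. w 1 = y \<and> B (path_shift 1 w)))"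
    by (rule finite_measure_finite_Union)
       (auto simp: disjoint_family_on_def simp del: path_shift_apply intro!: sets_path)
  also have "\<dots> = (\<Sum>y\<le>x + 2. pmf (K x) y * Pr y B)"
    by (intro sum.cong refl prob_first_step) simp
  finally show ?thesis .
qed

text \<open>The probability of never exceeding \<open>N\<close>, as a function of the starting
  point, is subharmonic and vanishes beyond \<open>N\<close>, so the maximum principle makes it
  zero.\<close>

lemma AE_unbounded: "AE w in path_law K x. \<forall>N. \<exists>n. N < w n"
  unfolding AE_all_countable
proof
  fix N
  define g where "g x = Pr x (\<lambda>w. \<forall>n. w n \<le> N)" for x
  have "g x \<le> 0"
  proof (rule maximum_principle)
    fix x
    have "g x \<le> Pr x (\<lambda>w. (\<lambda>w. \<forall>n. w n \<le> N) (path_shift 1 w))"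
      unfolding g_def by (rule prob_mono_AE) auto
    also have "\<dots> = (\<Sum>y\<le>x + 2. pmf (K x) y * g y)"
      unfolding g_def by (rule prob_shift_eq_sum) simp
    finally show "g x \<le> (\<Sum>y\<le>x + 2. pmf (K x) y * g y)" .
  next
    fix x assume "N < x"
    have "g x \<le> Pr x (\<lambda>w. False)"
      unfolding g_def
      by (rule prob_mono_AE) (use AE_path_start[of x K] \<open>N < x\<close> in \<open>auto elim!: eventually_mono simp: not_le\<close>)
    then show "g x \<le> 0" by simp
  qed
  then have "g x = 0" by (simp add: g_def measure_le_0_iff)
  moreover interpret prob_space "path_law K x" by (rule prob_space_path_law)
  have "{w \<in> space (path_law K x). \<forall>n. w n \<le> N} = {w. \<forall>n. w n \<le> N}" by simp
  ultimately have "prob {w \<in> space (path_law K x). \<forall>n. w n \<le> N} = 0" by (simp add: g_def)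
  then have "AE w in path_law K x. \<not> (\<forall>n. w n \<le> N)"
    by (subst (asm) prob_Collect_eq_0) (auto intro!: sets_path)
  then show "AE w in path_law K x. \<exists>n. N < w n" by (simp add: not_le)
qed

text \<open>The exit probability and \<open>\<phi>\<close> solve the same boundary value problem;
  the maximum principle applied to both differences gives uniqueness. An explicit harmonic function
  therefore identifies the probability.\<close>

lemma prob_reaches_eq_harmonic:
  fixes \<phi> :: "nat \<Rightarrow> real"
  assumes "lo \<le> k"
    and harm: "\<And>x. lo \<le> x \<Longrightarrow> x < k \<Longrightarrow> \<phi> x = (\<Sum>y\<le>x + 2. pmf (K x) y * \<phi> y)"
    and low: "\<And>x. x < lo \<Longrightarrow> \<phi> x = 0" and high: "\<And>x. k \<le> x \<Longrightarrow> \<phi> x = 1"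
  shows "Pr x (reaches lo k {k..}) = \<phi> x"
proof -
  define h where "h x = Pr x (reaches lo k {k..})" for x
  have hharm: "h x = (\<Sum>y\<le>x + 2. pmf (K x) y * h y)" if "lo \<le> x" "x < k" for x
  proof -
    have "h x = Pr x (\<lambda>w. reaches lo k {k..} (path_shift 1 w))"
      unfolding h_def
    proof (rule prob_cong_AE)
      show "AE w in path_law K x. reaches lo k {k..} w \<longleftrightarrow> reaches lo k {k..} (path_shift 1 w)"
        using AE_path_start[of x K] by eventually_elim (rule reaches_shift, use that in auto)
    qed auto
    then show ?thesis unfolding h_def using prob_shift_eq_sum[of "reaches lo k {k..}" x] by simp
  qed
  have hlow: "h x = 0" if "x < lo" for x
  proof -
    have "h x = Pr x (\<lambda>w. False)"
      unfolding h_def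
    proof (rule prob_cong_AE)
      show "AE w in path_law K x. reaches lo k {k..} w \<longleftrightarrow> False"
        using AE_path_start[of x K]
      proof eventually_elim
        case (elim w)
        show ?case
        proof
          assume "reaches lo k {k..} w"
          then obtain n where n: "\<forall>i<n. lo \<le> w i \<and> w i < k" "w n \<ge> k" by (auto simp: reaches_def)
          then show False using elim that \<open>lo \<le> k\<close> by (cases n) auto
        qed simp
      qed
    qed auto
    then show ?thesis by simp
  qed
  have hhigh: "h x = 1" if "k \<le> x" for x
  proof -
    have "h x = Pr x (\<lambda>w. True)"
      unfolding h_def
      by (rule prob_cong_AE) (use AE_path_start[of x K] that in \<open>auto elim!: eventually_mono simp: reaches_def intro!: exI[of _ 0]\<close>)
    then show ?thesis by (simp add: measure_path_law_UNIV)
  qed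
  have le: "f x \<le> g x"
    if f: "\<And>x. lo \<le> x \<Longrightarrow> x < k \<Longrightarrow> f x = (\<Sum>y\<le>x + 2. pmf (K x) y * f y)"
      and g: "\<And>x. lo \<le> x \<Longrightarrow> x < k \<Longrightarrow> g x = (\<Sum>y\<le>x + 2. pmf (K x) y * g y)"
      and eq: "\<And>x. x < lo \<or> k \<le> x \<Longrightarrow> f x = g x" for f g :: "nat \<Rightarrow> real"
  proof -
    have "f x - g x \<le> 0"
    proof (rule maximum_principle[of k])
      fix x assume "x \<le> k" "f x - g x > 0"
      then have "lo \<le> x" "x < k" using eq[of x] by force+
      then have "f x - g x = (\<Sum>y\<le>x + 2. pmf (K x) y * f y) - (\<Sum>y\<le>x + 2. pmf (K x) y * g y)"
        using f[of x] g[of x] by simp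
      then show "f x - g x \<le> (\<Sum>y\<le>x + 2. pmf (K x) y * (f y - g y))"
        by (simp add: right_diff_distrib sum_subtractf)
    qed (simp add: eq)
    then show ?thesis by simp
  qed
  have "h x = \<phi> x" if "x < lo \<or> k \<le> x" for x
    using that hlow[of x] low[of x] hhigh[of x] high[of x] by auto
  then have "h x = \<phi> x"
    using le[of h \<phi>] le[of \<phi> h] hharm harm by (simp add: order_antisym)
  then show ?thesis by (simp add: h_def)
qed

lemma reaches_if_unbounded:
  assumes "\<forall>m. lo \<le> w m" "\<exists>n. k < w n"
  shows "reaches lo k {k..} w"
proof -
  obtain m where "k \<le> w m" using assms(2) less_imp_le by blast
  then obtain n where "k \<le> w n" "\<And>i. i < n \<Longrightarrow> w i < k" using first_passage[of _ w] by blast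
  then show ?thesis unfolding reaches_def using assms by auto
qed

lemma prob_stay_le_reaches: "Pr x (\<lambda>w. \<forall>m. lo \<le> w m) \<le> Pr x (reaches lo k {k..})"
proof (rule prob_mono_AE)
  show "AE w in path_law K x. (\<forall>m. lo \<le> w m) \<longrightarrow> reaches lo k {k..} w"
    using AE_unbounded[of x]
  proof eventually_elim
    case (elim w)
    then show ?case using reaches_if_unbounded[of lo w k] by blast
  qed
qed simp

text \<open>The exit events decrease as the upper level grows. A path in all of them needs more than
  \<open>m\<close> steps to exceed its maximum over the first \<open>m\<close> steps, and until then
  it stays at or above \<open>lo\<close>.\<close>

lemma prob_stay_ge:
  assumes "lo \<le> a" and ge: "\<And>k. a < k \<Longrightarrow> \<beta> \<le> Pr x (reaches lo k {k..})"
  shows "\<beta> \<le> Pr x (\<lambda>w. \<forall>m. lo \<le> w m)"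
proof -
  interpret prob_space "path_law K x" by (rule prob_space_path_law)
  define R where "R n = {w. reaches lo (a + Suc n) {a + Suc n..} w}" for n
  have "R n \<in> events" for n unfolding R_def by (simp add: sets_path)
  moreover have "decseq R"
    unfolding decseq_Suc_iff
  proof (intro allI subsetI)
    fix n w assume "w \<in> R (Suc n)"
    then obtain m where m: "\<forall>i<m. lo \<le> w i" "w m \<ge> a + Suc (Suc n)"
      by (auto simp: R_def reaches_def)
    have "a + Suc n \<le> w m" using m by simp
    then obtain l where "l \<le> m" "a + Suc n \<le> w l" "\<And>i. i < l \<Longrightarrow> w i < a + Suc n"
      using first_passage[of _ w] by blast
    then have "(\<forall>i<l. lo \<le> w i \<and> w i < a + Suc n) \<and> w l \<in> {a + Suc n..}"
      using m by auto
    then show "w \<in> R n" unfolding R_def reaches_def by blast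
  qed
  ultimately have "(\<lambda>n. prob (R n)) \<longlonglongrightarrow> prob (\<Inter>n. R n)"
    by (intro finite_Lim_measure_decseq) auto
  moreover have "\<beta> \<le> prob (R n)" for n unfolding R_def by (rule ge) simp
  ultimately have "\<beta> \<le> prob (\<Inter>n. R n)" by (intro LIMSEQ_le_const) auto
  also have "(\<Inter>n. R n) = {w. \<forall>n. reaches lo (a + Suc n) {a + Suc n..} w}"
    unfolding R_def by auto
  also have "prob \<dots> \<le> Pr x (\<lambda>w. \<forall>m. lo \<le> w m)"
  proof (rule prob_mono_AE)
    have "\<forall>m. lo \<le> w m" if w: "\<forall>n. reaches lo (a + Suc n) {a + Suc n..} w" for w
    proof
      fix m
      define b where "b = Max (w ` {..m})"
      obtain n where n: "\<forall>i<n. lo \<le> w i" "w n \<ge> a + Suc b"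
        using spec[OF w, of b] unfolding reaches_def atLeast_iff by blast
      have "m < n"
      proof (rule ccontr)
        assume "\<not> m < n"
        then have "w n \<le> b" unfolding b_def by (intro Max_ge) auto
        then show False using n by simp
      qed
      then show "lo \<le> w m" using n by simp
    qed
    then show "AE w in path_law K x. (\<forall>n. reaches lo (a + Suc n) {a + Suc n..} w) \<longrightarrow> (\<forall>m. lo \<le> w m)"
      by simp
  qed simp
  finally show ?thesis .
qed

end

section \<open>From probability estimates to cutpoints\<close>

text \<open>For \<open>i = j\<close> the product is empty, so the sum begins with the leading 1 of
  \<open>total_D r j\<close> and has \<open>k - j\<close> terms.\<close>

definition partial_D :: "(nat \<Rightarrow> real) \<Rightarrow> nat \<Rightarrow> nat \<Rightarrow> real" where
  "partial_D r j k = (\<Sum>i\<in>{j..<k}. \<Prod>l\<in>{j + 1..i}. r l)"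

definition total_D :: "(nat \<Rightarrow> real) \<Rightarrow> nat \<Rightarrow> ennreal" where
  "total_D r n = 1 + (\<Sum>m. ennreal (\<Prod>i\<in>{n + 1..n + 1 + m}. r i))"

lemma partial_D_shift:
  "partial_D r j (j + 1 + m) = 1 + (\<Sum>i<m. \<Prod>l\<in>{j + 1..j + 1 + i}. r l)"
  by (induction m) (simp_all add: partial_D_def)

lemma partial_D_Suc: "j \<le> k \<Longrightarrow> partial_D r j (Suc k) = partial_D r j k + (\<Prod>l\<in>{j + 1..k}. r l)"
  by (simp add: partial_D_def)

lemma partial_D_self [simp]: "partial_D r j j = 0"
  by (simp add: partial_D_def)

lemma partial_D_add:
  "j \<le> k \<Longrightarrow> partial_D r j (k + m) = partial_D r j k + (\<Prod>l\<in>{j + 1..k}. r l) * partial_D r k (k + m)"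
proof (induction m)
  case (Suc m)
  have "(\<Prod>l\<in>{j + 1..k + m}. r l) = (\<Prod>l\<in>{j + 1..k}. r l) * (\<Prod>l\<in>{k + 1..k + m}. r l)"
    using Suc.prems prod.ub_add_nat[of "j + 1" k r m] by simp
  with Suc show ?case by (simp add: partial_D_Suc algebra_simps)
qed simp

section \<open>Series of products with ratios at most 1\<close>

locale ratio_sequence =
  fixes r :: "nat \<Rightarrow> real" and K0 :: nat
  assumes r: "\<And>k. K0 \<le> k \<Longrightarrow> 0 < r k \<and> r k \<le> 1"
begin

text \<open>Equal to 0 where the series diverges. Up to constants this is the escape
  probability.\<close>

definition w :: "nat \<Rightarrow> real" where
  "w k = enn2real (1 / total_D r k)"

lemma prod_r: "K0 \<le> j \<Longrightarrow> 0 < (\<Prod>l\<in>{j + 1..i}. r l)" "K0 \<le> j \<Longrightarrow> (\<Prod>l\<in>{j + 1..i}. r l) \<le> 1"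
  using r by (auto intro!: prod_pos prod_le_1 simp: less_imp_le)

lemma partial_D_le: "K0 \<le> j \<Longrightarrow> j \<le> k \<Longrightarrow> partial_D r j k \<le> real (k - j)"
  unfolding partial_D_def using sum_mono[of "{j..<k}" "\<lambda>i. \<Prod>l\<in>{j + 1..i}. r l" "\<lambda>_. 1"] prod_r(2) by simp

lemma partial_D_ge_1:
  assumes "K0 \<le> j" "j < k"
  shows "1 \<le> partial_D r j k"
proof -
  obtain m where m: "k = j + 1 + m" using assms less_iff_Suc_add by auto
  have "0 \<le> (\<Sum>i<m. \<Prod>l\<in>{j + 1..j + 1 + i}. r l)"
    using prod_r(1)[OF assms(1)] by (intro sum_nonneg less_imp_le)
  then show ?thesis unfolding m partial_D_shift by simp
qed

lemma ennreal_partial_D_le: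
  assumes "K0 \<le> j" "j < k"
  shows "ennreal (partial_D r j k) \<le> total_D r j"
proof -
  obtain m where m: "k = j + 1 + m" using assms less_iff_Suc_add by auto
  have nn: "0 \<le> (\<Prod>l\<in>{j + 1..j + 1 + i}. r l)" for i using prod_r(1)[OF assms(1)] by (rule less_imp_le)
  have "ennreal (partial_D r j k) = 1 + (\<Sum>i<m. ennreal (\<Prod>l\<in>{j + 1..j + 1 + i}. r l))"
    unfolding m partial_D_shift using nn by (simp add: ennreal_plus sum_nonneg sum_ennreal)
  also have "\<dots> \<le> total_D r j"
    unfolding total_D_def by (intro add_left_mono sum_le_suminf) auto
  finally show ?thesis .
qed

lemma total_D_le:
  assumes "K0 \<le> j" and B: "\<And>k. j < k \<Longrightarrow> partial_D r j k \<le> B"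
  shows "total_D r j \<le> ennreal B"
proof -
  have nn: "0 \<le> (\<Prod>l\<in>{j + 1..j + 1 + i}. r l)" for i using prod_r(1)[OF assms(1)] by (rule less_imp_le)
  have "1 \<le> partial_D r j (j + 1)" using assms(1) by (intro partial_D_ge_1) auto
  also have "\<dots> \<le> B" by (rule B) simp
  finally have B1: "1 \<le> B" .
  have "(\<Sum>m. ennreal (\<Prod>i\<in>{j + 1..j + 1 + m}. r i)) \<le> ennreal (B - 1)"
  proof (rule suminf_le_const)
    fix m
    have "(\<Sum>i<m. ennreal (\<Prod>l\<in>{j + 1..j + 1 + i}. r l)) = ennreal (\<Sum>i<m. \<Prod>l\<in>{j + 1..j + 1 + i}. r l)"
      using nn by (simp add: sum_ennreal)
    also have "\<dots> \<le> ennreal (B - 1)"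
      using B[of "j + 1 + m"] unfolding partial_D_shift by (intro ennreal_leI) simp
    finally show "(\<Sum>i<m. ennreal (\<Prod>l\<in>{j + 1..j + 1 + i}. r l)) \<le> ennreal (B - 1)" .
  qed auto
  then have "total_D r j \<le> ennreal 1 + ennreal (B - 1)"
    unfolding total_D_def by (simp add: add_left_mono)
  also have "\<dots> = ennreal B" using B1 by (subst ennreal_plus[symmetric]) auto
  finally show ?thesis .
qed

lemma total_D_ge_1: "1 \<le> total_D r j"
  unfolding total_D_def by simp

lemma total_D_finite:
  assumes "total_D r j \<noteq> \<top>"
  obtains d where "total_D r j = ennreal d" "1 \<le> d" "w j = 1 / d"
proof -
  obtain d where d: "total_D r j = ennreal d" "0 \<le> d" using assms by (cases "total_D r j") auto
  moreover have d1: "1 \<le> d" using total_D_ge_1[of j] unfolding d by simp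
  moreover have "w j = 1 / d"
  proof -
    have "1 / total_D r j = ennreal (1 / d)" using d d1 by (simp add: divide_ennreal flip: ennreal_1)
    then show ?thesis unfolding w_def using d1 by simp
  qed
  ultimately show ?thesis using that by blast
qed

lemma w_top: "total_D r j = \<top> \<Longrightarrow> w j = 0"
  by (simp add: w_def)

lemma w_nonneg: "0 \<le> w j"
  by (simp add: w_def)

lemma tendsto_partial_D:
  assumes "K0 \<le> j" and d: "total_D r j = ennreal d"
  shows "(\<lambda>m. partial_D r j (k + m)) \<longlonglongrightarrow> d"
proof -
  have nn: "0 \<le> (\<Prod>l\<in>{j + 1..j + 1 + i}. r l)" for i using prod_r(1)[OF assms(1)] by (rule less_imp_le)
  let ?f = "\<lambda>m. \<Prod>i\<in>{j + 1..j + 1 + m}. r i"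
  have "(\<Sum>m. ennreal (?f m)) \<noteq> \<top>"
    using d unfolding total_D_def by (auto simp: ennreal_add_eq_top)
  then have sm: "summable ?f" by (rule summable_suminf_not_top[OF nn])
  have "total_D r j = 1 + ennreal (suminf ?f)"
    unfolding total_D_def using nn sm by (simp only: suminf_ennreal2)
  then have eq: "ennreal d = ennreal (1 + suminf ?f)"
    unfolding d using suminf_nonneg[OF sm] nn by (simp add: ennreal_plus)
  have "0 \<le> suminf ?f" using suminf_nonneg[OF sm] nn by blast
  moreover have "d \<ge> 0"
  proof (rule ccontr)
    assume "\<not> d \<ge> 0"
    then have "ennreal d = 0" by (simp add: ennreal_neg)
    then show False using d total_D_ge_1[of j] by simp
  qed
  ultimately have "d = 1 + suminf ?f" using eq by (subst (asm) ennreal_inj) auto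
  moreover have "(\<lambda>m. 1 + (\<Sum>i<m. ?f i)) \<longlonglongrightarrow> 1 + suminf ?f"
    by (intro tendsto_add tendsto_const summable_LIMSEQ sm)
  ultimately have "(\<lambda>m. partial_D r j (j + 1 + m)) \<longlonglongrightarrow> d"
    by (simp only: partial_D_shift)
  then have "(\<lambda>m. partial_D r j (m + (j + 1))) \<longlonglongrightarrow> d" by (simp add: add.commute add.left_commute)
  then have "(\<lambda>m. partial_D r j m) \<longlonglongrightarrow> d" by (rule LIMSEQ_offset)
  then have "(\<lambda>m. partial_D r j (m + k)) \<longlonglongrightarrow> d" by (rule LIMSEQ_ignore_initial_segment)
  then show ?thesis by (simp add: add.commute)
qed

text \<open>Letting \<open>m\<close> tend to infinity in \<open>partial_D_add\<close> gives
  \<open>D j = D j k + P * D k\<close> with \<open>P\<close> the product of the ratios in between.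
  So \<open>1 - w j * D j k = P * D k / D j\<close>, and passing from \<open>k\<close> to
  \<open>k + 1\<close> multiplies this by \<open>1 - w k\<close>.\<close>

lemma w_partial_D:
  assumes fin: "\<And>i. J \<le> i \<Longrightarrow> total_D r i \<noteq> \<top>" and J: "K0 \<le> J" "J \<le> j" "j \<le> k"
  shows "w j * partial_D r j k = 1 - (\<Prod>i\<in>{j..<k}. 1 - w i)"
  using J(3)
proof (induction k rule: dec_induct)
  case base
  then show ?case by simp
next
  case (step k)
  obtain d where d: "total_D r j = ennreal d" "1 \<le> d" "w j = 1 / d"
    using total_D_finite[of j] fin[of j] J by auto
  obtain e where e: "total_D r k = ennreal e" "1 \<le> e" "w k = 1 / e"
    using total_D_finite[of k] fin[of k] J step by auto
  let ?P = "\<Prod>l\<in>{j + 1..k}. r l"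
  have "(\<lambda>m. partial_D r j k + ?P * partial_D r k (k + m)) \<longlonglongrightarrow> partial_D r j k + ?P * e"
    using J step by (intro tendsto_add tendsto_mult tendsto_const tendsto_partial_D e) auto
  moreover have "(\<lambda>m. partial_D r j (k + m)) \<longlonglongrightarrow> d"
    using J by (intro tendsto_partial_D d) auto
  ultimately have deq: "d = partial_D r j k + ?P * e"
    using partial_D_add[of j k r] step by (simp add: LIMSEQ_unique)
  have "w j * partial_D r j (Suc k) = 1 - (1 - w j * partial_D r j k) * (1 - w k)"
  proof -
    have pD: "partial_D r j k = d - ?P * e" using deq by simp
    show ?thesis unfolding partial_D_Suc[OF step(1)] pD d(3) e(3) using d(2) e(2) by (simp add: field_simps)
  qed
  also have "\<dots> = 1 - (\<Prod>i\<in>{j..<Suc k}. 1 - w i)"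
    using step by simp
  finally show ?case .
qed

lemma series_term:
  assumes "n \<ge> 2"
  shows "1 / (total_D r n * ennreal (ln (real n))) = ennreal (w n / ln (real n))"
proof -
  have l: "ln (real n) > 0" using assms by simp
  show ?thesis
  proof (cases "total_D r n = \<top>")
    case True
    then show ?thesis using l by (simp add: w_top ennreal_top_mult)
  next
    case False
    then obtain d where d: "total_D r n = ennreal d" "1 \<le> d" "w n = 1 / d" by (rule total_D_finite)
    have "1 / (total_D r n * ennreal (ln (real n))) = ennreal 1 / ennreal (d * ln (real n))"
      using d l by (simp add: ennreal_mult)
    also have "\<dots> = ennreal (1 / (d * ln (real n)))"
      using d l by (intro divide_ennreal) auto
    finally show ?thesis using d by simp
  qed
qed

lemma series_finite_iff:
  "(\<Sum>n. 1 / (total_D r (n + 2) * ennreal (ln (real (n + 2))))) < \<infinity> \<longleftrightarrow> summable (\<lambda>n. w n / ln (real n))"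
proof -
  have eq: "1 / (total_D r (n + 2) * ennreal (ln (real (n + 2)))) = ennreal (w (n + 2) / ln (real (n + 2)))" for n
    by (rule series_term) simp
  have nn: "0 \<le> w (n + 2) / ln (real (n + 2))" for n using w_nonneg by simp
  have "(\<Sum>n. ennreal (w (n + 2) / ln (real (n + 2)))) < \<infinity> \<longleftrightarrow> summable (\<lambda>n. w (n + 2) / ln (real (n + 2)))"
    unfolding infinity_ennreal_def less_top[symmetric]
    using summable_suminf_not_top[of "\<lambda>n. w (n + 2) / ln (real (n + 2))", OF nn]
      ennreal_suminf_neq_top[of "\<lambda>n. w (n + 2) / ln (real (n + 2))"] nn
    by blast
  then show ?thesis
    unfolding eq summable_iff_shift[of "\<lambda>n. w n / ln (real n)" 2] .
qed

end

text \<open>The interface between the two walks and the limit theorems. Products in place of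
  quotients keep the bounds meaningful when the series diverges: then no \<open>d\<close> satisfies
  the premise of \<open>esc_lb\<close>, and \<open>esc_ub\<close> forces the escape probability to
  be 0. The distance 4 leaves room to control the overshoot of the (1,2) walk.\<close>

locale cut_estimates = ratio_sequence r K0 for r :: "nat \<Rightarrow> real" and K0 :: nat +
  fixes K :: "nat \<Rightarrow> nat pmf" and c :: nat and \<alpha> \<Gamma> :: real
  assumes \<alpha>: "\<alpha> > 0" and \<Gamma>: "\<Gamma> > 0"
    and entry: "\<And>x k. K0 \<le> k \<Longrightarrow> x + 4 \<le> k \<Longrightarrow> \<alpha> \<le> entry_prob K c x k"
    and esc_ub: "\<And>k l. K0 \<le> k \<Longrightarrow> k < l \<Longrightarrow> escape_prob K c k * partial_D r k l \<le> \<Gamma>"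
    and esc_lb: "\<And>k d. K0 \<le> k \<Longrightarrow> (\<And>l. k < l \<Longrightarrow> partial_D r k l \<le> d) \<Longrightarrow> \<alpha> \<le> escape_prob K c k * d"
    and link_ub: "\<And>j k. K0 \<le> j \<Longrightarrow> j < k \<Longrightarrow> link_prob K c j k * partial_D r j k \<le> \<Gamma>"
    and link_lb: "\<And>j k. K0 \<le> j \<Longrightarrow> j + 4 \<le> k \<Longrightarrow> \<alpha> \<le> link_prob K c j k * partial_D r j k"
begin

abbreviation "ent \<equiv> entry_prob K c"
abbreviation "esc \<equiv> escape_prob K c"
abbreviation "lnk \<equiv> link_prob K c"

lemma entry_prob_le_1: "ent x k \<le> 1"
  unfolding entry_prob_def by (rule measure_path_law_le_1)

lemma entry_prob_nonneg: "0 \<le> ent x k"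
  unfolding entry_prob_def by simp

lemma escape_prob_nonneg: "0 \<le> esc k"
  unfolding escape_prob_def by simp

lemma link_prob_nonneg: "0 \<le> lnk j k"
  unfolding link_prob_def by simp

text \<open>A positive escape probability bounds all partial sums by
  \<open>\<Gamma> / esc k\<close>, so the series converges to at most this value.\<close>

lemma escape_prob_le:
  assumes "K0 \<le> k"
  shows "esc k \<le> \<Gamma> * w k"
proof (cases "esc k = 0")
  case False
  then have e: "esc k > 0" using escape_prob_nonneg[of k] by simp
  have "total_D r k \<le> ennreal (\<Gamma> / esc k)"
    using esc_ub[OF assms] e by (intro total_D_le assms) (simp add: field_simps)
  then have nt: "total_D r k \<noteq> \<top>" by (auto simp: top_unique)
  then obtain d where d: "total_D r k = ennreal d" "1 \<le> d" "w k = 1 / d" by (rule total_D_finite)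
  have "ennreal d \<le> ennreal (\<Gamma> / esc k)"
    using \<open>total_D r k \<le> _\<close> d by simp
  then have "d \<le> \<Gamma> / esc k" using \<Gamma> e by (subst (asm) ennreal_le_iff) auto
  then show ?thesis unfolding d(3) using d(2) e by (simp add: field_simps)
qed (use \<Gamma> w_nonneg in simp)

lemma escape_prob_ge:
  assumes "K0 \<le> k"
  shows "\<alpha> * w k \<le> esc k"
proof (cases "total_D r k = \<top>")
  case True
  then show ?thesis using escape_prob_nonneg by (simp add: w_top)
next
  case False
  then obtain d where d: "total_D r k = ennreal d" "1 \<le> d" "w k = 1 / d" by (rule total_D_finite)
  have "\<alpha> \<le> esc k * d"
  proof (rule esc_lb[OF assms])
    fix l assume "k < l"
    then have "ennreal (partial_D r k l) \<le> ennreal d"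
      using ennreal_partial_D_le[OF assms, of l] d by simp
    then show "partial_D r k l \<le> d" using d by (subst (asm) ennreal_le_iff) auto
  qed
  then show ?thesis unfolding d(3) using d(2) by (simp add: field_simps)
qed

lemma cut_events: "{v. cut_at c k v} \<in> sets path_space"
  by (rule sets_path) measurable

theorem AE_finite_cuts:
  assumes sum: "(\<Sum>n. 1 / (total_D r (n + 2) * ennreal (ln (real (n + 2))))) < \<infinity>"
  shows "AE v in path_law K x. finite {k. cut_at c k v}"
proof -
  interpret prob_space "path_law K x" by (rule prob_space_path_law)
  define A where "A k = {v. cut_at c k v}" for k
  define J where "J = K0 + x + 4"
  have later: "A k - (\<Union>i\<in>{k<..n}. A i) = {v. cut_at c k v \<and> last_cut c k n v}" for k n
    unfolding A_def last_cut_def by auto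
  have both: "A j \<inter> (A k - (\<Union>i\<in>{k<..n}. A i)) = {v. cut_at c j v \<and> cut_at c k v \<and> last_cut c k n v}" for j k n
    unfolding later unfolding A_def by auto
  have "AE v in path_law K x. finite {k. v \<in> A k}"
  \<comment> \<open>In \<open>c = \<alpha>\<^sup>2\<close> one factor comes from the link and one
    from the entry at \<open>j\<close>, whereas the entry at \<open>k\<close> is bounded by 1. The
    link contributes \<open>1 / (k - j)\<close> through
    \<open>partial_D r j k \<le> k - j\<close>.\<close>
  proof (rule AE_finite_occurrences[where K = J and C = \<Gamma> and c = "\<alpha>\<^sup>2" and w = w])
    show "A k \<in> events" for k unfolding A_def using cut_events by simp
    show "prob (A k) \<le> \<Gamma> * w k" if "J \<le> k" for k
    proof -
      have "prob (A k) = ent x k * esc k" unfolding A_def by (rule prob_cut)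
      also have "\<dots> \<le> 1 * esc k"
        by (intro mult_right_mono entry_prob_le_1 escape_prob_nonneg)
      also have "\<dots> \<le> \<Gamma> * w k" using escape_prob_le[of k] that by (simp add: J_def)
      finally show ?thesis .
    qed
    show "\<alpha>\<^sup>2 / real (k - j) * prob (A k - (\<Union>i\<in>{k<..n}. A i)) \<le> prob (A j \<inter> (A k - (\<Union>i\<in>{k<..n}. A i)))"
      if "J \<le> j" "j + 4 \<le> k" "k \<le> n" for j k n
    proof -
      define s where "s = measure (path_law K (k + c)) {w. above k w \<and> last_cut c k n w}"
      have s: "0 \<le> s" unfolding s_def by simp
      have jk: "j < k" and jK: "K0 \<le> j" "x + 4 \<le> j" using that by (auto simp: J_def)
      have D: "0 < partial_D r j k" "partial_D r j k \<le> real (k - j)"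
        using partial_D_ge_1[OF jK(1) jk] partial_D_le[OF jK(1)] jk by auto
      have "\<alpha> / real (k - j) \<le> \<alpha> / partial_D r j k"
        using D \<alpha> by (intro divide_left_mono) auto
      also have "\<dots> \<le> lnk j k"
        using link_lb[OF jK(1) that(2)] D by (simp add: field_simps)
      finally have 1: "\<alpha> / real (k - j) \<le> lnk j k" .
      have "\<alpha>\<^sup>2 / real (k - j) * (ent x k * s) \<le> \<alpha>\<^sup>2 / real (k - j) * (1 * s)"
        using entry_prob_le_1 s by (intro mult_left_mono mult_right_mono) auto
      also have "\<dots> = \<alpha> * (\<alpha> / real (k - j)) * s" by (simp add: power2_eq_square)
      also have "\<dots> \<le> ent x j * lnk j k * s"
        using 1 entry[OF jK] \<alpha> s entry_prob_nonneg by (intro mult_right_mono mult_mono) auto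
      finally show ?thesis
        unfolding both unfolding later prob_cut_no_later prob_cut_cut_no_later[OF jk] s_def .
    qed
    show "summable (\<lambda>k. w k / ln (real k))" using sum unfolding series_finite_iff .
  qed (use \<alpha> \<Gamma> w_nonneg in auto)
  then show ?thesis by (simp add: A_def)
qed

theorem AE_infinite_cuts:
  assumes \<delta>: "\<delta> > 0"
    and bound: "\<forall>\<^sub>F n in sequentially. total_D r n \<le> ennreal (\<delta> * real n * ln (real n))"
    and div: "(\<Sum>n. 1 / (total_D r (n + 2) * ennreal (ln (real (n + 2))))) = \<infinity>"
  shows "AE v in path_law K x. infinite {k. cut_at c k v}"
proof -
  obtain N where N: "\<And>n. N \<le> n \<Longrightarrow> total_D r n \<le> ennreal (\<delta> * real n * ln (real n))"
    using bound by (auto simp: eventually_sequentially)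
  define J where "J = K0 + N + 3"
  have fin: "total_D r n \<noteq> \<top>" if "J \<le> n" for n
  proof -
    have "N \<le> n" using that by (simp add: J_def)
    from N[OF this] show ?thesis by (auto simp: top_unique)
  qed
  have wJ: "0 < w n \<and> w n \<le> 1" "1 \<le> \<delta> * real n * ln (real n) * w n" if n: "J \<le> n" for n
  proof -
    obtain d where d: "total_D r n = ennreal d" "1 \<le> d" "w n = 1 / d"
      using total_D_finite[of n] fin[OF n] by auto
    then show "0 < w n \<and> w n \<le> 1" unfolding d(3) by (simp add: field_simps)
    have "N \<le> n" "n \<ge> 2" using n by (auto simp: J_def)
    then have "ennreal d \<le> ennreal (\<delta> * real n * ln (real n))" using N[of n] d by simp
    then have "d \<le> \<delta> * real n * ln (real n)"
      using \<delta> \<open>n \<ge> 2\<close> by (subst (asm) ennreal_le_iff) auto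
    then show "1 \<le> \<delta> * real n * ln (real n) * w n" unfolding d(3) using d(2) by (simp add: field_simps)
  qed
  obtain B where B: "B > 0"
    "\<And>a k. J \<le> a \<Longrightarrow> a < k \<Longrightarrow>
      (\<Sum>j\<in>{a..<k}. 1 / ln (real j) / partial_D r j k) \<le> B * (1 + (\<Sum>j\<in>{a..<k}. w j / ln (real j)))"
  proof (rule weighted_inverse_sum_bound[of J w \<delta> "partial_D r"])
    show "w j * partial_D r j k = 1 - (\<Prod>i\<in>{j..<k}. 1 - w i)" if "J \<le> j" "j < k" for j k
      using that by (intro w_partial_D[of J] fin) (auto simp: J_def)
  qed (use wJ \<delta> in \<open>auto simp: J_def\<close>)
  \<comment> \<open>Single probabilities need \<open>\<Gamma>\<close>, joint ones
    \<open>\<Gamma>\<^sup>2\<close> for link and escape; the sum serves for both.\<close>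
  define C where "C = \<Gamma> + \<Gamma>\<^sup>2"
  have C: "C > 0" "\<Gamma> \<le> C" "\<Gamma>\<^sup>2 \<le> C" using \<Gamma> by (auto simp: C_def add_pos_pos)
  have ndiv: "\<not> summable (\<lambda>k. w k / ln (real k))"
    using div unfolding series_finite_iff[symmetric] by simp
  define \<beta> where "\<beta> = (\<alpha>\<^sup>2)\<^sup>2 / (C + 4 * C * B)"
  have "\<beta> > 0" unfolding \<beta>_def using \<alpha> C B by (intro divide_pos_pos add_pos_pos) auto
  \<comment> \<open>The start \<open>y\<close> affects only how far out the levels have to be taken.
    The unions over \<open>k \<ge> a\<close> have probability at least \<open>\<beta>\<close> for
    all large \<open>a\<close> and decrease to the event of infinitely many cutpoints.\<close>
  moreover have "\<beta> \<le> measure (path_law K y) {v. infinite {k. cut_at c k v}}" for y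
  proof -
    interpret prob_space "path_law K y" by (rule prob_space_path_law)
    define A where "A k = {v. cut_at c k v}" for k
    have A: "A k \<in> events" for k unfolding A_def using cut_events by simp
    have ge: "\<beta> \<le> prob (\<Union>k\<in>{a..}. A k)" if a: "J + y + 4 \<le> a" for a
      unfolding \<beta>_def
    proof (rule prob_occurrence_ge[where w = w and D = "partial_D r"])
      have K0: "K0 \<le> k" "y + 4 \<le> k" "J \<le> k" if "a \<le> k" for k using that a by (auto simp: J_def)
      have P: "prob (A k) = ent y k * esc k" for k
        unfolding A_def by (rule prob_cut)
      show "prob (A k) \<le> C * w k" if "a \<le> k" for k
      proof -
        have "prob (A k) \<le> 1 * esc k"
          unfolding P by (intro mult_right_mono entry_prob_le_1 escape_prob_nonneg)
        also have "\<dots> \<le> \<Gamma> * w k" using escape_prob_le[OF K0(1)[OF that]] by simp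
        also have "\<dots> \<le> C * w k" using C w_nonneg by (intro mult_right_mono) auto
        finally show ?thesis .
      qed
      show "\<alpha>\<^sup>2 * w k \<le> prob (A k)" if "a \<le> k" for k
      proof -
        have "\<alpha> * (\<alpha> * w k) \<le> ent y k * esc k"
          using entry[OF K0(1,2)[OF that]] escape_prob_ge[OF K0(1)[OF that]] \<alpha> w_nonneg entry_prob_nonneg
          by (intro mult_mono) auto
        then show ?thesis unfolding P by (simp add: power2_eq_square mult.assoc)
      qed
      show "prob (A j \<inter> A k) \<le> C * w k * (1 / partial_D r j k)" if "a \<le> j" "j < k" for j k
      proof -
        have jK: "K0 \<le> j" "K0 \<le> k" using K0[of j] K0[of k] that by auto
        have D: "0 < partial_D r j k" using partial_D_ge_1[OF jK(1) that(2)] by simp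
        have "A j \<inter> A k = {v. cut_at c j v \<and> cut_at c k v}" unfolding A_def by auto
        then have "prob (A j \<inter> A k) = ent y j * lnk j k * esc k"
          using prob_cut_cut[OF that(2)] by simp
        also have "\<dots> \<le> 1 * (\<Gamma> / partial_D r j k) * (\<Gamma> * w k)"
          using link_ub[OF jK(1) that(2)] D \<Gamma> escape_prob_le[OF jK(2)]
          by (intro mult_mono entry_prob_le_1)
            (auto simp: field_simps entry_prob_nonneg link_prob_nonneg escape_prob_nonneg)
        also have "\<dots> = \<Gamma>\<^sup>2 * (w k * (1 / partial_D r j k))" by (simp add: power2_eq_square)
        also have "\<dots> \<le> C * (w k * (1 / partial_D r j k))"
          using C D w_nonneg by (intro mult_right_mono) auto
        finally show ?thesis by simp
      qed
      show "(\<Sum>j\<in>{a..<k}. 1 / ln (real j) / partial_D r j k) \<le> B * (1 + (\<Sum>j\<in>{a..<k}. w j / ln (real j)))"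
        if "a < k" for k using B(2)[of a k] a that by simp
    qed (use A C B \<alpha> w_nonneg ndiv a in \<open>auto simp: J_def\<close>)
    define U where "U n = (\<Union>k\<in>{J + y + 4 + n..}. A k)" for n
    have "(\<lambda>n. prob (U n)) \<longlonglongrightarrow> prob (\<Inter>n. U n)"
    proof (rule finite_Lim_measure_decseq)
      show "range U \<subseteq> events" unfolding U_def using A by auto
      show "decseq U" unfolding decseq_def U_def by fastforce
    qed
    moreover have "\<beta> \<le> prob (U n)" for n unfolding U_def by (rule ge) simp
    ultimately have "\<beta> \<le> prob (\<Inter>n. U n)" by (intro LIMSEQ_le_const) auto
    also have "(\<Inter>n. U n) = {v. infinite {k. cut_at c k v}}"
    proof (intro set_eqI iffI)
      fix v assume v: "v \<in> (\<Inter>n. U n)"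
      have "\<exists>k\<ge>n. cut_at c k v" for n
      proof -
        have "v \<in> U n" using v by blast
        then obtain k where "k \<ge> J + y + 4 + n" "cut_at c k v" unfolding U_def A_def by auto
        then show ?thesis by (intro exI[of _ k]) auto
      qed
      then show "v \<in> {v. infinite {k. cut_at c k v}}" by (auto simp: infinite_nat_iff_unbounded_le)
    next
      fix v assume "v \<in> {v. infinite {k. cut_at c k v}}"
      then have "\<exists>k\<ge>n. cut_at c k v" for n by (auto simp: infinite_nat_iff_unbounded_le)
      then show "v \<in> (\<Inter>n. U n)" unfolding U_def A_def by auto
    qed
    finally show ?thesis .
  qed
  ultimately show ?thesis by (rule AE_infinite_cut)
qed

end

section \<open>The three term recursion\<close>

text \<open>Increments of a harmonic function between neighbouring levels satisfy this recursion,
  read upwards for the (2,1) walk and downwards for the (1,2) walk. The initial 0 records that the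
  function is constant beyond the boundary where the recursion begins; the 1 fixes the
  scale.\<close>

fun rec_d :: "(nat \<Rightarrow> real) \<Rightarrow> (nat \<Rightarrow> real) \<Rightarrow> nat \<Rightarrow> real" where
  "rec_d \<alpha> \<beta> 0 = 0"
| "rec_d \<alpha> \<beta> (Suc 0) = 1"
| "rec_d \<alpha> \<beta> (Suc (Suc i)) = \<alpha> (Suc i) * rec_d \<alpha> \<beta> (Suc i) + \<beta> (Suc i) * rec_d \<alpha> \<beta> i"

text \<open>Since \<open>\<sigma> i\<close> is the positive root of \<open>x\<^sup>2 = \<alpha> i * x + \<beta> i\<close>, the products of the \<open>\<sigma> l\<close> solve the
  recursion up to an error whose sign is controlled by the monotonicity of \<open>\<sigma>\<close>.\<close>

lemma rec_d_bounds:
  assumes \<sigma>: "\<And>i. 1 \<le> i \<Longrightarrow> i \<le> N \<Longrightarrow> 0 < \<sigma> i \<and> 0 \<le> \<alpha> i \<and> 0 \<le> \<beta> i \<and> (\<sigma> i)\<^sup>2 = \<alpha> i * \<sigma> i + \<beta> i"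
    and mono: "\<And>i. 1 \<le> i \<Longrightarrow> i < N \<Longrightarrow> \<sigma> i \<le> \<sigma> (Suc i)"
    and \<kappa>: "0 \<le> \<kappa>" "\<kappa> \<le> 1" "\<kappa> * \<sigma> 1 \<le> \<alpha> 1"
    and i: "1 \<le> i" "i \<le> N"
  shows "\<kappa> * (\<Prod>l\<in>{1..<i}. \<sigma> l) \<le> rec_d \<alpha> \<beta> i \<and> \<sigma> 1 * rec_d \<alpha> \<beta> i \<le> \<sigma> i * (\<Prod>l\<in>{1..<i}. \<sigma> l)"
  using i
proof (induction i rule: less_induct)
  case (less i)
  define prd where "prd i = (\<Prod>l\<in>{1..<i}. \<sigma> l)" for i
  consider "i = 1" | "i = 2" | m where "i = Suc (Suc m)" "m \<ge> 1"
    using less.prems by (metis One_nat_def Suc_1 le_Suc_eq le_antisym not_less_eq_eq old.nat.exhaust)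
  then show ?case
  proof cases
    case 1
    then show ?thesis using \<kappa> by simp
  next
    \<comment> \<open>Here \<open>rec_d \<alpha> \<beta> 2 = \<alpha> 1\<close>, which may be
      smaller than \<open>\<sigma> 1\<close>; \<open>\<kappa>\<close> compensates for this.\<close>
    case 2
    then have N: "2 \<le> N" using less.prems by simp
    have s1: "0 < \<sigma> 1" "0 \<le> \<beta> 1" "(\<sigma> 1)\<^sup>2 = \<alpha> 1 * \<sigma> 1 + \<beta> 1" using \<sigma>[of 1] N by auto
    have m12: "\<sigma> 1 \<le> \<sigma> 2" using mono[of 1] N by (simp add: numeral_2_eq_2)
    have "\<sigma> 1 * \<alpha> 1 \<le> \<sigma> 1 * \<sigma> 1" using s1 by (simp add: power2_eq_square mult.commute)
    also have "\<dots> \<le> \<sigma> 2 * \<sigma> 1" using m12 s1(1) by (intro mult_right_mono) auto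
    finally show ?thesis using 2 \<kappa> by (simp add: numeral_2_eq_2)
  next
    case (3 m)
    let ?n = "Suc m"
    have n: "?n < i" "1 \<le> ?n" "?n \<le> N" and m: "m < i" "1 \<le> m" "m \<le> N" using 3 less.prems by auto
    have sn: "0 < \<sigma> ?n" "0 \<le> \<alpha> ?n" "0 \<le> \<beta> ?n" "(\<sigma> ?n)\<^sup>2 = \<alpha> ?n * \<sigma> ?n + \<beta> ?n"
      using \<sigma>[OF n(2,3)] by auto
    have sm: "0 < \<sigma> m" using \<sigma>[OF m(2,3)] by auto
    have mon: "\<sigma> m \<le> \<sigma> ?n" "\<sigma> ?n \<le> \<sigma> i" using mono[of m] mono[of ?n] m n 3 less.prems by auto
    have P1: "prd ?n = prd m * \<sigma> m" using m by (simp add: prd_def)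
    have P2: "prd i = prd ?n * \<sigma> ?n" using 3 by (simp add: prd_def)
    have Pm: "0 < prd m" unfolding prd_def using \<sigma> m by (intro prod_pos) auto
    have IHn: "\<kappa> * prd ?n \<le> rec_d \<alpha> \<beta> ?n" "\<sigma> 1 * rec_d \<alpha> \<beta> ?n \<le> \<sigma> ?n * prd ?n"
      using less.IH[OF n] by (auto simp: prd_def)
    have IHm: "\<kappa> * prd m \<le> rec_d \<alpha> \<beta> m" "\<sigma> 1 * rec_d \<alpha> \<beta> m \<le> \<sigma> m * prd m"
      using less.IH[OF m] by (auto simp: prd_def)
    have d: "rec_d \<alpha> \<beta> i = \<alpha> ?n * rec_d \<alpha> \<beta> ?n + \<beta> ?n * rec_d \<alpha> \<beta> m" using 3 by simp
    have an: "\<alpha> ?n \<le> \<sigma> ?n"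
    proof -
      have "\<alpha> ?n * \<sigma> ?n \<le> \<sigma> ?n * \<sigma> ?n" using sn by (simp add: power2_eq_square)
      then show ?thesis using sn by simp
    qed
    have "\<kappa> * prd i = \<kappa> * prd m * (\<sigma> m * \<sigma> ?n)" by (simp add: P1 P2)
    also have "\<dots> \<le> \<kappa> * prd m * (\<alpha> ?n * \<sigma> m + \<beta> ?n)"
    proof (rule mult_left_mono)
      \<comment> \<open>Expanded by means of the quadratic equation for \<open>\<sigma> ?n\<close>,
        this product is exactly the error of the recursion; monotonicity gives its sign.\<close>
      have "0 \<le> (\<sigma> ?n - \<alpha> ?n) * (\<sigma> ?n - \<sigma> m)" using an mon by simp
      also have "\<dots> = \<alpha> ?n * \<sigma> m + \<beta> ?n - \<sigma> m * \<sigma> ?n"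
        using sn(4) by (simp add: algebra_simps power2_eq_square)
      finally show "\<sigma> m * \<sigma> ?n \<le> \<alpha> ?n * \<sigma> m + \<beta> ?n" by simp
    qed (use \<kappa> Pm in simp)
    also have "\<dots> = \<alpha> ?n * (\<kappa> * prd ?n) + \<beta> ?n * (\<kappa> * prd m)" by (simp add: P1 algebra_simps)
    also have "\<dots> \<le> rec_d \<alpha> \<beta> i"
      unfolding d using IHn IHm sn by (intro add_mono mult_left_mono) auto
    finally have lo: "\<kappa> * prd i \<le> rec_d \<alpha> \<beta> i" .
    \<comment> \<open>The extra factor \<open>\<sigma> i\<close> in the upper bound closes the
      induction: \<open>\<sigma> m * prd m = prd ?n\<close> turns the right side into
      \<open>(\<sigma> ?n)\<^sup>2 * prd ?n\<close>.\<close>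
    have "\<sigma> 1 * rec_d \<alpha> \<beta> i = \<alpha> ?n * (\<sigma> 1 * rec_d \<alpha> \<beta> ?n) + \<beta> ?n * (\<sigma> 1 * rec_d \<alpha> \<beta> m)"
      unfolding d by (simp add: algebra_simps)
    also have "\<dots> \<le> \<alpha> ?n * (\<sigma> ?n * prd ?n) + \<beta> ?n * (\<sigma> m * prd m)"
      using IHn IHm sn by (intro add_mono mult_left_mono) auto
    also have "\<dots> = (\<alpha> ?n * \<sigma> ?n + \<beta> ?n) * prd ?n" by (simp add: P1 algebra_simps)
    also have "\<dots> = \<sigma> ?n * prd i" unfolding sn(4)[symmetric] by (simp add: P2 power2_eq_square)
    also have "\<dots> \<le> \<sigma> i * prd i"
      using mon sn Pm sm by (intro mult_right_mono) (auto simp: P1 P2)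
    finally show ?thesis using lo by (simp add: prd_def)
  qed
qed

section \<open>Cutpoints of individual paths\<close>

lemma hits_level_upward:
  fixes w :: "nat \<Rightarrow> nat"
  assumes step: "\<And>i. w (Suc i) \<le> w i + 1" and "w i < k" "k \<le> w j" "i < j"
  shows "\<exists>l. i < l \<and> l \<le> j \<and> w l = k"
proof -
  define l where "l = (LEAST l. i < l \<and> k \<le> w l)"
  have l: "i < l \<and> k \<le> w l" unfolding l_def by (rule LeastI[of _ j]) (use assms in auto)
  have lj: "l \<le> j" unfolding l_def by (rule Least_le) (use assms in auto)
  obtain m where m: "l = Suc m" using l by (cases l) auto
  have "w m < k"
  proof (cases "m = i")
    case False
    then have "i < m" using l m by simp
    then show ?thesis using not_less_Least[of m "\<lambda>l. i < l \<and> k \<le> w l"] m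
      unfolding l_def[symmetric] by auto
  qed (use assms in simp)
  then have "w l = k" using step[of m] l m by simp
  then show ?thesis using l lj by blast
qed

text \<open>A path with upward steps of at most one cannot pass \<open>k\<close> upwards without
  visiting it. Being at or above \<open>k\<close> before the unique visit, or below \<open>k\<close>
  after it, would force another visit; the latter because the path is unbounded.\<close>

lemma ex1_iff_cut_at:
  fixes w :: "nat \<Rightarrow> nat"
  assumes step: "\<And>i. w (Suc i) \<le> w i + 1" and unb: "\<And>N. \<exists>n. N < w n" and "w 0 < k"
  shows "(\<exists>!n. w n = k) \<longleftrightarrow> cut_at 0 k w"
proof
  assume "\<exists>!n. w n = k"
  then obtain n where n: "w n = k" "\<And>m. w m = k \<Longrightarrow> m = n" by blast
  have "w i < k" if "i < n" for i
  proof (rule ccontr)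
    assume "\<not> w i < k"
    then have "0 < i" using assms(3) by (cases i) auto
    then obtain l where "l \<le> i" "w l = k"
      using hits_level_upward[of w 0 k i, OF step] assms(3) \<open>\<not> w i < k\<close> by auto
    then show False using n(2)[of l] that by simp
  qed
  moreover have "k < w m" if "n < m" for m
  proof (rule ccontr)
    assume "\<not> k < w m"
    then have wm: "w m < k" using n(2)[of m] that by (cases "w m = k") auto
    define b where "b = Max (insert k (w ` {..m}))"
    obtain j where j: "b < w j" using unb by blast
    have "m < j"
    proof (rule ccontr)
      assume "\<not> m < j"
      then have "w j \<le> b" unfolding b_def by (intro Max_ge) auto
      then show False using j by simp
    qed
    have "k \<le> b" unfolding b_def by (intro Max_ge) auto
    then obtain l where "m < l" "w l = k"
      using hits_level_upward[of w m k j, OF step] wm j \<open>m < j\<close> by auto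
    then show False using n(2)[of l] that by simp
  qed
  ultimately show "cut_at 0 k w" unfolding cut_at_def using n(1) by (intro exI[of _ n]) auto
next
  assume "cut_at 0 k w"
  then obtain n where n: "\<forall>i<n. w i < k" "w n = k" "\<forall>m>n. k < w m" by (auto simp: cut_at_def)
  show "\<exists>!n. w n = k"
  proof
    show "w n = k" by fact
    fix m assume "w m = k"
    then show "m = n" using n by (metis less_irrefl linorder_neqE_nat)
  qed
qed

text \<open>To pass \<open>k\<close> unvisited the path has to jump from \<open>k - 1\<close> to
  \<open>k + 1\<close>. Afterwards downward steps of one cannot take it below \<open>k\<close>
  without a visit.\<close>

lemma never_iff_cut_at:
  fixes w :: "nat \<Rightarrow> nat"
  assumes step: "\<And>i. w (Suc i) \<le> w i + 2" and down: "\<And>i. w i \<le> w (Suc i) + 1"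
    and unb: "\<And>N. \<exists>n. N < w n" and "w 0 < k"
  shows "(\<forall>n. w n \<noteq> k) \<longleftrightarrow> cut_at 1 k w"
proof
  assume never: "\<forall>n. w n \<noteq> k"
  obtain m' where "k \<le> w m'" using unb[of k] less_imp_le by blast
  then obtain n where kn: "k \<le> w n" and below: "\<And>i. i < n \<Longrightarrow> w i < k" using first_passage[of _ w] by blast
  obtain m where m: "n = Suc m" using kn assms(4) by (cases n) auto
  have "w m < k" using below[of m] m by simp
  moreover have "w n \<le> w m + 2" using step[of m] m by simp
  moreover have "w n \<noteq> k" using never by blast
  ultimately have "w n = k + 1" using kn by linarith
  moreover have "k < w (n + i)" for i
  proof (induction i)
    case 0
    then show ?case using kn never by (metis add.right_neutral le_neq_implies_less)
  next
    case (Suc i)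
    then have "k \<le> w (n + Suc i)" using down[of "n + i"] by simp
    then show ?case using never by (metis le_neq_implies_less)
  qed
  then have "k < w m" if "n < m" for m using that less_imp_add_positive by blast
  ultimately show "cut_at 1 k w" unfolding cut_at_def using below by auto
next
  assume "cut_at 1 k w"
  then obtain n where n: "\<forall>i<n. w i < k" "w n = k + 1" "\<forall>m>n. k < w m" by (auto simp: cut_at_def)
  show "\<forall>n. w n \<noteq> k"
  proof
    fix m show "w m \<noteq> k"
      using n by (cases m n rule: linorder_cases) auto
  qed
qed

lemma partial_D_mono:
  assumes "\<And>l. j < l \<Longrightarrow> 0 \<le> r l" "k \<le> k'"
  shows "partial_D r j k \<le> partial_D r j k'"
  unfolding partial_D_def using assms by (intro sum_mono2 prod_nonneg) auto

section \<open>Uniform bounds on the coefficients at large levels\<close>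

locale walk_bounds =
  fixes q p1 p2 :: "nat \<Rightarrow> real" and a b :: real and K0 :: nat
  assumes probs: "\<And>k. 2 \<le> k \<Longrightarrow> q k > 0 \<and> p1 k \<ge> 0 \<and> p2 k > 0 \<and> q k + p1 k + p2 k = 1"
    and ab: "0 < a" "a < 1" "0 < b" "b < 1" and K0: "2 \<le> K0"
    and a_bounds: "\<And>k. K0 \<le> k \<Longrightarrow> a / 2 \<le> a_seq q p1 p2 k \<and> a_seq q p1 p2 k \<le> 2"
    and b_bounds: "\<And>k. K0 \<le> k \<Longrightarrow> b / 2 \<le> b_seq q p1 p2 k"
    and rho_bounds: "\<And>k. K0 \<le> k \<Longrightarrow> 1 / 2 \<le> rho q p1 p2 k \<and> rho q p1 p2 k \<le> 2"
begin

abbreviation "A \<equiv> a_seq q p1 p2"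
abbreviation "B \<equiv> b_seq q p1 p2"
abbreviation "\<rho> \<equiv> rho q p1 p2"

lemma qA: "2 \<le> k \<Longrightarrow> q k * A k = p1 k + p2 k" and qB: "2 \<le> k \<Longrightarrow> q k * B k = p2 k"
  using probs[of k] by (auto simp: a_seq_def b_seq_def)

lemma AB_nonneg: "2 \<le> k \<Longrightarrow> 0 \<le> A k" "2 \<le> k \<Longrightarrow> 0 \<le> B k"
  using probs[of k] by (auto simp: a_seq_def b_seq_def)

lemma rho_square: "2 \<le> k \<Longrightarrow> (\<rho> k)\<^sup>2 = A k * \<rho> k + B k"
proof -
  assume "2 \<le> k"
  then have "(sqrt ((A k)\<^sup>2 + 4 * B k))\<^sup>2 = (A k)\<^sup>2 + 4 * B k"
    using AB_nonneg by (intro real_sqrt_pow2) simp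
  then show ?thesis unfolding rho_def by (simp add: power2_eq_square field_simps)
qed

lemma rho_pos: "K0 \<le> k \<Longrightarrow> 0 < \<rho> k"
  using rho_bounds[of k] by linarith

text \<open>\<open>q k * (1 + A k) = 1\<close> with \<open>A k \<le> 2\<close> gives the bound 1/3,
  and then \<open>p2 k = q k * B k\<close> with \<open>B k \<ge> b / 2\<close> gives the other
  one.\<close>

lemma q_ge: "K0 \<le> k \<Longrightarrow> 1 / 3 \<le> q k" and p2_ge: "K0 \<le> k \<Longrightarrow> b / 6 \<le> p2 k"
proof -
  assume k: "K0 \<le> k"
  then have k2: "2 \<le> k" using K0 by simp
  have "q k * A k \<le> q k * 2" using a_bounds[OF k] probs[OF k2] by (intro mult_left_mono) auto
  then show q3: "1 / 3 \<le> q k" using qA[OF k2] probs[OF k2] by simp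
  have "1 / 3 * (b / 2) \<le> q k * B k" using q3 b_bounds[OF k] ab by (intro mult_mono) auto
  then show "b / 6 \<le> p2 k" using qB[OF k2] by simp
qed

text \<open>The index map \<open>f\<close> covers both directions: \<open>f i = j + i\<close> for
  the (2,1) walk with increasing ratios and \<open>f i = k - i\<close> for the (1,2) walk with
  decreasing ones. The choice \<open>\<kappa> = a / 4\<close> works since
  \<open>\<rho> \<le> 2\<close> and \<open>A \<ge> a / 2\<close>; the 4 bounds a quotient of two
  values of \<open>\<rho>\<close> between 1/2 and 2.\<close>

lemma rec_d_rho_bounds:
  assumes f: "\<And>i. 1 \<le> i \<Longrightarrow> i \<le> N \<Longrightarrow> K0 \<le> f i" and N: "1 \<le> N"
    and mono: "\<And>i. 1 \<le> i \<Longrightarrow> i < N \<Longrightarrow> \<rho> (f i) \<le> \<rho> (f (Suc i))"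
    and i: "1 \<le> i" "i \<le> N"
  shows "a / 4 * (\<Prod>l\<in>{1..<i}. \<rho> (f l)) \<le> rec_d (\<lambda>i. A (f i)) (\<lambda>i. B (f i)) i"
    and "rec_d (\<lambda>i. A (f i)) (\<lambda>i. B (f i)) i \<le> 4 * (\<Prod>l\<in>{1..<i}. \<rho> (f l))"
proof -
  let ?d = "rec_d (\<lambda>i. A (f i)) (\<lambda>i. B (f i)) i" and ?P = "\<Prod>l\<in>{1..<i}. \<rho> (f l)"
  have f1: "K0 \<le> f 1" using f[of 1] N by simp
  have "a / 4 * ?P \<le> ?d \<and> \<rho> (f 1) * ?d \<le> \<rho> (f i) * ?P"
  proof (rule rec_d_bounds[where N = N])
    show "0 < \<rho> (f i) \<and> 0 \<le> A (f i) \<and> 0 \<le> B (f i) \<and> (\<rho> (f i))\<^sup>2 = A (f i) * \<rho> (f i) + B (f i)"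
      if "1 \<le> i" "i \<le> N" for i
      using rho_bounds[OF f[OF that]] AB_nonneg[of "f i"] rho_square[of "f i"] f[OF that] K0 by auto
    have "a / 4 * \<rho> (f 1) \<le> a / 4 * 2" using rho_bounds[OF f1] ab by (intro mult_left_mono) auto
    then show "a / 4 * \<rho> (f 1) \<le> A (f 1)" using a_bounds[OF f1] by simp
  qed (use ab mono i in auto)
  then have *: "a / 4 * ?P \<le> ?d" "\<rho> (f 1) * ?d \<le> \<rho> (f i) * ?P" by auto
  then show "a / 4 * ?P \<le> ?d" by simp
  have P: "0 \<le> ?P" using i by (intro prod_nonneg) (auto intro!: less_imp_le[OF rho_pos] f)
  have "0 \<le> a / 4 * ?P" using P ab by simp
  then have d: "0 \<le> ?d" using *(1) by linarith
  have "1 / 2 * ?d \<le> \<rho> (f 1) * ?d" using rho_bounds[OF f1] d by (intro mult_right_mono) auto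
  also have "\<dots> \<le> \<rho> (f i) * ?P" by fact
  also have "\<dots> \<le> 2 * ?P" using rho_bounds[OF f[OF i]] P by (intro mult_right_mono) auto
  finally show "?d \<le> 4 * ?P" by simp
qed

end

section \<open>Exit probabilities of the two walks\<close>

lemma pmf_embed_pmf_finite:
  fixes f :: "'a \<Rightarrow> real"
  assumes "finite S" "\<And>x. 0 \<le> f x" "\<And>x. x \<notin> S \<Longrightarrow> f x = 0" "sum f S = 1"
  shows "pmf (embed_pmf f) x = f x"
proof (rule pmf_embed_pmf)
  have "(\<integral>\<^sup>+x. ennreal (f x) \<partial>count_space UNIV) = (\<Sum>x\<in>S. ennreal (f x))"
    using assms(1,3) by (intro nn_integral_count_space') auto
  then show "(\<integral>\<^sup>+x. ennreal (f x) \<partial>count_space UNIV) = 1"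
    using assms by (simp add: sum_ennreal)
qed fact

lemma rec_d_nonneg: "(\<And>i. 0 \<le> \<alpha> i) \<Longrightarrow> (\<And>i. 0 \<le> \<beta> i) \<Longrightarrow> 0 \<le> rec_d \<alpha> \<beta> i"
  by (induction \<alpha> \<beta> i rule: rec_d.induct) auto

definition kernel21 :: "(nat \<Rightarrow> real) \<Rightarrow> (nat \<Rightarrow> real) \<Rightarrow> (nat \<Rightarrow> real) \<Rightarrow> nat \<Rightarrow> nat pmf" where
  "kernel21 q p1 p2 n = embed_pmf (trans21 q p1 p2 n)"

definition kernel12 :: "(nat \<Rightarrow> real) \<Rightarrow> (nat \<Rightarrow> real) \<Rightarrow> (nat \<Rightarrow> real) \<Rightarrow> nat \<Rightarrow> nat pmf" where
  "kernel12 q p1 p2 n = embed_pmf (trans12 q p1 p2 n)"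

lemma nonneg_if_chain:
  fixes u v z :: real
  assumes "0 \<le> u" "0 \<le> v" "0 \<le> z"
  shows "0 \<le> (if c1 then if c2 then 1 else 0 else if c3 then if c4 then 1 else 0
    else if c5 then u else if c6 then v else if c7 then z else 0)"
  using assms by auto

context walk_bounds
begin

lemma pmf_kernel21: "pmf (kernel21 q p1 p2 n) m = trans21 q p1 p2 n m"
  unfolding kernel21_def
proof (rule pmf_embed_pmf_finite)
  define S where "S = (if n = 0 then {1} else if n = 1 then {2} else {n + 1, n - 1, n - 2})"
  show "finite S" by (simp add: S_def)
  show "0 \<le> trans21 q p1 p2 n x" for x
  proof (cases "2 \<le> n")
    case True
    then have "0 \<le> q n" "0 \<le> p1 n" "0 \<le> p2 n" using probs[OF True] by auto
    then show ?thesis unfolding trans21_def by (rule nonneg_if_chain)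
  next
    case False
    then show ?thesis by (cases "n = 0") (auto simp: trans21_def)
  qed
  show "trans21 q p1 p2 n x = 0" if "x \<notin> S" for x
    using that by (auto simp: trans21_def S_def split: if_splits)
  show "sum (trans21 q p1 p2 n) S = 1"
  proof (cases "n < 2")
    case True
    then show ?thesis by (cases "n = 0") (auto simp: S_def trans21_def)
  next
    case False
    define m where "m = n - 2"
    have n: "n = Suc (Suc m)" using False by (simp add: m_def)
    show ?thesis using probs[of n] unfolding S_def n by (simp add: trans21_def)
  qed
qed

lemma pmf_kernel12: "pmf (kernel12 q p1 p2 n) m = trans12 q p1 p2 n m"
  unfolding kernel12_def
proof (rule pmf_embed_pmf_finite)
  define S where "S = (if n = 0 then {2} else if n = 1 then {0} else {n - 1, n + 1, n + 2})"
  show "finite S" by (simp add: S_def)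
  show "0 \<le> trans12 q p1 p2 n x" for x
  proof (cases "2 \<le> n")
    case True
    then have "0 \<le> q n" "0 \<le> p1 n" "0 \<le> p2 n" using probs[OF True] by auto
    then show ?thesis unfolding trans12_def by (rule nonneg_if_chain)
  next
    case False
    then show ?thesis by (cases "n = 0") (auto simp: trans12_def)
  qed
  show "trans12 q p1 p2 n x = 0" if "x \<notin> S" for x
    using that by (auto simp: trans12_def S_def split: if_splits)
  show "sum (trans12 q p1 p2 n) S = 1"
  proof (cases "n < 2")
    case True
    then show ?thesis by (cases "n = 0") (auto simp: S_def trans12_def)
  next
    case False
    define m where "m = n - 2"
    have n: "n = Suc (Suc m)" using False by (simp add: m_def)
    show ?thesis using probs[of n] unfolding S_def n by (simp add: trans12_def)
  qed
qed

abbreviation "KX \<equiv> kernel21 q p1 p2"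
abbreviation "KY \<equiv> kernel12 q p1 p2"
abbreviation "dX j \<equiv> rec_d (\<lambda>i. A (j + i)) (\<lambda>i. B (j + i))"
abbreviation "dY k \<equiv> rec_d (\<lambda>i. A (k - i)) (\<lambda>i. B (k - i))"

lemma set_KX: "y \<in> set_pmf (KX x) \<Longrightarrow> y \<le> x + 1"
  by (auto simp: set_pmf_iff pmf_kernel21 trans21_def split: if_splits)

lemma set_KY: "y \<in> set_pmf (KY x) \<Longrightarrow> y \<le> x + 2 \<and> x \<le> y + 1"
  by (auto simp: set_pmf_iff pmf_kernel12 trans12_def split: if_splits)

sublocale X: climbing_walk KX "\<lambda>x. x"
proof
  show "set_pmf (KX x) \<subseteq> {..x + 2}" for x using set_KX by fastforce
  show "\<exists>y\<in>set_pmf (KX x). x < y" for x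
    using probs[of x] by (intro bexI[of _ "x + 1"]) (auto simp: set_pmf_iff pmf_kernel21 trans21_def)
qed

text \<open>The walk leaves state 1 only through state 0, so the heights of 0 and 1 are exchanged.\<close>

sublocale Y: climbing_walk KY "\<lambda>x. if x = 0 then 1 else if x = 1 then 0 else x"
proof
  show "set_pmf (KY x) \<subseteq> {..x + 2}" for x using set_KY by fastforce
  show "\<exists>y\<in>set_pmf (KY x). (if x = 0 then 1 else if x = 1 then 0 else x) < (if y = 0 then 1 else if y = 1 then 0 else y)" for x
  proof (cases "x = 1")
    case True
    then show ?thesis by (intro bexI[of _ 0]) (auto simp: set_pmf_iff pmf_kernel12 trans12_def)
  next
    case False
    then show ?thesis
      using probs[of x] by (intro bexI[of _ "x + 2"]) (auto simp: set_pmf_iff pmf_kernel12 trans12_def)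
  qed
qed

lemma sum_KX:
  assumes "2 \<le> n"
  shows "(\<Sum>y\<le>n + 2. pmf (KX n) y * \<phi> y) = q n * \<phi> (n + 1) + p1 n * \<phi> (n - 1) + p2 n * \<phi> (n - 2)"
proof -
  have "(\<Sum>y\<le>n + 2. pmf (KX n) y * \<phi> y) = (\<Sum>y\<in>{n + 1, n - 1, n - 2}. pmf (KX n) y * \<phi> y)"
    using assms by (intro sum.mono_neutral_right) (auto simp: pmf_kernel21 trans21_def)
  also have "\<dots> = q n * \<phi> (n + 1) + p1 n * \<phi> (n - 1) + p2 n * \<phi> (n - 2)"
  proof -
    define m where "m = n - 2"
    have n: "n = Suc (Suc m)" using assms by (simp add: m_def)
    show ?thesis unfolding n by (simp add: pmf_kernel21 trans21_def)
  qed
  finally show ?thesis .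
qed

lemma sum_KY:
  assumes "2 \<le> n"
  shows "(\<Sum>y\<le>n + 2. pmf (KY n) y * \<phi> y) = q n * \<phi> (n - 1) + p1 n * \<phi> (n + 1) + p2 n * \<phi> (n + 2)"
proof -
  have "(\<Sum>y\<le>n + 2. pmf (KY n) y * \<phi> y) = (\<Sum>y\<in>{n - 1, n + 1, n + 2}. pmf (KY n) y * \<phi> y)"
    using assms by (intro sum.mono_neutral_right) (auto simp: pmf_kernel12 trans12_def)
  also have "\<dots> = q n * \<phi> (n - 1) + p1 n * \<phi> (n + 1) + p2 n * \<phi> (n + 2)"
  proof -
    define m where "m = n - 2"
    have n: "n = Suc (Suc m)" using assms by (simp add: m_def)
    show ?thesis unfolding n by (simp add: pmf_kernel12 trans12_def)
  qed
  finally show ?thesis .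
qed

text \<open>For a harmonic function of the (2,1) walk the increment above \<open>n\<close> is
  \<open>A n\<close> times the one below \<open>n\<close> plus \<open>B n\<close> times the one
  before that. If it vanishes at and below \<open>j\<close>, its increments are multiples of
  \<open>dX j\<close>, and its value at \<open>j + 1\<close> is the first increment, 1, divided by
  their sum.\<close>

lemma X_reaches:
  assumes j: "2 \<le> j" "j < k"
  shows "X.hit j k =
    1 / (\<Sum>i\<in>{1..k - j}. dX j i)"
proof -
  define d where "d = dX j"
  define S where "S m = (\<Sum>i\<in>{1..m}. d i)" for m
  have S_Suc: "S (Suc m) = S m + d (Suc m)" for m by (simp add: S_def)
  have S_pred: "S m = S (m - 1) + d m" for m by (cases m) (auto simp: S_def d_def)
  have d_nn: "0 \<le> d i" for i unfolding d_def using j AB_nonneg by (intro rec_d_nonneg) auto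
  have Sk: "S (k - j) \<ge> 1"
  proof -
    have "1 = (\<Sum>i\<in>{1}. d i)" by (simp add: d_def)
    also have "\<dots> \<le> S (k - j)" unfolding S_def using j d_nn by (intro sum_mono2) auto
    finally show ?thesis .
  qed
  \<comment> \<open>Truncated subtraction makes \<open>\<phi>\<close> vanish at and below
    \<open>j\<close>, and \<open>min\<close> makes it 1 from \<open>k\<close> on.\<close>
  define \<phi> where "\<phi> n = S (min n k - j) / S (k - j)" for n
  have "X.hit j k = \<phi> (j + 1)"
  proof (rule X.prob_reaches_eq_harmonic)
    fix n assume n: "j + 1 \<le> n" "n < k"
    define i where "i = n - j - 1"
    have ni: "n = j + Suc i" using n by (simp add: i_def)
    have n2: "2 \<le> n" using n j by simp
    have e1: "min n k - j = Suc i" "min (n + 1) k - j = Suc (Suc i)" "min (n - 1) k - j = i" "min (n - 2) k - j = i - 1"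
      using n j by (auto simp: ni)
    have dd: "d (Suc (Suc i)) = A n * d (Suc i) + B n * d i" by (simp add: d_def ni)
    have s2: "S (Suc (Suc i)) = S (Suc i) + (A n * d (Suc i) + B n * d i)" by (simp only: S_Suc[of "Suc i"] dd)
    have s0: "S i = S (Suc i) - d (Suc i)" using S_Suc[of i] by simp
    have sm: "S (i - 1) = S (Suc i) - d (Suc i) - d i" using S_pred[of i] s0 by simp
    have "q n * S (Suc (Suc i)) + p1 n * S i + p2 n * S (i - 1) =
        (q n + p1 n + p2 n) * S (Suc i) + (q n * A n - (p1 n + p2 n)) * d (Suc i) + (q n * B n - p2 n) * d i"
      unfolding s2 s0 sm by (simp add: algebra_simps)
    also have "\<dots> = S (Suc i)" using qA[OF n2] qB[OF n2] probs[OF n2] by simp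
    finally have "S (Suc i) = q n * S (Suc (Suc i)) + p1 n * S i + p2 n * S (i - 1)" ..
    then show "\<phi> n = (\<Sum>y\<le>n + 2. pmf (KX n) y * \<phi> y)"
      unfolding sum_KX[OF n2] \<phi>_def e1 by (simp add: add_divide_distrib)
  next
    show "\<phi> n = 0" if "n < j + 1" for n using that j by (simp add: \<phi>_def S_def)
    show "\<phi> n = 1" if "k \<le> n" for n using that Sk by (simp add: \<phi>_def)
  qed (use j in simp)
  also have "\<dots> = 1 / S (k - j)" using j by (simp add: \<phi>_def S_def d_def)
  finally show ?thesis by (simp add: S_def d_def)
qed

text \<open>For the (1,2) walk the increment below \<open>n\<close> is expressed by the two above
  it, so the recursion runs downwards from \<open>k\<close>, above which the function is constant.
  The scale is fixed at the top, hence the increment at \<open>j\<close> remains in the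
  numerator.\<close>

lemma Y_reaches:
  assumes j: "2 \<le> j" "j < k"
    and pos: "0 < (\<Sum>m\<in>{j..<k}. dY k (k - m))"
  shows "Y.hit j k =
    dY k (k - j) /
      (\<Sum>m\<in>{j..<k}. dY k (k - m))"
proof -
  define d where "d = dY k"
  define h where "h n = (\<Sum>m\<in>{j..<n}. d (k - m))" for n
  have h_Suc: "h (Suc n) = h n + d (k - n)" if "j \<le> n" for n using that by (simp add: h_def)
  have hk: "h k > 0" using pos by (simp add: h_def d_def)
  \<comment> \<open>For \<open>m \<ge> k\<close> the index \<open>k - m\<close> is 0 and
    \<open>d 0 = 0\<close>, so \<open>h\<close> stops growing at \<open>k\<close>.\<close>
  have h_high: "h n = h k" if "k \<le> n" for n
    using that by (induction n rule: dec_induct) (use j h_Suc in \<open>auto simp: d_def\<close>)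
  define \<phi> where "\<phi> n = h n / h k" for n
  have "Y.hit j k = \<phi> (j + 1)"
  proof (rule Y.prob_reaches_eq_harmonic)
    fix n assume n: "j + 1 \<le> n" "n < k"
    define i where "i = k - n - 1"
    have n2: "2 \<le> n" using n j by simp
    have e1: "k - n = Suc i" "k - (n - 1) = Suc (Suc i)" "k - (n + 1) = i" "k - Suc i = n"
      using n j by (auto simp: i_def)
    have dd: "d (Suc (Suc i)) = A n * d (Suc i) + B n * d i" by (simp add: d_def e1)
    have s1: "h n = h (n - 1) + (A n * d (Suc i) + B n * d i)"
      using h_Suc[of "n - 1"] n e1 dd by simp
    have s2: "h (n + 1) = h n + d (Suc i)" using h_Suc[of n] n e1 by simp
    have s3: "h (n + 2) = h n + d (Suc i) + d i" using h_Suc[of "n + 1"] s2 n e1 by simp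
    have s0: "h (n - 1) = h n - (A n * d (Suc i) + B n * d i)" using s1 by simp
    have "q n * h (n - 1) + p1 n * h (n + 1) + p2 n * h (n + 2) =
        (q n + p1 n + p2 n) * h n - (q n * A n - (p1 n + p2 n)) * d (Suc i) - (q n * B n - p2 n) * d i"
      unfolding s2 s3 s0 by (simp add: algebra_simps)
    also have "\<dots> = h n" using qA[OF n2] qB[OF n2] probs[OF n2] by simp
    finally have "h n = q n * h (n - 1) + p1 n * h (n + 1) + p2 n * h (n + 2)" ..
    then show "\<phi> n = (\<Sum>y\<le>n + 2. pmf (KY n) y * \<phi> y)"
      unfolding sum_KY[OF n2] \<phi>_def by (simp add: add_divide_distrib)
  next
    show "\<phi> n = 0" if "n < j + 1" for n using that by (simp add: \<phi>_def h_def)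
    show "\<phi> n = 1" if "k \<le> n" for n unfolding \<phi>_def h_high[OF that] using hk by simp
  qed (use j in simp)
  also have "\<dots> = d (k - j) / h k" by (simp add: \<phi>_def h_def)
  finally show ?thesis by (simp add: h_def d_def)
qed

lemma X_reaches_bounds:
  assumes j: "K0 \<le> j" "j < k" and mono: "\<And>i. K0 \<le> i \<Longrightarrow> \<rho> i \<le> \<rho> (Suc i)"
  shows "X.hit j k * partial_D \<rho> j k \<le> 4 / a"
    and "1 / 4 \<le> X.hit j k * partial_D \<rho> j k"
proof -
  let ?d = "dX j" and ?P = "\<lambda>i. \<Prod>l\<in>{1..<i}. \<rho> (j + l)"
  have b: "a / 4 * ?P i \<le> ?d i" "?d i \<le> 4 * ?P i" if "i \<in> {1..k - j}" for i
    using rec_d_rho_bounds[of "k - j" "\<lambda>i. j + i" i] that j mono by auto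
  have D: "partial_D \<rho> j k = (\<Sum>i\<in>{1..k - j}. ?P i)"
  proof -
    have "(\<Sum>i\<in>{1..k - j}. ?P i) = (\<Sum>i\<in>{j..<k}. ?P (i + 1 - j))"
      by (rule sum.reindex_bij_witness[of _ "\<lambda>i. i + 1 - j" "\<lambda>i. j + i - 1"]) auto
    also have "\<dots> = partial_D \<rho> j k"
      unfolding partial_D_def
    proof (rule sum.cong[OF refl])
      fix i assume "i \<in> {j..<k}"
      then show "?P (i + 1 - j) = (\<Prod>l\<in>{j + 1..i}. \<rho> l)"
        by (intro prod.reindex_bij_witness[of _ "\<lambda>l. l - j" "\<lambda>l. j + l"]) auto
    qed
    finally show ?thesis ..
  qed
  have P0: "0 < ?P i" for i using j by (intro prod_pos rho_pos) simp
  have Dpos: "0 < partial_D \<rho> j k" unfolding D using j P0 by (intro sum_pos) auto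
  have lo: "a / 4 * partial_D \<rho> j k \<le> (\<Sum>i\<in>{1..k - j}. ?d i)"
    unfolding D sum_distrib_left by (intro sum_mono b)
  have hi: "(\<Sum>i\<in>{1..k - j}. ?d i) \<le> 4 * partial_D \<rho> j k"
    unfolding D sum_distrib_left by (intro sum_mono b)
  have "0 < a / 4 * partial_D \<rho> j k" using ab Dpos by simp
  then have pos: "0 < (\<Sum>i\<in>{1..k - j}. ?d i)" using lo by linarith
  have eq: "X.hit j k = 1 / (\<Sum>i\<in>{1..k - j}. ?d i)"
    using j K0 by (intro X_reaches) auto
  show "X.hit j k * partial_D \<rho> j k \<le> 4 / a"
    unfolding eq using lo pos ab by (simp add: field_simps)
  show "1 / 4 \<le> X.hit j k * partial_D \<rho> j k"
    unfolding eq using hi pos by (simp add: field_simps)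
qed

text \<open>\<open>T m / T j\<close> is the product of the inverse ratios from \<open>j + 1\<close>
  to \<open>m\<close>, so dividing the sum of the \<open>T m\<close> by \<open>T j\<close> produces
  \<open>partial_D\<close> for the inverse ratios. Numerator and denominator are each known up to
  the factors \<open>a / 4\<close> and 4, which gives \<open>16 / a\<close> and
  \<open>a / 16\<close>.\<close>

lemma Y_reaches_bounds:
  assumes j: "K0 \<le> j" "j < k" and mono: "\<And>i. K0 \<le> i \<Longrightarrow> \<rho> (Suc i) \<le> \<rho> i"
  shows "Y.hit j k * partial_D (\<lambda>i. inverse (\<rho> i)) j k \<le> 16 / a"
    and "a / 16 \<le> Y.hit j k * partial_D (\<lambda>i. inverse (\<rho> i)) j k"
proof -
  let ?d = "dY k" and ?P = "\<lambda>i. \<Prod>l\<in>{1..<i}. \<rho> (k - l)"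
  define T where "T m = (\<Prod>t\<in>{m + 1..<k}. \<rho> t)" for m
  let ?D = "partial_D (\<lambda>i. inverse (\<rho> i)) j k"
  have PT: "?P (k - m) = T m" if "m \<in> {j..<k}" for m
    unfolding T_def using that by (intro prod.reindex_bij_witness[of _ "\<lambda>l. k - l" "\<lambda>l. k - l"]) auto
  have T0: "0 < T m" if "j \<le> m" for m
    unfolding T_def using that j by (intro prod_pos rho_pos) auto
  have b: "a / 4 * T m \<le> ?d (k - m)" "?d (k - m) \<le> 4 * T m" if m: "m \<in> {j..<k}" for m
  proof -
    have "\<rho> (k - i) \<le> \<rho> (k - Suc i)" if "1 \<le> i" "i < k - j" for i
      using mono[of "k - Suc i"] that j by (simp add: Suc_diff_Suc)
    then show "a / 4 * T m \<le> ?d (k - m)" "?d (k - m) \<le> 4 * T m"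
      using rec_d_rho_bounds[of "k - j" "\<lambda>i. k - i" "k - m"] PT[OF m] m j by auto
  qed
  have T_split: "T j * (\<Prod>l\<in>{j + 1..m}. inverse (\<rho> l)) = T m" if m: "m \<in> {j..<k}" for m
  proof -
    have "{j + 1..<k} = {j + 1..m} \<union> {m + 1..<k}" using m by auto
    then have "T j = (\<Prod>l\<in>{j + 1..m} \<union> {m + 1..<k}. \<rho> l)" by (simp add: T_def)
    also have "\<dots> = (\<Prod>l\<in>{j + 1..m}. \<rho> l) * T m"
      unfolding T_def by (rule prod.union_disjoint) auto
    finally have e: "T j = (\<Prod>l\<in>{j + 1..m}. \<rho> l) * T m" .
    have "0 < (\<Prod>l\<in>{j + 1..m}. \<rho> l)" using j by (intro prod_pos rho_pos) auto
    then have "(\<Prod>l\<in>{j + 1..m}. \<rho> l) \<noteq> 0" by (rule less_imp_neq[symmetric])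
    then show ?thesis unfolding e prod_inversef[unfolded comp_def] by simp
  qed
  have D: "T j * ?D = (\<Sum>m\<in>{j..<k}. T m)"
    unfolding partial_D_def sum_distrib_left by (intro sum.cong refl T_split)
  have Sum0: "0 < (\<Sum>m\<in>{j..<k}. T m)" using j T0 by (intro sum_pos) auto
  have Tj: "0 < T j" using T0 by simp
  have Dpos: "0 < ?D" using Sum0 Tj unfolding D[symmetric] by (simp add: zero_less_mult_iff)
  define S where "S = (\<Sum>m\<in>{j..<k}. ?d (k - m))"
  have lo: "a / 4 * (T j * ?D) \<le> S"
    unfolding D S_def sum_distrib_left by (intro sum_mono b)
  have hi: "S \<le> 4 * (T j * ?D)"
    unfolding D S_def sum_distrib_left by (intro sum_mono b)
  have "0 < a / 4 * (T j * ?D)" using ab Dpos Tj by simp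
  then have pos: "0 < S" using lo by linarith
  have eq: "Y.hit j k = ?d (k - j) / S"
    unfolding S_def using j K0 pos by (intro Y_reaches) (auto simp: S_def)
  have dj: "a / 4 * T j \<le> ?d (k - j)" "?d (k - j) \<le> 4 * T j" using b[of j] j by auto
  have "?d (k - j) * ?D \<le> 4 * T j * ?D" using dj Dpos by (intro mult_right_mono) auto
  also have "\<dots> = 16 / a * (a / 4 * (T j * ?D))" using ab by simp
  also have "\<dots> \<le> 16 / a * S" using lo ab by (intro mult_left_mono) auto
  finally show "Y.hit j k * ?D \<le> 16 / a"
    unfolding eq using pos by (simp add: field_simps)
  have "a / 16 * S \<le> a / 16 * (4 * (T j * ?D))" using hi ab by (intro mult_left_mono) auto
  also have "\<dots> = a / 4 * T j * ?D" by simp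
  also have "\<dots> \<le> ?d (k - j) * ?D" using dj Dpos by (intro mult_right_mono) auto
  finally show "a / 16 \<le> Y.hit j k * ?D"
    unfolding eq using pos by (simp add: field_simps)
qed

end

section \<open>Estimates for the two walks\<close>

lemma reaches_mono: "T \<subseteq> T' \<Longrightarrow> reaches lo k T w \<Longrightarrow> reaches lo k T' w"
  unfolding reaches_def by blast

context walk_bounds
begin

lemma X_path: "AE w in path_law KX x. w 0 = x \<and> (\<forall>i. w (Suc i) \<le> w i + 1) \<and> (\<forall>N. \<exists>n. N < w n)"
  using AE_path_start[of x KX] AE_path_steps[of KX x] X.AE_unbounded[of x]
  by eventually_elim (use set_KX in blast)

lemma Y_path: "AE w in path_law KY x. w 0 = x \<and> (\<forall>i. w (Suc i) \<le> w i + 2 \<and> w i \<le> w (Suc i) + 1) \<and>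
    (\<forall>N. \<exists>n. N < w n)"
  using AE_path_start[of x KY] AE_path_steps[of KY x] Y.AE_unbounded[of x]
  by eventually_elim (use set_KY in blast)

lemma X_first_step:
  assumes "2 \<le> j" "path_pred R"
  shows "X.Pr j (\<lambda>w. w 1 = j + 1 \<and> R (path_shift 1 w)) = q j * X.Pr (j + 1) R"
  using prob_first_step[OF assms(2), of KX j "j + 1"] assms(1)
  by (simp add: pmf_kernel21 trans21_def del: path_shift_apply)

text \<open>The only way up from \<open>j\<close> is the step to \<open>j + 1\<close>, taken with
  probability \<open>q j\<close>; the remaining path must then never return to
  \<open>j\<close>.\<close>

lemma X_escape_prob:
  assumes "2 \<le> j"
  shows "escape_prob KX 0 j = q j * X.Pr (j + 1) (\<lambda>w. \<forall>m. j + 1 \<le> w m)"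
proof -
  have "escape_prob KX 0 j = X.Pr j (\<lambda>w. w 1 = j + 1 \<and> (\<lambda>w. \<forall>m. j + 1 \<le> w m) (path_shift 1 w))"
    unfolding escape_prob_def add_0_right
  proof (rule prob_cong_AE)
    show "AE w in path_law KX j. above j w \<longleftrightarrow> w 1 = j + 1 \<and> (\<forall>m. j + 1 \<le> path_shift 1 w m)"
      using X_path[of j]
    proof eventually_elim
      case (elim w)
      then have w1: "w 1 \<le> j + 1" using elim by (metis One_nat_def)
      show ?case
      proof
        assume s: "above j w"
        then have "w 1 > j" by (simp add: above_def)
        then have "w 1 = j + 1" using w1 by linarith
        moreover have "\<forall>m. j + 1 \<le> path_shift 1 w m" using s by (auto simp: above_def Suc_le_eq)
        ultimately show "w 1 = j + 1 \<and> (\<forall>m. j + 1 \<le> path_shift 1 w m)" ..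
      next
        assume s: "w 1 = j + 1 \<and> (\<forall>m. j + 1 \<le> path_shift 1 w m)"
        show "above j w" unfolding above_def
        proof (intro allI impI)
          fix m :: nat assume "0 < m"
          then have "j + 1 \<le> path_shift 1 w (m - 1)" using s by blast
          then show "j < w m" using \<open>0 < m\<close> by simp
        qed
      qed
    qed
  qed measurable
  also have "\<dots> = q j * X.Pr (j + 1) (\<lambda>w. \<forall>m. j + 1 \<le> w m)"
    by (rule X_first_step[OF assms]) measurable
  finally show ?thesis .
qed

text \<open>Since upward steps have size one, \<open>{k..}\<close> can be entered from below only at
  \<open>k\<close>, so upward exit alone determines the entry point.\<close>

lemma X_link_prob:
  assumes j: "2 \<le> j" "j < k"
  shows "link_prob KX 0 j k = q j * X.hit j k"
proof -
  have "link_prob KX 0 j k = X.Pr j (\<lambda>w. w 1 = j + 1 \<and> reaches (j + 1) k {k..} (path_shift 1 w))"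
    unfolding link_prob_def add_0_right
  proof (rule prob_cong_AE)
    show "AE w in path_law KX j. links 0 j k w \<longleftrightarrow> w 1 = j + 1 \<and> reaches (j + 1) k {k..} (path_shift 1 w)"
      using X_path[of j]
    proof eventually_elim
      case (elim w)
      then have w0: "w 0 = j" and step: "\<And>i. w (Suc i) \<le> w i + 1" by auto
      have w1: "w 1 \<le> j + 1" using step[of 0] w0 by simp
      show ?case
      proof
        assume "links 0 j k w"
        then obtain n where n: "n > 0" "\<forall>i<n. w i < k" "w n = k" "\<forall>i. 0 < i \<and> i < n \<longrightarrow> j < w i"
          by (auto simp: links_def)
        have "j < w 1" using n j by (cases "n = 1") auto
        then have "w 1 = j + 1" using w1 by simp
        moreover have "reaches (j + 1) k {k..} (path_shift 1 w)"
          unfolding reaches_def using n by (intro exI[of _ "n - 1"]) (auto simp: Suc_le_eq)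
        ultimately show "w 1 = j + 1 \<and> reaches (j + 1) k {k..} (path_shift 1 w)" ..
      next
        assume "w 1 = j + 1 \<and> reaches (j + 1) k {k..} (path_shift 1 w)"
        then obtain n where w1: "w 1 = j + 1" and n: "\<forall>i<n. j + 1 \<le> w (Suc i) \<and> w (Suc i) < k" "k \<le> w (Suc n)"
          by (auto simp: reaches_def)
        have "w n < k" using n(1) w0 j by (cases n) auto
        then have "w (Suc n) = k" using step[of n] n(2) by simp
        moreover have "w i < k" if "i < Suc n" for i using that n(1) w0 j by (cases i) auto
        moreover have "j < w i" if "0 < i \<and> i < Suc n" for i using that n(1) by (cases i) (auto simp: Suc_le_eq)
        ultimately show "links 0 j k w" unfolding links_def by (intro exI[of _ "Suc n"]) auto
      qed
    qed
  qed measurable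
  also have "\<dots> = q j * X.hit j k"
    by (rule X_first_step[OF j(1)]) measurable
  finally show ?thesis .
qed

lemma X_entry_prob: "x < k \<Longrightarrow> entry_prob KX 0 x k = 1"
proof -
  assume x: "x < k"
  have "entry_prob KX 0 x k = X.Pr x (\<lambda>w. True)"
    unfolding entry_prob_def
  proof (rule prob_cong_AE)
    show "AE w in path_law KX x. (\<exists>n. enters 0 k n w) \<longleftrightarrow> True"
      using X_path[of x]
    proof eventually_elim
      case (elim w)
      obtain m' where "k \<le> w m'" using elim less_imp_le by blast
      then obtain n where kn: "k \<le> w n" and below: "\<And>i. i < n \<Longrightarrow> w i < k" using first_passage[of _ w] by blast
      obtain m where m: "n = Suc m" using kn elim x by (cases n) auto
      have "w m < k" using below[of m] m by simp
      moreover have "w n \<le> w m + 1" using elim m by simp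
      ultimately have "w n = k" using kn by linarith
      then have "enters 0 k n w" using below by (simp add: enters_def)
      then show ?case by blast
    qed
  next
    show "path_pred (\<lambda>w. \<exists>n. enters 0 k n w)" unfolding enters_def by measurable
  qed simp
  then show ?thesis by (simp add: measure_path_law_UNIV)
qed

text \<open>The constant 1/12 is 1/3 times 1/4: the first step up has probability at least 1/3, and
  the exit estimate supplies 1/4.\<close>

lemma X_cut_estimates:
  assumes mono: "\<And>i. K0 \<le> i \<Longrightarrow> \<rho> i \<le> \<rho> (Suc i)" and le1: "\<And>i. K0 \<le> i \<Longrightarrow> \<rho> i \<le> 1"
  shows "cut_estimates \<rho> K0 KX 0 (1 / 12) (4 / a)"
proof -
  have r: "0 < \<rho> k \<and> \<rho> k \<le> 1" if "K0 \<le> k" for k using rho_bounds[OF that] le1[OF that] by auto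
  interpret ratio_sequence \<rho> K0 by unfold_locales (use r in auto)
  note bounds = X_reaches_bounds[OF _ _ mono]
  have q: "1 / 3 \<le> q k" "q k \<le> 1" "0 < q k" if "K0 \<le> k" for k
    using q_ge[OF that] probs[of k] K0 that by auto
  show ?thesis
  proof
    show "1 / 12 \<le> entry_prob KX 0 x k" if "x + 4 \<le> k" for x k
      using that by (simp add: X_entry_prob)
    show "escape_prob KX 0 k * partial_D \<rho> k l \<le> 4 / a" if kl: "K0 \<le> k" "k < l" for k l
    proof -
      have D: "0 \<le> partial_D \<rho> k l" using partial_D_ge_1[OF kl] by simp
      have "escape_prob KX 0 k = q k * X.Pr (k + 1) (\<lambda>w. \<forall>m. k + 1 \<le> w m)"
        using kl K0 by (intro X_escape_prob) simp
      also have "\<dots> \<le> 1 * X.hit k l"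
        using q[OF kl(1)] by (intro mult_mono X.prob_stay_le_reaches) auto
      finally have "escape_prob KX 0 k * partial_D \<rho> k l \<le> X.hit k l * partial_D \<rho> k l"
        using D by (intro mult_right_mono) auto
      also have "\<dots> \<le> 4 / a" using bounds(1)[OF kl] by simp
      finally show ?thesis .
    qed
    show "1 / 12 \<le> escape_prob KX 0 k * d" if k: "K0 \<le> k" and d: "\<And>l. k < l \<Longrightarrow> partial_D \<rho> k l \<le> d" for k d
    proof -
      have d1: "1 \<le> d" using d[of "k + 1"] partial_D_ge_1[OF k, of "k + 1"] by simp
      have "1 / (4 * d) \<le> X.Pr (k + 1) (\<lambda>w. \<forall>m. k + 1 \<le> w m)"
      proof (rule X.prob_stay_ge[of _ "k + 1"])
        fix l assume "k + 1 < l"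
        then have kl: "k < l" by simp
        have D: "0 < partial_D \<rho> k l" "partial_D \<rho> k l \<le> d" using partial_D_ge_1[OF k kl] d[OF kl] by auto
        have "1 / (4 * d) \<le> 1 / (4 * partial_D \<rho> k l)"
          using D d1 by (intro divide_left_mono) auto
        also have "\<dots> \<le> X.hit k l"
          using bounds(2)[OF k kl] D by (simp add: field_simps)
        finally show "1 / (4 * d) \<le> X.hit k l" .
      qed simp
      then have "1 / 3 * (1 / (4 * d)) \<le> q k * X.Pr (k + 1) (\<lambda>w. \<forall>m. k + 1 \<le> w m)"
        using q[OF k] d1 by (intro mult_mono) auto
      also have "\<dots> = escape_prob KX 0 k" using k K0 by (subst X_escape_prob) auto
      finally show ?thesis using d1 by (simp add: field_simps)
    qed
    show "link_prob KX 0 j k * partial_D \<rho> j k \<le> 4 / a" if jk: "K0 \<le> j" "j < k" for j k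
    proof -
      have D: "0 \<le> partial_D \<rho> j k" using partial_D_ge_1[OF jk] by simp
      have "link_prob KX 0 j k = q j * X.hit j k"
        using jk K0 by (intro X_link_prob) auto
      also have "\<dots> \<le> 1 * X.hit j k"
        using q[OF jk(1)] by (intro mult_right_mono) auto
      finally have "link_prob KX 0 j k * partial_D \<rho> j k \<le> X.hit j k * partial_D \<rho> j k"
        using D by (intro mult_right_mono) auto
      also have "\<dots> \<le> 4 / a" using bounds(1)[OF jk] by simp
      finally show ?thesis .
    qed
    show "1 / 12 \<le> link_prob KX 0 j k * partial_D \<rho> j k" if "K0 \<le> j" "j + 4 \<le> k" for j k
    proof -
      have jk: "K0 \<le> j" "j < k" using that by auto
      have "1 / 3 * (1 / 4) \<le> q j * (X.hit j k * partial_D \<rho> j k)"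
        using q[OF jk(1)] bounds(2)[OF jk] by (intro mult_mono) auto
      then show ?thesis using jk K0 by (subst X_link_prob) (auto simp: mult.assoc)
    qed
  qed (use ab in auto)
qed

text \<open>On reaching \<open>{k - 2..}\<close> from below the walk is at \<open>t = k - 2\<close>
  or at \<open>t + 1\<close>. From either place a fixed short route below \<open>k\<close> ends at
  \<open>k + 1 = t + 3\<close>: a direct jump from \<open>t + 1\<close>, or the route
  \<open>t\<close>, \<open>t - 1\<close>, \<open>t + 1\<close>, \<open>t + 3\<close>. The detour
  through \<open>t - 1\<close> uses only steps of probability \<open>q\<close> or \<open>p2\<close>,
  because \<open>p1\<close> may vanish; it has probability at least
  \<open>1 / 3 * (b / 6)\<^sup>2 = b\<^sup>2 / 108\<close>.\<close>

lemma Y_overshoot: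
  assumes lo: "lo + 3 \<le> k" and k: "K0 + 3 \<le> k" and x: "x + 3 \<le> k"
  shows "b\<^sup>2 / 108 * Y.Pr x (reaches lo (k - 2) {k - 2..}) \<le> Y.Pr x (reaches lo k {k + 1})"
proof -
  interpret prob_space "path_law KY x" by (rule prob_space_path_law)
  define t where "t = k - 2"
  have kt: "k = t + 2" and t: "lo + 1 \<le> t" "K0 + 1 \<le> t" "x < t" using assms by (auto simp: t_def)
  define R where "R y n w \<longleftrightarrow> (\<forall>i<n. lo \<le> w i \<and> w i < t) \<and> w n = y" for y n and w :: "nat \<Rightarrow> nat"
  define v0 where "v0 i = [t, t - 1, t + 1, t + 3] ! i" for i
  define v1 where "v1 i = [t + 1, t + 3] ! i" for i
  define B0 where "B0 w \<longleftrightarrow> (\<forall>i\<le>3. w i = v0 i)" for w :: "nat \<Rightarrow> nat"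
  define B1 where "B1 w \<longleftrightarrow> (\<forall>i\<le>1. w i = v1 i)" for w :: "nat \<Rightarrow> nat"
  let ?P0 = "Y.Pr x (\<lambda>w. \<exists>n. R t n w)" and ?P1 = "Y.Pr x (\<lambda>w. \<exists>n. R (t + 1) n w)"
  let ?E0 = "{w. \<exists>n. R t n w \<and> B0 (path_shift n w)}" and ?E1 = "{w. \<exists>n. R (t + 1) n w \<and> B1 (path_shift n w)}"
  have B_meas [measurable]: "path_pred B0" "path_pred B1"
    unfolding B0_def B1_def by measurable
  have R_meas [measurable]: "path_pred (R y n)" for y n
    unfolding R_def by measurable
  have adR: "adapted n (R y n)" for y n unfolding adapted_def R_def by auto
  have uniq: "n = m" if "R y n w" "R z m w" "t \<le> y" "t \<le> z" for y z n m w
    using that unfolding R_def by (metis leD linorder_neqE_nat)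
  have SM: "Y.Pr x (\<lambda>w. \<exists>n. R y n w \<and> C (path_shift n w)) = Y.Pr x (\<lambda>w. \<exists>n. R y n w) * Y.Pr y C"
    if y: "t \<le> y" and "path_pred C" for y C
  proof (rule strong_markov)
    show "adapted n (R y n)" for n by (rule adR)
    show "w n = y" if "R y n w" for n w using that by (simp add: R_def)
    show "n = m" if "R y n w" "R y m w" for n m w using that y uniq by blast
  qed fact
  have q: "1 / 3 \<le> q t" and p: "b / 6 \<le> p2 (t - 1)" "b / 6 \<le> p2 (t + 1)"
    using q_ge[of t] p2_ge[of "t - 1"] p2_ge[of "t + 1"] t by auto
  have cyl: "Y.Pr y (\<lambda>w. \<forall>i\<le>n. w i = v i) = (\<Prod>i<n. pmf (KY (v i)) (v (Suc i)))" if "v 0 = y" for y n v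
    using emeasure_path_law_cylinder[of KY y n v] that by (simp add: measure_def prod_nonneg)
  have P0: "b\<^sup>2 / 108 \<le> Y.Pr t B0"
  proof -
    have t2: "2 \<le> t - 1" "2 \<le> t" using t K0 by auto
    have "Y.Pr t B0 = (\<Prod>i<3. pmf (KY (v0 i)) (v0 (Suc i)))"
      unfolding B0_def by (rule cyl) (simp add: v0_def)
    also have "\<dots> = pmf (KY t) (t - 1) * pmf (KY (t - 1)) (t + 1) * pmf (KY (t + 1)) (t + 3)"
      by (simp add: v0_def numeral_3_eq_3 lessThan_Suc)
    also have "\<dots> = q t * p2 (t - 1) * p2 (t + 1)"
      using t2 by (auto simp: pmf_kernel12 trans12_def)
    also have "\<dots> \<ge> 1 / 3 * (b / 6) * (b / 6)"
      using q p ab by (intro mult_mono) auto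
    finally show ?thesis by (simp add: power2_eq_square)
  qed
  have P1: "b\<^sup>2 / 108 \<le> Y.Pr (t + 1) B1"
  proof -
    have "Y.Pr (t + 1) B1 = (\<Prod>i<1. pmf (KY (v1 i)) (v1 (Suc i)))"
      unfolding B1_def by (rule cyl) (simp add: v1_def)
    also have "\<dots> = p2 (t + 1)"
      using t K0 by (auto simp: v1_def pmf_kernel12 trans12_def)
    also have "\<dots> \<ge> b / 6" by (rule p)
    finally have "b / 6 \<le> Y.Pr (t + 1) B1" .
    moreover have "b\<^sup>2 / 108 \<le> b / 6"
    proof -
      have "b * b \<le> b * 1" using ab by (intro mult_left_mono) auto
      then show ?thesis using ab by (simp add: power2_eq_square)
    qed
    ultimately show ?thesis by simp
  qed
  have "Y.Pr x (reaches lo t {t..}) \<le> prob ({w. \<exists>n. R t n w} \<union> {w. \<exists>n. R (t + 1) n w})"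
  proof -
    have "Y.Pr x (reaches lo t {t..}) \<le> Y.Pr x (\<lambda>w. (\<exists>n. R t n w) \<or> (\<exists>n. R (t + 1) n w))"
    proof (rule prob_mono_AE)
      show "AE w in path_law KY x. reaches lo t {t..} w \<longrightarrow> (\<exists>n. R t n w) \<or> (\<exists>n. R (t + 1) n w)"
        using Y_path[of x]
      proof eventually_elim
        case (elim w)
        show ?case
        proof
          assume "reaches lo t {t..} w"
          then obtain n where n: "\<forall>i<n. lo \<le> w i \<and> w i < t" "t \<le> w n" by (auto simp: reaches_def)
          obtain m where m: "n = Suc m" using n elim t by (cases n) auto
          have "w m < t" using n m by simp
          moreover have "w n \<le> w m + 2" using elim m by simp
          ultimately have "w n = t \<or> w n = t + 1" using n(2) by linarith
          then have "R t n w \<or> R (t + 1) n w" using n(1) unfolding R_def by blast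
          then show "(\<exists>n. R t n w) \<or> (\<exists>n. R (t + 1) n w)" by blast
        qed
      qed
    qed measurable
    also have "{w. (\<exists>n. R t n w) \<or> (\<exists>n. R (t + 1) n w)} = {w. \<exists>n. R t n w} \<union> {w. \<exists>n. R (t + 1) n w}"
      by blast
    finally show ?thesis .
  qed
  also have "\<dots> \<le> ?P0 + ?P1"
    by (intro measure_Un_le) (auto intro!: sets_path)
  finally have "b\<^sup>2 / 108 * Y.Pr x (reaches lo t {t..}) \<le>
      b\<^sup>2 / 108 * (?P0 + ?P1)"
    by (intro mult_left_mono) auto
  also have "\<dots> \<le> ?P0 * Y.Pr t B0 + ?P1 * Y.Pr (t + 1) B1"
    unfolding distrib_left mult.commute[of "b\<^sup>2 / 108"]
    by (intro add_mono mult_left_mono P0 P1 measure_nonneg)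
  also have "\<dots> = Y.Pr x (\<lambda>w. \<exists>n. R t n w \<and> B0 (path_shift n w)) +
      Y.Pr x (\<lambda>w. \<exists>n. R (t + 1) n w \<and> B1 (path_shift n w))"
    by (subst (1 2) SM) auto
  also have "\<dots> = prob (?E0 \<union> ?E1)"
  proof (rule finite_measure_Union[symmetric])
    show "?E0 \<in> events" "?E1 \<in> events"
      by (auto intro!: sets_path simp del: path_shift_apply)
    have False if "R t n w" "R (t + 1) m w" for n m w
    proof -
      have "n = m" using uniq[OF that] by simp
      then show False using that unfolding R_def by simp
    qed
    then show "?E0 \<inter> ?E1 = {}"
      by blast
  qed
  also have "\<dots> \<le> Y.Pr x (reaches lo k {k + 1})"
  proof (rule finite_measure_mono)
    show "?E0 \<union> ?E1 \<subseteq>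
        {w. reaches lo k {k + 1} w}"
    proof safe
      fix w n assume R: "R t n w" and "B0 (path_shift n w)"
      then have w: "w (n + i) = v0 i" if "i \<le> 3" for i using that by (simp add: B0_def)
      have "lo \<le> w i \<and> w i < k" if "i < n + 3" for i
      proof (cases "i < n")
        case True
        then show ?thesis using R by (auto simp: R_def kt)
      next
        case False
        then have "i - n = 0 \<or> i - n = 1 \<or> i - n = 2" using that by auto
        then have "v0 (i - n) = t \<or> v0 (i - n) = t - 1 \<or> v0 (i - n) = t + 1" by (auto simp: v0_def)
        moreover have "w i = v0 (i - n)" using w[of "i - n"] False that by simp
        ultimately show ?thesis using t by (auto simp: kt)
      qed
      moreover have "w (n + 3) = k + 1" using w[of 3] by (simp add: v0_def kt)
      ultimately show "reaches lo k {k + 1} w" unfolding reaches_def by blast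
    next
      fix w n assume R: "R (t + 1) n w" and "B1 (path_shift n w)"
      then have w: "w (n + i) = v1 i" if "i \<le> 1" for i using that by (simp add: B1_def)
      have "lo \<le> w i \<and> w i < k" if "i < n + 1" for i
      proof (cases "i < n")
        case True
        then show ?thesis using R by (auto simp: R_def kt)
      next
        case False
        then have "i = n" using that by simp
        then have "w i = t + 1" using w[of 0] by (simp add: v1_def)
        then show ?thesis using t by (auto simp: kt)
      qed
      moreover have "w (n + 1) = k + 1" using w[of 1] by (simp add: v1_def kt)
      ultimately show "reaches lo k {k + 1} w" unfolding reaches_def by blast
    qed
  qed (auto intro!: sets_path)
  finally show ?thesis by (simp add: t_def)
qed

lemma Y_escape_prob: "escape_prob KY 1 j = Y.Pr (j + 1) (\<lambda>w. \<forall>m. j + 1 \<le> w m)"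
  unfolding escape_prob_def
proof (rule prob_cong_AE)
  show "AE w in path_law KY (j + 1). above j w \<longleftrightarrow> (\<forall>m. j + 1 \<le> w m)"
    using Y_path[of "j + 1"]
  proof eventually_elim
    case (elim w)
    then have w0: "w 0 = j + 1" by simp
    show ?case
    proof
      assume s: "above j w"
      show "\<forall>m. j + 1 \<le> w m"
      proof
        fix m show "j + 1 \<le> w m" using s w0 by (cases m) (auto simp: above_def Suc_le_eq)
      qed
    qed (auto simp: above_def Suc_le_eq)
  qed
qed measurable

lemma Y_link_prob:
  assumes "j < k"
  shows "link_prob KY 1 j k = Y.Pr (j + 1) (reaches (j + 1) k {k + 1})"
  unfolding link_prob_def
proof (rule prob_cong_AE)
  show "AE w in path_law KY (j + 1). links 1 j k w \<longleftrightarrow> reaches (j + 1) k {k + 1} w"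
    using Y_path[of "j + 1"]
  proof eventually_elim
    case (elim w)
    then have w0: "w 0 = j + 1" by simp
    show ?case
    proof
      assume "links 1 j k w"
      then obtain n where n: "n > 0" "\<forall>i<n. w i < k" "w n = k + 1" "\<forall>i. 0 < i \<and> i < n \<longrightarrow> j < w i"
        by (auto simp: links_def)
      have "j + 1 \<le> w i" if "i < n" for i using that n w0 by (cases i) (auto simp: Suc_le_eq)
      then show "reaches (j + 1) k {k + 1} w" unfolding reaches_def using n by blast
    next
      assume "reaches (j + 1) k {k + 1} w"
      then obtain n where n: "\<forall>i<n. j + 1 \<le> w i \<and> w i < k" "w n = k + 1" by (auto simp: reaches_def)
      have "n > 0" using n w0 assms by (cases n) auto
      then show "links 1 j k w" unfolding links_def using n by (intro exI[of _ n]) (auto simp: Suc_le_eq)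
    qed
  qed
qed measurable

text \<open>The factor \<open>b\<^sup>2 / 108\<close> is the price for prescribing the entry point
  through \<open>Y_overshoot\<close>, which also causes the shift to \<open>K0 + 3\<close>;
  \<open>a / 16\<close> comes from the exit estimate.\<close>

lemma Y_cut_estimates:
  assumes mono: "\<And>i. K0 \<le> i \<Longrightarrow> \<rho> (Suc i) \<le> \<rho> i" and ge1: "\<And>i. K0 \<le> i \<Longrightarrow> 1 \<le> \<rho> i"
  shows "cut_estimates (\<lambda>i. inverse (\<rho> i)) (K0 + 3) KY 1 (b\<^sup>2 / 108 * (a / 16)) (16 / a)"
proof -
  let ?r = "\<lambda>i. inverse (\<rho> i)"
  have r: "0 < ?r k \<and> ?r k \<le> 1" if "K0 \<le> k" for k
    using ge1[OF that] by (auto simp: field_simps)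
  interpret ratio_sequence ?r "K0 + 3" by unfold_locales (use r in auto)
  note bounds = Y_reaches_bounds[OF _ _ mono]
  define \<kappa> where "\<kappa> = b\<^sup>2 / 108"
  have \<kappa>: "0 < \<kappa>" "\<kappa> \<le> 1" using ab power_le_one[of b 2] by (auto simp: \<kappa>_def)
  show ?thesis
    unfolding \<kappa>_def[symmetric]
  proof
    show "\<kappa> * (a / 16) > 0" "16 / a > 0" using \<kappa> ab by auto
    show "\<kappa> * (a / 16) \<le> entry_prob KY 1 x k" if "K0 + 3 \<le> k" "x + 4 \<le> k" for x k
    proof -
      \<comment> \<open>The barrier 0 imposes nothing, so upward exit is almost sure.\<close>
      have "Y.Pr x (reaches 0 (k - 2) {k - 2..}) \<ge> Y.Pr x (\<lambda>w. \<forall>m. 0 \<le> w m)"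
        by (rule Y.prob_stay_le_reaches)
      then have 1: "Y.Pr x (reaches 0 (k - 2) {k - 2..}) \<ge> 1" by (simp add: measure_path_law_UNIV)
      have "entry_prob KY 1 x k = Y.Pr x (reaches 0 k {k + 1})"
        unfolding entry_prob_def reaches_def enters_def by simp
      also have "\<dots> \<ge> \<kappa> * Y.Pr x (reaches 0 (k - 2) {k - 2..})"
        unfolding \<kappa>_def using that by (intro Y_overshoot) auto
      finally have "\<kappa> * Y.Pr x (reaches 0 (k - 2) {k - 2..}) \<le> entry_prob KY 1 x k" .
      moreover have "\<kappa> * (a / 16) \<le> \<kappa> * Y.Pr x (reaches 0 (k - 2) {k - 2..})"
        using 1 \<kappa> ab by (intro mult_left_mono) auto
      ultimately show ?thesis by linarith
    qed
    show "escape_prob KY 1 k * partial_D ?r k l \<le> 16 / a" if kl: "K0 + 3 \<le> k" "k < l" for k l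
    proof -
      have D: "0 \<le> partial_D ?r k l" using partial_D_ge_1[OF kl] by simp
      have "escape_prob KY 1 k * partial_D ?r k l \<le> Y.hit k l * partial_D ?r k l"
        unfolding Y_escape_prob using D by (intro mult_right_mono Y.prob_stay_le_reaches) auto
      also have "\<dots> \<le> 16 / a" using bounds(1)[of k l] kl by simp
      finally show ?thesis .
    qed
    show "\<kappa> * (a / 16) \<le> escape_prob KY 1 k * d"
      if k: "K0 + 3 \<le> k" and d: "\<And>l. k < l \<Longrightarrow> partial_D ?r k l \<le> d" for k d
    proof -
      have d1: "1 \<le> d" using d[of "k + 1"] partial_D_ge_1[OF k, of "k + 1"] by simp
      have "a / 16 / d \<le> Y.Pr (k + 1) (\<lambda>w. \<forall>m. k + 1 \<le> w m)"
      proof (rule Y.prob_stay_ge[of _ "k + 1"])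
        fix l assume "k + 1 < l"
        then have kl: "k < l" by simp
        have D: "0 < partial_D ?r k l" "partial_D ?r k l \<le> d" using partial_D_ge_1[OF k kl] d[OF kl] by auto
        have "a / 16 / d \<le> a / 16 / partial_D ?r k l"
          using D d1 ab by (intro divide_left_mono) auto
        also have "\<dots> \<le> Y.hit k l"
          using bounds(2)[of k l] k kl D by (simp add: field_simps)
        finally show "a / 16 / d \<le> Y.hit k l" .
      qed simp
      then have "a / 16 \<le> escape_prob KY 1 k * d"
        unfolding Y_escape_prob using d1 by (simp add: field_simps)
      moreover have "\<kappa> * (a / 16) \<le> 1 * (a / 16)" using \<kappa> ab by (intro mult_right_mono) auto
      ultimately show ?thesis by linarith
    qed
    show "link_prob KY 1 j k * partial_D ?r j k \<le> 16 / a" if jk: "K0 + 3 \<le> j" "j < k" for j k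
    proof -
      have D: "0 \<le> partial_D ?r j k" using partial_D_ge_1[OF jk] by simp
      have "link_prob KY 1 j k \<le> Y.hit j k"
        unfolding Y_link_prob[OF jk(2)]
      proof (rule prob_mono_AE)
        have "{k + 1} \<subseteq> {k..}" by simp
        then show "AE w in path_law KY (j + 1). reaches (j + 1) k {k + 1} w \<longrightarrow> reaches (j + 1) k {k..} w"
          by (intro AE_I2 impI) (rule reaches_mono)
      qed measurable
      then have "link_prob KY 1 j k * partial_D ?r j k \<le> Y.hit j k * partial_D ?r j k"
        using D by (intro mult_right_mono) auto
      also have "\<dots> \<le> 16 / a" using bounds(1)[of j k] jk by simp
      finally show ?thesis .
    qed
    \<comment> \<open>\<open>j + 4 \<le> k\<close> is what \<open>Y_overshoot\<close> asks for with
      \<open>lo = j + 1\<close>. The exit is estimated at level \<open>k - 2\<close>; replacing this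
      by \<open>k\<close> only enlarges \<open>partial_D\<close>.\<close>
    show "\<kappa> * (a / 16) \<le> link_prob KY 1 j k * partial_D ?r j k" if "K0 + 3 \<le> j" "j + 4 \<le> k" for j k
    proof -
      have jk: "K0 + 3 \<le> j" "j < k - 2" using that by auto
      have D: "0 \<le> partial_D ?r j (k - 2)" using partial_D_ge_1[OF jk] by simp
      have Dm: "partial_D ?r j (k - 2) \<le> partial_D ?r j k"
      proof (rule partial_D_mono)
        fix l assume "j < l"
        then show "0 \<le> ?r l" using r[of l] jk by simp
      qed simp
      have "\<kappa> * (a / 16) \<le> \<kappa> * (Y.hit j (k - 2) * partial_D ?r j (k - 2))"
        using bounds(2)[of j "k - 2"] jk \<kappa> by (intro mult_left_mono) auto
      also have "\<dots> = \<kappa> * Y.hit j (k - 2) * partial_D ?r j (k - 2)" by simp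
      also have "\<dots> \<le> link_prob KY 1 j k * partial_D ?r j k"
      proof (rule mult_mono)
        have "j < k" using that by simp
        then show "\<kappa> * Y.hit j (k - 2) \<le> link_prob KY 1 j k"
          unfolding \<kappa>_def Y_link_prob[OF \<open>j < k\<close>] using that by (intro Y_overshoot) auto
        show "0 \<le> link_prob KY 1 j k" by (simp add: link_prob_def)
      qed (use D Dm in auto)
      finally show ?thesis .
    qed
  qed
qed

end

text \<open>With \<open>b = 1 - a\<close> the discriminant \<open>a\<^sup>2 + 4 * b\<close> is the
  square of \<open>2 - a\<close>, which is positive because \<open>a < 1\<close>.\<close>

lemma rho_tendsto_1:
  assumes "a_seq q p1 p2 \<longlonglongrightarrow> a" "b_seq q p1 p2 \<longlonglongrightarrow> b" "a + b = 1" "b > 0"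
  shows "rho q p1 p2 \<longlonglongrightarrow> 1"
proof -
  have "(\<lambda>k. (a_seq q p1 p2 k + sqrt ((a_seq q p1 p2 k)\<^sup>2 + 4 * b_seq q p1 p2 k)) / 2)
      \<longlonglongrightarrow> (a + sqrt (a\<^sup>2 + 4 * b)) / 2"
    by (intro tendsto_intros assms) simp
  moreover have "a\<^sup>2 + 4 * b = (2 - a)\<^sup>2"
  proof -
    have "b = 1 - a" using assms by simp
    then show ?thesis by (simp add: power2_eq_square algebra_simps)
  qed
  then have "sqrt (a\<^sup>2 + 4 * b) = 2 - a" using assms by simp
  ultimately show ?thesis by (simp add: rho_def[abs_def])
qed

lemma eventually_walk_bounds:
  assumes probs: "\<forall>k\<ge>2. q k > 0 \<and> p1 k \<ge> 0 \<and> p2 k > 0 \<and> q k + p1 k + p2 k = 1"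
    and lim: "a_seq q p1 p2 \<longlonglongrightarrow> a" "b_seq q p1 p2 \<longlonglongrightarrow> b"
    and ab: "a > 0" "b > 0" "a + b = 1"
  shows "\<exists>K\<ge>N. walk_bounds q p1 p2 a b K"
proof -
  note lim_rho = rho_tendsto_1[OF lim ab(3,2)]
  have "\<forall>\<^sub>F k in sequentially. a / 2 < a_seq q p1 p2 k"
    by (rule order_tendstoD(1)[OF lim(1)]) (use ab in simp)
  moreover have "\<forall>\<^sub>F k in sequentially. a_seq q p1 p2 k < 2"
    by (rule order_tendstoD(2)[OF lim(1)]) (use ab in simp)
  moreover have "\<forall>\<^sub>F k in sequentially. b / 2 < b_seq q p1 p2 k"
    by (rule order_tendstoD(1)[OF lim(2)]) (use ab in simp)
  moreover have "\<forall>\<^sub>F k in sequentially. 1 / 2 < rho q p1 p2 k"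
    by (rule order_tendstoD(1)[OF lim_rho]) simp
  moreover have "\<forall>\<^sub>F k in sequentially. rho q p1 p2 k < 2"
    by (rule order_tendstoD(2)[OF lim_rho]) simp
  ultimately have "\<forall>\<^sub>F k in sequentially. a / 2 < a_seq q p1 p2 k \<and> a_seq q p1 p2 k < 2 \<and>
      b / 2 < b_seq q p1 p2 k \<and> 1 / 2 < rho q p1 p2 k \<and> rho q p1 p2 k < 2"
    by eventually_elim auto
  then obtain K where K: "\<And>k. K \<le> k \<Longrightarrow> a / 2 < a_seq q p1 p2 k \<and> a_seq q p1 p2 k < 2 \<and>
      b / 2 < b_seq q p1 p2 k \<and> 1 / 2 < rho q p1 p2 k \<and> rho q p1 p2 k < 2"
    by (auto simp: eventually_sequentially)
  have "walk_bounds q p1 p2 a b (max (max K N) 2)"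
    by unfold_locales (use probs ab K in \<open>auto simp: less_imp_le\<close>)
  then show ?thesis by (intro exI[of _ "max (max K N) 2"]) auto
qed

section \<open>Transfer to the given chains\<close>

lemma AE_markov_chain:
  assumes "markov_chain M Z x (\<lambda>n m. pmf (K n) m)" "AE w in path_law K x. Q w"
  shows "AE \<omega> in M. Q (\<lambda>n. Z n \<omega>)"
  using markov_chain_law[OF assms(1)] assms(2) by (metis (mono_tags) AE_distrD)

context walk_bounds
begin

lemma X_finite_cutpoints_iff:
  "AE w in path_law KX 2. finite {k. \<exists>!n. w n = k} \<longleftrightarrow> finite {k. cut_at 0 k w}"
  using X_path[of 2]
proof eventually_elim
  case (elim w)
  then show ?case by (intro finite_Collect_iff_above[of 2] ex1_iff_cut_at) auto
qed

lemma Y_finite_cutpoints_iff: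
  "AE w in path_law KY 2. finite {k. \<forall>n. w n \<noteq> k} \<longleftrightarrow> finite {k. cut_at 1 k w}"
  using Y_path[of 2]
proof eventually_elim
  case (elim w)
  then show ?case by (intro finite_Collect_iff_above[of 2] never_iff_cut_at) auto
qed

end

theorem theorem1:
  fixes q p1 p2 :: "nat \<Rightarrow> real" and a b :: real
    and MX :: "'a measure" and X :: "nat \<Rightarrow> 'a \<Rightarrow> nat"
    and MY :: "'b measure" and Y :: "nat \<Rightarrow> 'b \<Rightarrow> nat"
  assumes probs: "\<forall>k\<ge>2. q k > 0 \<and> p1 k \<ge> 0 \<and> p2 k > 0 \<and> q k + p1 k + p2 k = 1"
    and X_chain: "markov_chain MX X 2 (trans21 q p1 p2)"
    and Y_chain: "markov_chain MY Y 2 (trans12 q p1 p2)"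
    and lim_a: "a_seq q p1 p2 \<longlonglongrightarrow> a"
    and lim_b: "b_seq q p1 p2 \<longlonglongrightarrow> b"
    and a_pos: "a > 0" and b_pos: "b > 0" and ab: "a + b = 1"
  shows
    "((\<exists>N0>0. \<forall>k l. N0 \<le> k \<longrightarrow> k \<le> l \<longrightarrow> rho q p1 p2 k \<le> rho q p1 p2 l) \<longrightarrow>
        (((\<Sum>n. 1 / (D_X q p1 p2 (n + 2) * ennreal (ln (real (n + 2))))) < \<infinity> \<longrightarrow>
            (AE \<omega> in MX. finite (cutpoints_X X \<omega>))) \<and>
         ((\<exists>\<delta>>0. \<forall>\<^sub>F n in sequentially.
               D_X q p1 p2 n \<le> ennreal (\<delta> * real n * ln (real n))) \<and>
          (\<Sum>n. 1 / (D_X q p1 p2 (n + 2) * ennreal (ln (real (n + 2))))) = \<infinity> \<longrightarrow>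
            (AE \<omega> in MX. infinite (cutpoints_X X \<omega>)))))
   \<and>
    ((\<exists>N0>0. \<forall>k l. N0 \<le> k \<longrightarrow> k \<le> l \<longrightarrow> rho q p1 p2 l \<le> rho q p1 p2 k) \<longrightarrow>
        (((\<Sum>n. 1 / (D_Y q p1 p2 (n + 2) * ennreal (ln (real (n + 2))))) < \<infinity> \<longrightarrow>
            (AE \<omega> in MY. finite (cutpoints_Y Y \<omega>))) \<and>
         ((\<exists>\<delta>>0. \<forall>\<^sub>F n in sequentially.
               D_Y q p1 p2 n \<le> ennreal (\<delta> * real n * ln (real n))) \<and>
          (\<Sum>n. 1 / (D_Y q p1 p2 (n + 2) * ennreal (ln (real (n + 2))))) = \<infinity> \<longrightarrow>
            (AE \<omega> in MY. infinite (cutpoints_Y Y \<omega>)))))"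
proof -
  let ?\<rho> = "rho q p1 p2"
  have lim: "?\<rho> \<longlonglongrightarrow> 1" by (rule rho_tendsto_1[OF lim_a lim_b ab b_pos])
  have DX: "D_X q p1 p2 = total_D ?\<rho>" by (intro ext) (simp add: D_X_def total_D_def)
  have DY: "D_Y q p1 p2 = total_D (\<lambda>i. inverse (?\<rho> i))" by (intro ext) (simp add: D_Y_def total_D_def)
  show ?thesis
  proof (intro conjI impI; (elim exE conjE)?)
    fix N0 :: nat assume mono: "\<forall>k l. N0 \<le> k \<longrightarrow> k \<le> l \<longrightarrow> ?\<rho> k \<le> ?\<rho> l"
    obtain K where K: "N0 \<le> K" "walk_bounds q p1 p2 a b K"
      using eventually_walk_bounds[OF probs lim_a lim_b a_pos b_pos ab] by blast
    interpret walk_bounds q p1 p2 a b K by fact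
    \<comment> \<open>An increasing sequence stays below its limit, so the ratios qualify for
      \<open>ratio_sequence\<close>.\<close>
    have le1: "?\<rho> k \<le> 1" if "K \<le> k" for k
      using that K mono by (intro LIMSEQ_le_const[OF lim]) (auto intro!: exI[of _ k])
    interpret cut_estimates ?\<rho> K KX 0 "1 / 12" "4 / a"
      by (rule X_cut_estimates) (use mono K le1 in auto)
    have chain: "markov_chain MX X 2 (\<lambda>n m. pmf (KX n) m)"
      using X_chain by (simp add: pmf_kernel21)
    {
      assume "(\<Sum>n. 1 / (D_X q p1 p2 (n + 2) * ennreal (ln (real (n + 2))))) < \<infinity>"
      then have "AE w in path_law KX 2. finite {k. cut_at 0 k w}"
        unfolding DX by (rule AE_finite_cuts)
      with X_finite_cutpoints_iff have "AE w in path_law KX 2. finite {k. \<exists>!n. w n = k}"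
        by eventually_elim simp
      from AE_markov_chain[OF chain this] show "AE \<omega> in MX. finite (cutpoints_X X \<omega>)"
        by (simp add: cutpoints_X_def)
    next
      fix \<delta> :: real
      assume "\<delta> > 0" "\<forall>\<^sub>F n in sequentially. D_X q p1 p2 n \<le> ennreal (\<delta> * real n * ln (real n))"
        "(\<Sum>n. 1 / (D_X q p1 p2 (n + 2) * ennreal (ln (real (n + 2))))) = \<infinity>"
      then have "AE w in path_law KX 2. infinite {k. cut_at 0 k w}"
        unfolding DX by (rule AE_infinite_cuts)
      then have "AE w in path_law KX 2. infinite {k. \<exists>!n. w n = k}"
        using X_finite_cutpoints_iff by eventually_elim simp
      from AE_markov_chain[OF chain this] show "AE \<omega> in MX. infinite (cutpoints_X X \<omega>)"
        by (simp add: cutpoints_X_def)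
    }
  next
    fix N0 :: nat assume mono: "\<forall>k l. N0 \<le> k \<longrightarrow> k \<le> l \<longrightarrow> ?\<rho> l \<le> ?\<rho> k"
    obtain K where K: "N0 \<le> K" "walk_bounds q p1 p2 a b K"
      using eventually_walk_bounds[OF probs lim_a lim_b a_pos b_pos ab] by blast
    interpret walk_bounds q p1 p2 a b K by fact
    \<comment> \<open>A decreasing sequence stays above its limit, so here the inverse ratios are at
      most 1.\<close>
    have ge1: "1 \<le> ?\<rho> k" if "K \<le> k" for k
      using that K mono by (intro LIMSEQ_le_const2[OF lim]) (auto intro!: exI[of _ k])
    interpret cut_estimates "\<lambda>i. inverse (?\<rho> i)" "K + 3" KY 1 "b\<^sup>2 / 108 * (a / 16)" "16 / a"
      by (rule Y_cut_estimates) (use mono K ge1 in auto)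
    have chain: "markov_chain MY Y 2 (\<lambda>n m. pmf (KY n) m)"
      using Y_chain by (simp add: pmf_kernel12)
    {
      assume "(\<Sum>n. 1 / (D_Y q p1 p2 (n + 2) * ennreal (ln (real (n + 2))))) < \<infinity>"
      then have "AE w in path_law KY 2. finite {k. cut_at 1 k w}"
        unfolding DY by (rule AE_finite_cuts)
      then have "AE w in path_law KY 2. finite {k. \<forall>n. w n \<noteq> k}"
        using Y_finite_cutpoints_iff by eventually_elim simp
      from AE_markov_chain[OF chain this] show "AE \<omega> in MY. finite (cutpoints_Y Y \<omega>)"
        by (simp add: cutpoints_Y_def)
    next
      fix \<delta> :: real
      assume "\<delta> > 0" "\<forall>\<^sub>F n in sequentially. D_Y q p1 p2 n \<le> ennreal (\<delta> * real n * ln (real n))"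
        "(\<Sum>n. 1 / (D_Y q p1 p2 (n + 2) * ennreal (ln (real (n + 2))))) = \<infinity>"
      then have "AE w in path_law KY 2. infinite {k. cut_at 1 k w}"
        unfolding DY by (rule AE_infinite_cuts)
      then have "AE w in path_law KY 2. infinite {k. \<forall>n. w n \<noteq> k}"
        using Y_finite_cutpoints_iff by eventually_elim simp
      from AE_markov_chain[OF chain this] show "AE \<omega> in MY. infinite (cutpoints_Y Y \<omega>)"
        by (simp add: cutpoints_Y_def)
    }
  qed
qed

end
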